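(* Let $\kappa\in\frac12\mathbb Z$ with $\kappa\ge2$, let $N\ge1$, let $N'=N$ if $\kappa\in\mathbb Z$ and $N'=4N$ otherwise, and let $\mathfrak f\in M_\kappa(\Gamma(N'))$ be a modular form which is not a cusp form, such that $a_{\mathfrak f}(n)=0$ for all $n$ with $\gcd(n,N')>1$. Then there exist infinitely many odd square-free $n$ with $a_{\mathfrak f}(n)\neq0$. More precisely, with $\mathfrak f'(\tau)=\mathfrak f(N'\tau)=\sum_{n}a_{\mathfrak f}(n)e^{2\pi in\tau}$ (so $a_{\mathfrak f'}(n)=a_{\mathfrak f}(n)$), \[\#\{n\le X:\ n\text{ square-free},\ a_{\mathfrak f'}(n)\neq0\}\gg X.\]
   Context: $M_\kappa(\Gamma(N'))$ is the space of holomorphic modular forms of weight $\kappa$ on the principal congruence subgroup $\Gamma(N')$ (for half-integral $\kappa$ with the standard theta multiplier), with Fourier expansion $\mathfrak f(\tau)=\sum_{n\ge0}a_{\mathfrak f}(n)e^{2\pi in\tau/N'}$. The implied constant depends on $\mathfrak f$. *)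

theory Defs
  imports
    "HOL-Complex_Analysis.Complex_Analysis"
    "HOL-Number_Theory.Cong"
    "HOL-Computational_Algebra.Squarefree"
    "HOL-Library.Landau_Symbols"
begin

definition upper_half_plane :: "complex set" where
  "upper_half_plane = {\<tau>. Im \<tau> > 0}"

text \<open>A quadruple \<open>(a, b, c, d)\<close> stands for the matrix with rows \<open>(a, b)\<close> and \<open>(c, d)\<close>.\<close>

type_synonym int_matrix2 = "int \<times> int \<times> int \<times> int"

definition SL2Z :: "int_matrix2 set" where
  "SL2Z = {(a, b, c, d). a * d - b * c = 1}"

definition principal_congruence_subgroup :: "nat \<Rightarrow> int_matrix2 set" where
  "principal_congruence_subgroup M =
     {(a, b, c, d). (a, b, c, d) \<in> SL2Z \<and>
        [a = 1] (mod int M) \<and> [b = 0] (mod int M) \<and> [c = 0] (mod int M) \<and> [d = 1] (mod int M)}"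

fun moebius :: "int_matrix2 \<Rightarrow> complex \<Rightarrow> complex" where
  "moebius (a, b, c, d) \<tau> = (of_int a * \<tau> + of_int b) / (of_int c * \<tau> + of_int d)"

fun cocycle :: "int_matrix2 \<Rightarrow> complex \<Rightarrow> complex" where
  "cocycle (a, b, c, d) \<tau> = of_int c * \<tau> + of_int d"

definition theta :: "complex \<Rightarrow> complex" where
  "theta \<tau> = (\<Sum>\<^sub>\<infinity>n\<in>(UNIV :: int set). exp (2 * of_real pi * \<i> * of_int (n ^ 2) * \<tau>))"

text \<open>
  In the half-integral case the automorphy factor is the \<open>2\<kappa>\<close>-th power of
  \<open>theta (\<gamma>\<tau>) / theta \<tau>\<close>.  This is an automorphy factor of weight \<open>\<kappa>\<close> on subgroups of the
  Hecke congruence group of level 4, so it is only meant to be used for levels divisible by 4.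
  Both exponents below are integers when \<open>2\<kappa>\<close> is, so that \<open>floor\<close> is merely a type conversion.
\<close>

definition automorphy_factor :: "real \<Rightarrow> int_matrix2 \<Rightarrow> complex \<Rightarrow> complex" where
  "automorphy_factor \<kappa> \<gamma> \<tau> =
     (if \<kappa> \<in> \<int> then cocycle \<gamma> \<tau> powi \<lfloor>\<kappa>\<rfloor>
      else (theta (moebius \<gamma> \<tau>) / theta \<tau>) powi \<lfloor>2 * \<kappa>\<rfloor>)"

text \<open>
  The expansion of \<open>f\<close> at the cusp \<open>\<gamma>\<infinity>\<close>.  For half-integral \<open>\<kappa>\<close> the principal branch of the
  power is used; another branch changes \<open>slash \<kappa> f \<gamma>\<close> only by a constant factor of modulus 1,
  which affects neither boundedness nor vanishing at \<open>\<i>\<infinity>\<close>.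
\<close>

definition slash :: "real \<Rightarrow> (complex \<Rightarrow> complex) \<Rightarrow> int_matrix2 \<Rightarrow> complex \<Rightarrow> complex" where
  "slash \<kappa> f \<gamma> \<tau> = cocycle \<gamma> \<tau> powr (- of_real \<kappa>) * f (moebius \<gamma> \<tau>)"

definition bounded_at_i_infinity :: "(complex \<Rightarrow> complex) \<Rightarrow> bool" where
  "bounded_at_i_infinity g \<longleftrightarrow> (\<exists>A B. \<forall>\<tau>. Im \<tau> \<ge> A \<longrightarrow> norm (g \<tau>) \<le> B)"

definition zero_at_i_infinity :: "(complex \<Rightarrow> complex) \<Rightarrow> bool" where
  "zero_at_i_infinity g \<longleftrightarrow> (g \<longlongrightarrow> 0) (filtercomap Im at_top)"

definition modular_forms :: "real \<Rightarrow> nat \<Rightarrow> (complex \<Rightarrow> complex) set" where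
  "modular_forms \<kappa> M =
     {f. f holomorphic_on upper_half_plane \<and>
         (\<forall>\<gamma>\<in>principal_congruence_subgroup M. \<forall>\<tau>\<in>upper_half_plane.
            f (moebius \<gamma> \<tau>) = automorphy_factor \<kappa> \<gamma> \<tau> * f \<tau>) \<and>
         (\<forall>\<gamma>\<in>SL2Z. bounded_at_i_infinity (slash \<kappa> f \<gamma>))}"

definition cusp_forms :: "real \<Rightarrow> nat \<Rightarrow> (complex \<Rightarrow> complex) set" where
  "cusp_forms \<kappa> M =
     {f \<in> modular_forms \<kappa> M. \<forall>\<gamma>\<in>SL2Z. zero_at_i_infinity (slash \<kappa> f \<gamma>)}"

text \<open>
  The coefficients \<open>a n\<close> in \<open>f \<tau> = (\<Sum>n. a n * exp (2 \<pi> \<i> n \<tau> / h))\<close> on the upper half-plane.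
  There is at most one such sequence for \<open>h > 0\<close>, and there is one for
  \<open>f \<in> modular_forms \<kappa> h\<close>, because the automorphy factor is 1 for the translation by \<open>h\<close>.
\<close>

definition fourier_coeff :: "nat \<Rightarrow> (complex \<Rightarrow> complex) \<Rightarrow> nat \<Rightarrow> complex" where
  "fourier_coeff h f =
     (THE a. \<forall>\<tau>\<in>upper_half_plane.
        (\<lambda>n. a n * exp (2 * of_real pi * \<i> * of_nat n * \<tau> / of_nat h)) sums f \<tau>)"

end

(*
Only |f| matters: |f(g tau)| = |c tau + d|^kappa |f(tau)| for g in Gamma(M), where the theta multiplier
enters through |theta(g tau)| = |c tau + d|^(1/2) |theta(tau)| alone.

Near a cusp a/c, |f(tau)| is |c tau - a|^(-kappa) times a slashed form. Choose the class of cusps modulo M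
where the supremum of the slashed form at i*infinity is maximal; it is positive as f is not cuspidal, and the
Phragmen-Lindelof principle makes the value nearly attained at every height. Represent the class by a/c with
c odd if M is odd and not divisible by p^2 for any prime p not dividing M. The condition that p^2 does not
divide n is imposed by a combination of the shifts tau + M j / p^2. Each nontrivial shift used sends the cusp to one
with denominator at least p times larger, hence to a smaller bound for |f|; as kappa >= 2, the error at p is
at most p^(-2) times the main term. The product of (1 + p^(-2)) over all primes p is below 2, so the sieved
series keeps a positive proportion of the size y^(-kappa) of f, uniformly in the number of primes used.

Bessel's inequality and Dirichlet approximation bound the second moment of the coefficients by the same order
of magnitude, and Cauchy-Schwarz then gives a positive proportion of n with nonzero sieved coefficient. The
n that survive without being squarefree are divisible by p^2 for some p > D, and their density is O(1/D).
*)

theory Submission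
  imports Defs "HOL-Probability.Probability" "HOL-Real_Asymp.Real_Asymp"
    "HOL-Analysis.Kronecker_Approximation_Theorem"
begin

section \<open>Matrices acting on the upper half-plane\<close>

text \<open>The obstacle is uniformity in the sieving range \<open>D\<close>. Non-squarefree
  integers that escape the sieve are negligible only if \<open>D\<close> is large compared with the
  constants of the lower bound, so none of these may depend on \<open>D\<close>. Three things secure
  this. One number \<open>\<Phi>\<close> bounds the slashed forms from above at every cusp and
  nearly from below at the chosen one, so every cusp reached by a shift can be compared with the
  main term. The losses at all primes together cost a factor of at most 5/3, and 9/10 - (5/3 - 1) *
  11/10 = 1/6 is still positive; an arbitrary cusp at which the form does not vanish would leave no
  such margin. The weights have absolute value at most 1 at every prime not dividing
  \<open>2 * c\<close>, so the cusp alone controls the size of the sieved coefficients. Only the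
  height from which the estimates hold depends on \<open>D\<close>. In half-integral weight the
  modulus of theta is needed on all of Gamma_0(4). It comes from Poisson summation for the Gaussian,
  which gives the inversion, and from a Euclidean descent to upper and lower triangular
  matrices.\<close>

fun mat_mult :: "int_matrix2 \<Rightarrow> int_matrix2 \<Rightarrow> int_matrix2" where
  "mat_mult (a, b, c, d) (a', b', c', d') =
     (a * a' + b * c', a * b' + b * d', c * a' + d * c', c * b' + d * d')"

fun mat_inv :: "int_matrix2 \<Rightarrow> int_matrix2" where
  "mat_inv (a, b, c, d) = (d, -b, -c, a)"

lemma upper_half_plane_iff [simp]: "\<tau> \<in> upper_half_plane \<longleftrightarrow> Im \<tau> > 0"
  by (simp add: upper_half_plane_def)

lemma open_upper_half_plane: "open upper_half_plane"
  unfolding upper_half_plane_def by (rule open_halfspace_Im_gt)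

lemma convex_upper_half_plane: "convex upper_half_plane"
  unfolding upper_half_plane_def by (rule convex_halfspace_Im_gt)

lemma SL2Z_iff: "(a, b, c, d) \<in> SL2Z \<longleftrightarrow> a * d - b * c = 1"
  by (simp add: SL2Z_def)

lemma mat_mult_SL2Z: "A \<in> SL2Z \<Longrightarrow> B \<in> SL2Z \<Longrightarrow> mat_mult A B \<in> SL2Z"
proof -
  assume A: "A \<in> SL2Z" and B: "B \<in> SL2Z"
  obtain a b c d where A': "A = (a, b, c, d)" by (cases A) auto
  obtain p q r s where B': "B = (p, q, r, s)" by (cases B) auto
  have "(a * p + b * r) * (c * q + d * s) - (a * q + b * s) * (c * p + d * r)
      = (a * d - b * c) * (p * s - q * r)" by algebra
  then show ?thesis using A B by (simp add: A' B' SL2Z_iff)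
qed

lemma mat_inv_SL2Z: "A \<in> SL2Z \<Longrightarrow> mat_inv A \<in> SL2Z"
  by (cases A) (simp add: SL2Z_iff algebra_simps)

lemma cocycle_nonzero:
  assumes "A \<in> SL2Z" "Im \<tau> > 0"
  shows "cocycle A \<tau> \<noteq> 0"
proof -
  obtain a b c d where A: "A = (a, b, c, d)" by (cases A) auto
  show ?thesis
  proof
    assume "cocycle A \<tau> = 0"
    then have eq: "of_int c * \<tau> + of_int d = 0" by (simp add: A)
    then have "Im (of_int c * \<tau> + of_int d) = 0" by simp
    then have "c = 0" using assms by simp
    moreover have "d = 0" using eq \<open>c = 0\<close> by simp
    ultimately show False using assms by (simp add: A SL2Z_iff)
  qed
qed

lemma Im_moebius:
  assumes "A \<in> SL2Z" "Im \<tau> > 0"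
  shows "Im (moebius A \<tau>) = Im \<tau> / (norm (cocycle A \<tau>))\<^sup>2"
proof -
  obtain a b c d where A: "A = (a, b, c, d)" by (cases A) auto
  define w where "w = of_int c * \<tau> + (of_int d :: complex)"
  have det: "real_of_int a * real_of_int d - real_of_int b * real_of_int c = 1"
    using assms(1) by (simp add: A SL2Z_iff flip: of_int_mult of_int_diff)
  have "moebius A \<tau> = (of_int a * \<tau> + of_int b) / w" by (simp add: A w_def)
  then have "Im (moebius A \<tau>) = Im ((of_int a * \<tau> + of_int b) * cnj w) / (norm w)\<^sup>2"
    by (simp add: complex_div_cnj[of _ w])
  moreover have "Im ((of_int a * \<tau> + of_int b) * cnj w)
      = (real_of_int a * real_of_int d - real_of_int b * real_of_int c) * Im \<tau>"
    by (simp add: w_def algebra_simps)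
  ultimately show ?thesis by (simp add: det A w_def)
qed

lemma moebius_upper_half_plane: "A \<in> SL2Z \<Longrightarrow> Im \<tau> > 0 \<Longrightarrow> Im (moebius A \<tau>) > 0"
  by (simp add: Im_moebius cocycle_nonzero)

lemma mat_mult_moebius_cocycle:
  assumes "A \<in> SL2Z" "B \<in> SL2Z" "Im \<tau> > 0"
  shows "moebius (mat_mult A B) \<tau> = moebius A (moebius B \<tau>)" (is ?M)
    and "cocycle (mat_mult A B) \<tau> = cocycle A (moebius B \<tau>) * cocycle B \<tau>" (is ?C)
proof -
  obtain a b c d where A: "A = (a, b, c, d)" by (cases A) auto
  obtain p q r s where B: "B = (p, q, r, s)" by (cases B) auto
  define w where "w = of_int r * \<tau> + (of_int s :: complex)"
  have w: "w \<noteq> 0" using cocycle_nonzero[OF assms(2,3)] by (simp add: B w_def)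
  have mB: "moebius B \<tau> = (of_int p * \<tau> + of_int q) / w" by (simp add: B w_def)
  show C: ?C using w by (simp add: A mB) (simp add: A B w_def field_simps)
  have "cocycle A (moebius B \<tau>) \<noteq> 0"
    using assms by (intro cocycle_nonzero moebius_upper_half_plane)
  then have nz: "of_int c * ((of_int p * \<tau> + of_int q) / w) + of_int d \<noteq> 0" by (simp add: A mB)
  define X where "X = of_int p * \<tau> + (of_int q :: complex)"
  have "moebius (mat_mult A B) \<tau> = (of_int a * X + of_int b * w) / (of_int c * X + of_int d * w)"
    by (simp add: A B w_def X_def algebra_simps)
  also have "of_int a * X + of_int b * w = w * (of_int a * (X / w) + of_int b)"
    using w by (simp add: algebra_simps)
  also have "of_int c * X + of_int d * w = w * (of_int c * (X / w) + of_int d)"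
    using w by (simp add: algebra_simps)
  also have "w * (of_int a * (X / w) + of_int b) / (w * (of_int c * (X / w) + of_int d))
      = moebius A (moebius B \<tau>)"
    unfolding mB A X_def[symmetric] moebius.simps using w by (intro mult_divide_mult_cancel_left)
  finally show ?M .
qed

lemma mat_mult_inv: 
  "A \<in> SL2Z \<Longrightarrow> mat_mult A (mat_inv A) = (1, 0, 0, 1)"
  "A \<in> SL2Z \<Longrightarrow> mat_mult (mat_inv A) A = (1, 0, 0, 1)"
  by (cases A; simp add: SL2Z_iff algebra_simps)+

lemma moebius_inv:
  assumes "A \<in> SL2Z" "Im \<tau> > 0"
  shows "moebius A (moebius (mat_inv A) \<tau>) = \<tau>" "moebius (mat_inv A) (moebius A \<tau>) = \<tau>"
  using mat_mult_moebius_cocycle(1)[of A "mat_inv A" \<tau>] mat_mult_moebius_cocycle(1)[of "mat_inv A" A \<tau>]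
  by (simp_all add: assms mat_inv_SL2Z mat_mult_inv)

lemma principal_congruence_subgroup_SL2Z: "A \<in> principal_congruence_subgroup M \<Longrightarrow> A \<in> SL2Z"
  by (auto simp: principal_congruence_subgroup_def)

lemma translation_SL2Z: "(1, k, 0, 1) \<in> SL2Z"
  by (simp add: SL2Z_iff)

section \<open>Poisson summation for the Gaussian\<close>

text \<open>The substitution x -> \<open>r * x\<close> with \<open>r = sqrt (2 * pi * t)\<close>
  matches this Gaussian with the standard normal density, so integrability and value are read off
  from the characteristic function of the normal distribution.\<close>

lemma gaussian_fourier_transform:
  fixes t s :: real
  assumes t: "t > 0"
  shows "integrable lborel (\<lambda>x. complex_of_real (exp (- pi * t * x\<^sup>2)) * exp (- 2 * pi * \<i> * s * x))" (is ?I)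
    and "(LINT x|lborel. complex_of_real (exp (- pi * t * x\<^sup>2)) * exp (- 2 * pi * \<i> * s * x))
           = exp (- pi * s\<^sup>2 / t) / sqrt t" (is ?V)
proof -
  define r where "r = sqrt (2 * pi * t)"
  have r: "r > 0" "r\<^sup>2 = 2 * pi * t" using t by (simp_all add: r_def)
  \<comment> \<open>Chosen so that \<open>\<sigma> * (r * x)\<close> is the phase -2 pi s x.\<close>
  define \<sigma> where "\<sigma> = - 2 * pi * s / r"
  define f where "f = (\<lambda>x. std_normal_density x *\<^sub>R iexp (\<sigma> * x))"
  have "integrable std_normal_distribution (\<lambda>x. iexp (\<sigma> * x))"
    using real_dist_normal_dist prob_space_normal_density[of 1 0]
    by (intro finite_measure.integrable_const_bound[where B=1])
       (auto simp: real_distribution_def prob_space_def prob_space_axioms_def)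
  then have If: "integrable lborel f"
    by (simp add: f_def integrable_density)
  have "char std_normal_distribution \<sigma> = (LINT x|lborel. f x)"
    by (simp add: char_def f_def integral_density)
  then have Vf: "(LINT x|lborel. f x) = exp (- (\<sigma>^2) / 2)"
    by (simp add: char_std_normal_distribution)
  have f_eq: "f (0 + r * x) = (1 / sqrt (2 * pi)) *\<^sub>R
      (complex_of_real (exp (- pi * t * x\<^sup>2)) * exp (- 2 * pi * \<i> * s * x))" for x
  proof -
    have "(r * x)\<^sup>2 / 2 = pi * t * x\<^sup>2" by (simp add: power_mult_distrib r)
    moreover have "\<sigma> * (r * x) = - 2 * pi * s * x" using r by (simp add: \<sigma>_def)
    moreover have "exp (\<i> * of_real (- 2 * pi * s * x)) = exp (- 2 * pi * \<i> * s * x)"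
      by (simp add: algebra_simps)
    ultimately show ?thesis
      unfolding f_def std_normal_density_def
      by (simp add: scaleR_conv_of_real del: exp_of_real)
  qed
  have "integrable lborel (\<lambda>x. f (0 + r * x))"
    using If r by (intro lborel_integrable_real_affine) auto
  then have I2: "integrable lborel (\<lambda>x. (1 / sqrt (2 * pi)) *\<^sub>R
      (complex_of_real (exp (- pi * t * x\<^sup>2)) * exp (- 2 * pi * \<i> * s * x)))"
    by (simp only: f_eq)
  have "integrable lborel (\<lambda>x. sqrt (2 * pi) *\<^sub>R (1 / sqrt (2 * pi)) *\<^sub>R
      (complex_of_real (exp (- pi * t * x\<^sup>2)) * exp (- 2 * pi * \<i> * s * x)))"
    by (rule integrable_scaleR_right) (rule I2)
  moreover have "sqrt (2 * pi) *\<^sub>R (1 / sqrt (2 * pi)) *\<^sub>R z = z" for z :: complex by simp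
  ultimately show ?I by (simp only:)
  have "(LINT x|lborel. f x) = r *\<^sub>R (LINT x|lborel. f (0 + r * x))"
    using lborel_integral_real_affine[of r f 0] r by simp
  also have "\<dots> = r *\<^sub>R (1 / sqrt (2 * pi)) *\<^sub>R
      (LINT x|lborel. complex_of_real (exp (- pi * t * x\<^sup>2)) * exp (- 2 * pi * \<i> * s * x))"
    unfolding f_eq by (subst integral_scaleR_right) auto
  also have "\<dots> = sqrt t *\<^sub>R
      (LINT x|lborel. complex_of_real (exp (- pi * t * x\<^sup>2)) * exp (- 2 * pi * \<i> * s * x))"
    by (simp add: r_def real_sqrt_mult)
  finally have "complex_of_real (sqrt t) * (LINT x|lborel. complex_of_real (exp (- pi * t * x\<^sup>2)) * exp (- 2 * pi * \<i> * s * x))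
      = exp (- (\<sigma>^2) / 2)"
    using Vf by (simp add: scaleR_conv_of_real)
  moreover have "\<sigma>\<^sup>2 / 2 = pi * s\<^sup>2 / t"
  proof -
    have "\<sigma>\<^sup>2 / 2 = (2 * pi * s)\<^sup>2 / (2 * pi * t) / 2" by (simp add: \<sigma>_def power_divide r)
    then show ?thesis using t by (simp add: field_simps power2_eq_square)
  qed
  ultimately show ?V using t by (simp add: field_simps)
qed

text \<open>Integration by parts gives the explicit rate O(1 / |s k|), with a constant made of
  bounds for \<open>H\<close> and its derivative on the segment; holomorphy supplies the continuous
  derivative.\<close>

lemma riemann_lebesgue_holomorphic:
  fixes H :: "complex \<Rightarrow> complex" and s :: "nat \<Rightarrow> real"
  assumes H: "H holomorphic_on A" "open A" "of_real ` {a..b} \<subseteq> A" and ab: "a \<le> b"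
    and s: "filterlim s at_infinity sequentially"
  shows "(\<lambda>k. integral {a..b} (\<lambda>x. H (of_real x) * exp (\<i> * s k * x))) \<longlonglongrightarrow> 0"
proof -
  have cH: "continuous_on {a..b} (\<lambda>x. H (of_real x))"
    using H by (intro continuous_on_compose2[OF holomorphic_on_imp_continuous_on[OF H(1)]] continuous_intros) auto
  have cdH: "continuous_on {a..b} (\<lambda>x. deriv H (of_real x))"
    using H by (intro continuous_on_compose2[OF holomorphic_on_imp_continuous_on[OF holomorphic_deriv[OF H(1,2)]]] continuous_intros) auto
  obtain B where B: "\<forall>x\<in>{a..b}. norm (H (of_real x)) \<le> B"
    using compact_imp_bounded[OF compact_continuous_image[OF cH compact_Icc]]
    unfolding bounded_iff by auto
  obtain B' where B': "\<forall>x\<in>{a..b}. norm (deriv H (of_real x)) \<le> B'"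
    using compact_imp_bounded[OF compact_continuous_image[OF cdH compact_Icc]]
    unfolding bounded_iff by auto
  have bound: "norm (integral {a..b} (\<lambda>x. H (of_real x) * exp (\<i> * r * x))) \<le> (2 * B + B' * (b - a)) / norm r"
    if r: "r \<noteq> 0" for r :: real
  proof -
    let ?I = "integral {a..b} (\<lambda>x. H (of_real x) * exp (\<i> * r * x))"
    let ?J = "integral {a..b} (\<lambda>x. deriv H (of_real x) * exp (\<i> * r * x))"
    have "((\<lambda>x. deriv H (of_real x) * exp (\<i> * r * x) + (\<i> * r) * (H (of_real x) * exp (\<i> * r * x)))
       has_integral (H (of_real b) * exp (\<i> * r * b) - H (of_real a) * exp (\<i> * r * a))) {a..b}"
    proof (rule fundamental_theorem_of_calculus[OF ab])
      fix x assume x: "x \<in> {a..b}"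
      have "(H has_field_derivative deriv H (of_real x)) (at (of_real x))"
        using H x by (intro holomorphic_derivI[of H A]) auto
      then have "((\<lambda>x. H (of_real x)) has_vector_derivative deriv H (of_real x)) (at x)"
        by (rule has_vector_derivative_real_field)
      moreover have "((\<lambda>z. exp (\<i> * r * z)) has_field_derivative (\<i> * r) * exp (\<i> * r * of_real x)) (at (of_real x))"
        by (auto intro!: derivative_eq_intros)
      then have "((\<lambda>x. exp (\<i> * r * of_real x)) has_vector_derivative (\<i> * r) * exp (\<i> * r * of_real x)) (at x)"
        by (rule has_vector_derivative_real_field)
      ultimately have "((\<lambda>x. H (of_real x) * exp (\<i> * r * x)) has_vector_derivative
          (H (of_real x) * ((\<i> * r) * exp (\<i> * r * of_real x)) + deriv H (of_real x) * exp (\<i> * r * x))) (at x)"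
        by (rule has_vector_derivative_mult)
      then show "((\<lambda>x. H (of_real x) * exp (\<i> * r * x)) has_vector_derivative
          (deriv H (of_real x) * exp (\<i> * r * x) + (\<i> * r) * (H (of_real x) * exp (\<i> * r * x)))) (at x within {a..b})"
        by (auto simp: algebra_simps intro: has_vector_derivative_at_within)
    qed
    moreover have "((\<lambda>x. deriv H (of_real x) * exp (\<i> * r * x) + (\<i> * r) * (H (of_real x) * exp (\<i> * r * x)))
       has_integral (?J + (\<i> * r) * ?I)) {a..b}"
      by (intro has_integral_add has_integral_mult_right integrable_integral integrable_continuous_interval
            continuous_intros cH cdH)
    ultimately have "?J + (\<i> * r) * ?I = H (of_real b) * exp (\<i> * r * b) - H (of_real a) * exp (\<i> * r * a)"
      by (rule has_integral_unique[rotated])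
    then have "(\<i> * r) * ?I = H (of_real b) * exp (\<i> * r * b) - H (of_real a) * exp (\<i> * r * a) - ?J"
      by (simp add: algebra_simps)
    moreover have "norm r * norm ?I = norm ((\<i> * r) * ?I)" by (simp add: norm_mult)
    ultimately have "norm r * norm ?I = norm (H (of_real b) * exp (\<i> * r * b) - H (of_real a) * exp (\<i> * r * a) - ?J)"
      by (simp only:)
    also have "\<dots> \<le> norm (H (of_real b) * exp (\<i> * r * b)) + norm (H (of_real a) * exp (\<i> * r * a)) + norm ?J"
      by (intro order_trans[OF norm_triangle_ineq4] add_mono norm_triangle_ineq4 order_refl)
    also have "norm (H (of_real b) * exp (\<i> * r * b)) \<le> B" using B ab by (simp add: norm_mult)
    also have "norm (H (of_real a) * exp (\<i> * r * a)) \<le> B" using B ab by (simp add: norm_mult)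
    also have "norm ?J \<le> B' * (b - a)"
    proof (rule integral_bound[OF ab])
      show "continuous_on {a..b} (\<lambda>x. deriv H (of_real x) * exp (\<i> * r * x))"
        by (intro continuous_intros cdH)
    qed (use B' in \<open>auto simp: norm_mult\<close>)
    finally show ?thesis using r by (simp add: field_simps)
  qed
  have "((\<lambda>k. (2 * B + B' * (b - a)) / norm (s k)) \<longlongrightarrow> 0) sequentially"
    by (intro tendsto_divide_0[OF tendsto_const] filterlim_at_top_imp_at_infinity
              filterlim_at_infinity_imp_norm_at_top s)
  then show ?thesis
  proof (rule Lim_null_comparison[rotated])
    have "eventually (\<lambda>k. s k \<noteq> 0) sequentially"
      using s by (simp add: filterlim_at_infinity_imp_eventually_ne)
    then show "\<forall>\<^sub>F k in sequentially. norm (integral {a..b} (\<lambda>x. H (of_real x) * exp (\<i> * s k * x))) \<le> (2 * B + B' * (b - a)) / norm (s k)"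
      by eventually_elim (use bound in auto)
  qed
qed

lemma has_integral_exp_times:
  fixes c :: complex
  assumes "c \<noteq> 0" "a \<le> b"
  shows "((\<lambda>x. exp (c * of_real x)) has_integral (exp (c * of_real b) / c - exp (c * of_real a) / c)) {a..b}"
proof (rule fundamental_theorem_of_calculus[OF assms(2)])
  fix x :: real
  have "((\<lambda>z. exp (c * z) / c) has_field_derivative exp (c * of_real x)) (at (of_real x))"
    using assms(1) by (auto intro!: derivative_eq_intros)
  from has_vector_derivative_real_field[OF this]
  show "((\<lambda>x. exp (c * of_real x) / c) has_vector_derivative exp (c * of_real x)) (at x within {a..b})"
    by (rule has_vector_derivative_at_within)
qed

text \<open>Chernoff's argument: dividing \<open>F z - F 0\<close> by \<open>exp (2 * pi * \<i> * z) - 1\<close> makes the sum of the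
  Fourier coefficients telescope.\<close>

lemma fourier_series_at_0:
  fixes F :: "complex \<Rightarrow> complex"
  assumes F: "F holomorphic_on UNIV"
  shows "(\<lambda>K::nat. \<Sum>k=-int K..int K. integral {-1/2..1/2} (\<lambda>x. F (of_real x) * exp (- 2 * pi * \<i> * k * x))) \<longlonglongrightarrow> F 0"
proof -
  \<comment> \<open>The strip contains the segment from -1/2 to 1/2 and no integer but 0. So 0 is
    the only zero of \<open>E\<close> there, and it is simple; the quotient \<open>H\<close> of
    \<open>F z - F 0\<close> by \<open>E z\<close> therefore extends holomorphically across
    0.\<close>
  define A where "A = {z::complex. -1 < Re z} \<inter> {z. Re z < 1}"
  have A: "open A" unfolding A_def by (intro open_Int open_halfspace_Re_lt open_halfspace_Re_gt)
  define E where "E = (\<lambda>z::complex. exp (2 * pi * \<i> * z) - 1)"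
  have E: "E holomorphic_on A" unfolding E_def by (intro holomorphic_intros)
  define D1 where "D1 = (\<lambda>z. if z = 0 then deriv F 0 else (F z - F 0) / (z - 0))"
  define D2 where "D2 = (\<lambda>z. if z = 0 then deriv E 0 else (E z - E 0) / (z - 0))"
  have D1: "D1 holomorphic_on A" unfolding D1_def using F A by (intro pole_lemma_open) (auto intro: holomorphic_on_subset)
  have D2: "D2 holomorphic_on A" unfolding D2_def using E A by (intro pole_lemma_open)
  have E0: "E 0 = 0" by (simp add: E_def)
  have "(E has_field_derivative 2 * pi * \<i>) (at 0)"
    unfolding E_def by (auto intro!: derivative_eq_intros)
  then have dE: "deriv E 0 = 2 * pi * \<i>" by (rule DERIV_imp_deriv)
  have E_nz: "E z \<noteq> 0" if "z \<in> A" "z \<noteq> 0" for z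
  proof
    assume "E z = 0"
    then have "exp (2 * pi * \<i> * z) = 1" by (simp add: E_def)
    then obtain n :: int where n: "Re (2 * pi * \<i> * z) = 0" "Im (2 * pi * \<i> * z) = of_int (2 * n) * pi"
      unfolding exp_eq_1 by blast
    then have "Im z = 0" "Re z = n" by auto
    moreover have "n = 0" using that \<open>Re z = n\<close> by (auto simp: A_def)
    ultimately show False using that by (auto simp: complex_eq_iff)
  qed
  have D2_nz: "D2 z \<noteq> 0" if "z \<in> A" for z
    using E_nz[OF that] by (simp add: D2_def dE E0)
  define H where "H = (\<lambda>z. D1 z / D2 z)"
  have H: "H holomorphic_on A" unfolding H_def using D1 D2 D2_nz by (intro holomorphic_intros) auto
  have FH: "F z = F 0 + H z * exp (2 * pi * \<i> * z) - H z" if "z \<in> A" for z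
  proof (cases "z = 0")
    case False
    then have "H z = (F z - F 0) / E z" using E_nz[OF that False] by (simp add: H_def D1_def D2_def E0)
    then have "H z * E z = F z - F 0" using E_nz[OF that False] by simp
    then show ?thesis by (simp add: E_def algebra_simps)
  qed simp
  have sub: "complex_of_real ` {-1/2..1/2} \<subseteq> A" by (auto simp: A_def)
  have cH: "continuous_on {-1/2..1/2} (\<lambda>x. H (of_real x))"
    using sub by (intro continuous_on_compose2[OF holomorphic_on_imp_continuous_on[OF H]] continuous_intros) auto
  define h where "h = (\<lambda>k::int. integral {-1/2..1/2} (\<lambda>x. H (of_real x) * exp (\<i> * of_real (- 2 * pi * k) * x)))"
  have delta: "integral {-1/2..1/2::real} (\<lambda>x. exp (- 2 * pi * \<i> * k * x)) = (if k = 0 then 1 else 0)" for k :: int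
  proof (cases "k = 0")
    case False
    define c where "c = - 2 * pi * \<i> * k"
    have c: "c \<noteq> 0" using False by (simp add: c_def)
    have "exp (c * of_real (1/2)) = exp (c * of_real (-1/2))"
      unfolding exp_eq by (intro exI[of _ "-k"]) (simp add: c_def algebra_simps)
    then show ?thesis
      using has_integral_exp_times[OF c, of "-1/2" "1/2"] False by (simp add: c_def integral_unique)
  qed simp
  have c: "integral {-1/2..1/2} (\<lambda>x. F (of_real x) * exp (- 2 * pi * \<i> * k * x))
      = F 0 * (if k = 0 then 1 else 0) + h (k - 1) - h k" for k :: int
  proof -
    have i1: "(\<lambda>x. F 0 * exp (- 2 * pi * \<i> * k * x)) integrable_on {-1/2..1/2::real}"
      by (intro integrable_continuous_interval continuous_intros)
    have i2: "(\<lambda>x. H (of_real x) * exp (\<i> * of_real (- 2 * pi * k) * x)) integrable_on {-1/2..1/2}" for k :: int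
      by (intro integrable_continuous_interval continuous_intros cH)
    have "integral {-1/2..1/2} (\<lambda>x. F (of_real x) * exp (- 2 * pi * \<i> * k * x))
        = integral {-1/2..1/2} (\<lambda>x. F 0 * exp (- 2 * pi * \<i> * k * x) 
           + H (of_real x) * exp (\<i> * of_real (- 2 * pi * (k - 1)) * x) - H (of_real x) * exp (\<i> * of_real (- 2 * pi * k) * x))"
    proof (rule integral_cong)
      fix x :: real assume "x \<in> {-1/2..1/2}"
      then have "of_real x \<in> A" using sub by blast
      have "exp (2 * pi * \<i> * x) * exp (- 2 * pi * \<i> * k * x) = exp (\<i> * of_real (- 2 * pi * (k - 1)) * x)"
        by (simp add: algebra_simps flip: exp_add)
      moreover have "exp (- 2 * pi * \<i> * k * x) = exp (\<i> * of_real (- 2 * pi * k) * x)"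
        by (simp add: algebra_simps)
      ultimately show "F (of_real x) * exp (- 2 * pi * \<i> * k * x) = F 0 * exp (- 2 * pi * \<i> * k * x) 
           + H (of_real x) * exp (\<i> * of_real (- 2 * pi * (k - 1)) * x) - H (of_real x) * exp (\<i> * of_real (- 2 * pi * k) * x)"
        by (subst FH[OF \<open>of_real x \<in> A\<close>]) (metis (no_types, lifting) distrib_right left_diff_distrib mult.assoc)
    qed
    also have "\<dots> = integral {-1/2..1/2::real} (\<lambda>x. F 0 * exp (- 2 * pi * \<i> * k * x)) + h (k - 1) - h k"
      unfolding h_def using i1 i2[of "k - 1"] i2[of k]
      by (simp only: integral_diff integral_add integrable_add)
    also have "integral {-1/2..1/2::real} (\<lambda>x. F 0 * exp (- 2 * pi * \<i> * k * x)) = F 0 * (if k = 0 then 1 else 0)"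
      unfolding integral_mult_right delta ..
    finally show ?thesis .
  qed
  have tele: "(\<Sum>k=-int K..int K. F 0 * (if k = 0 then 1 else 0) + h (k - 1) - h k) = F 0 + h (- int K - 1) - h (int K)" for K
  proof (induction K)
    case (Suc K)
    have "{-int (Suc K)..int (Suc K)} = insert (-int K - 1) (insert (int K + 1) {-int K..int K})" by auto
    then show ?case by (simp add: Suc.IH) (simp add: add.commute)
  qed simp
  have le: "- 1 / 2 \<le> (1 / 2 :: real)" by simp
  have L1: "filterlim (\<lambda>K. - 2 * pi * real_of_int (- int K - 1)) at_infinity sequentially"
  proof -
    have "filterlim (\<lambda>K. 2 * pi * (real K + 1)) at_top sequentially"
      by real_asymp
    moreover have "(\<lambda>K. - 2 * pi * real_of_int (- int K - 1)) = (\<lambda>K. 2 * pi * (real K + 1))"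
      by (simp add: fun_eq_iff algebra_simps)
    ultimately show ?thesis
      by (simp only: filterlim_at_top_imp_at_infinity)
  qed
  have L2: "filterlim (\<lambda>K. - 2 * pi * real_of_int (int K)) at_infinity sequentially"
  proof -
    have "filterlim (\<lambda>K. - 2 * pi * real K) at_bot sequentially"
      by real_asymp
    then show ?thesis
      by (simp only: of_int_of_nat_eq filterlim_at_bot_imp_at_infinity)
  qed
  have "(\<lambda>K. h (- int K - 1)) \<longlonglongrightarrow> 0"
    using riemann_lebesgue_holomorphic[OF H A sub le L1] by (simp only: h_def)
  moreover have "(\<lambda>K. h (int K)) \<longlonglongrightarrow> 0"
    using riemann_lebesgue_holomorphic[OF H A sub le L2] by (simp only: h_def)
  ultimately have "(\<lambda>K. F 0 + h (- int K - 1) - h (int K)) \<longlonglongrightarrow> F 0 + 0 - 0"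
    by (intro tendsto_intros)
  then show ?thesis by (simp only: c tele add_0_right diff_zero)
qed

section \<open>The periodized Gaussian and its Fourier coefficients\<close>

lemma summable_on_exp_abs_int:
  assumes "c > 0"
  shows "(\<lambda>n::int. exp (- c * \<bar>of_int n\<bar>) :: real) summable_on UNIV"
proof -
  have "summable (\<lambda>n. norm (exp (- c) ^ n))" using assms by (simp add: summable_geometric)
  then have "(\<lambda>n. exp (- c) ^ n) summable_on (UNIV :: nat set)"
    by (rule norm_summable_imp_summable_on)
  then have nat: "(\<lambda>n. exp (- (c * real n))) summable_on (UNIV :: nat set)"
  proof -
    have "exp (- c) ^ n = exp (- (c * real n))" for n
      by (simp add: mult.commute flip: exp_of_nat_mult)
    then show ?thesis using \<open>(\<lambda>n. exp (- c) ^ n) summable_on UNIV\<close> by (simp only:)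
  qed
  have "(\<lambda>n::int. exp (- c * \<bar>of_int n\<bar>)) summable_on range int"
    by (subst summable_on_reindex) (auto simp: o_def nat)
  moreover have "(\<lambda>n::int. exp (- c * \<bar>of_int n\<bar>)) summable_on range (\<lambda>n. - int n)"
    by (subst summable_on_reindex) (auto simp: o_def nat inj_on_def)
  moreover have "range int \<union> range (\<lambda>n. - int n) = UNIV"
    using int_cases2 by auto blast
  ultimately show ?thesis using summable_on_union by metis
qed

lemma filterlim_symmetric_int_interval:
  "filterlim (\<lambda>N. {- int N..int N}) (finite_subsets_at_top UNIV) sequentially"
proof (unfold filterlim_iff, intro allI impI)
  fix P assume "eventually P (finite_subsets_at_top (UNIV :: int set))"
  then obtain X where X: "finite X" "\<And>Y. finite Y \<Longrightarrow> X \<subseteq> Y \<Longrightarrow> P Y"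
    unfolding eventually_finite_subsets_at_top by auto
  obtain B where "\<forall>x\<in>X. \<bar>x\<bar> \<le> B"
    using X(1) by (metis Max_ge finite_imageI imageI)
  then have "X \<subseteq> {- int N..int N}" if "N \<ge> nat B" for N
    using that by fastforce
  then show "\<forall>\<^sub>F N in sequentially. P {- int N..int N}"
    unfolding eventually_sequentially using X(2) by blast
qed

definition periodized_gaussian :: "real \<Rightarrow> complex \<Rightarrow> complex" where
  "periodized_gaussian t z = (\<Sum>\<^sub>\<infinity>n\<in>(UNIV :: int set). exp (of_real (- pi * t) * (of_int n + z)\<^sup>2))"

lemma abs_int_le_square: "\<bar>real_of_int n\<bar> \<le> (real_of_int n)\<^sup>2"
proof -
  have "\<bar>n\<bar> * 1 \<le> \<bar>n\<bar> * \<bar>n\<bar>"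
    by (cases "n = 0", simp, intro mult_left_mono) auto
  then have "real_of_int \<bar>n\<bar> \<le> real_of_int (n * n)"
    unfolding of_int_le_iff by (simp add: abs_mult_self_eq)
  then show ?thesis by (simp add: power2_eq_square)
qed

text \<open>A majorant for the Weierstrass test, valid on the whole disc of radius \<open>R\<close>;
  |n| <= n^2 turns the Gaussian decay into a geometric one, which is simpler to sum.\<close>

lemma norm_gaussian_shift_le:
  fixes z :: complex
  assumes t: "t > 0" and z: "norm z \<le> R"
  shows "norm (exp (of_real (- pi * t) * (of_int n + z)\<^sup>2)) \<le> exp (2 * pi * t * R\<^sup>2) * exp (- (pi * t / 2) * \<bar>of_int n\<bar>)"
proof -
  let ?n = "real_of_int n"
  have re: "Re ((of_int n + z)\<^sup>2) = (?n + Re z)\<^sup>2 - (Im z)\<^sup>2"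
    by (simp add: power2_eq_square)
  have "(Re z)\<^sup>2 + (Im z)\<^sup>2 \<le> R\<^sup>2"
    using power_mono[OF z, of 2] by (simp add: cmod_def)
  then have b: "(Re z)\<^sup>2 \<le> R\<^sup>2" "(Im z)\<^sup>2 \<le> R\<^sup>2"
    using zero_le_power2[of "Re z"] zero_le_power2[of "Im z"] by linarith+
  \<comment> \<open>With x = \<open>Re z\<close>, half of this square is the difference of the sides
    of the next inequality: (n + x)^2 - (n^2 / 2 - x^2) = (n + 2 x)^2 / 2.\<close>
  have "0 \<le> (?n + 2 * Re z)\<^sup>2" by simp
  then have "?n\<^sup>2 / 2 - (Re z)\<^sup>2 \<le> (?n + Re z)\<^sup>2"
    by (simp add: power2_eq_square algebra_simps)
  then have "\<bar>?n\<bar> / 2 - 2 * R\<^sup>2 \<le> Re ((of_int n + z)\<^sup>2)"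
    using b abs_int_le_square[of n] unfolding re by linarith
  then have "(pi * t) * (\<bar>?n\<bar> / 2 - 2 * R\<^sup>2) \<le> (pi * t) * Re ((of_int n + z)\<^sup>2)"
    using t by (intro mult_left_mono) auto
  then have "- (pi * t * Re ((of_int n + z)\<^sup>2)) \<le> 2 * pi * t * R\<^sup>2 + (- (pi * t / 2) * \<bar>?n\<bar>)"
    by (simp add: algebra_simps)
  moreover have "norm (exp (of_real (- pi * t) * (of_int n + z)\<^sup>2)) = exp (- (pi * t * Re ((of_int n + z)\<^sup>2)))"
    by simp
  ultimately show ?thesis by (simp only: exp_add[symmetric] exp_le_cancel_iff)
qed

lemma uniform_limit_periodized_gaussian:
  assumes t: "t > 0"
  shows "uniform_limit (cball 0 R) (\<lambda>N (z::complex). \<Sum>n\<in>{- int N..int N}. exp (of_real (- pi * t) * (of_int n + z)\<^sup>2))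
           (periodized_gaussian t) sequentially"
proof -
  have "uniform_limit (cball 0 R) (\<lambda>X (z::complex). \<Sum>n\<in>X. exp (of_real (- pi * t) * (of_int n + z)\<^sup>2))
      (\<lambda>z. \<Sum>\<^sub>\<infinity>n\<in>(UNIV :: int set). exp (of_real (- pi * t) * (of_int n + z)\<^sup>2)) (finite_subsets_at_top UNIV)"
  proof (rule Weierstrass_m_test_general)
    show "(\<lambda>n::int. exp (2 * pi * t * R\<^sup>2) * exp (- (pi * t / 2) * \<bar>of_int n\<bar>)) summable_on UNIV"
      using t by (intro summable_on_cmult_right summable_on_exp_abs_int) auto
  qed (use norm_gaussian_shift_le[OF t] in auto)
  then show ?thesis
    unfolding periodized_gaussian_def[abs_def]
    by (rule filterlim_compose[OF _ filterlim_symmetric_int_interval])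
qed

lemma periodized_gaussian_holomorphic:
  assumes t: "t > 0"
  shows "periodized_gaussian t holomorphic_on UNIV"
proof (rule holomorphic_uniform_sequence[OF open_UNIV])
  show "(\<lambda>z. \<Sum>n\<in>{- int N..int N}. exp (of_real (- pi * t) * (of_int n + z)\<^sup>2)) holomorphic_on UNIV" for N
    by (intro holomorphic_intros)
  show "\<exists>d>0. cball x d \<subseteq> UNIV \<and> uniform_limit (cball x d) 
      (\<lambda>N z. \<Sum>n\<in>{- int N..int N}. exp (of_real (- pi * t) * (of_int n + z)\<^sup>2)) (periodized_gaussian t) sequentially" for x :: complex
  proof (intro exI[of _ 1] conjI)
    have "cball x 1 \<subseteq> cball 0 (norm x + 1)"
      by (auto simp: dist_norm norm_minus_commute) (smt (verit) norm_triangle_sub)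
    then show "uniform_limit (cball x 1) (\<lambda>N z. \<Sum>n\<in>{- int N..int N}. exp (of_real (- pi * t) * (of_int n + z)\<^sup>2))
        (periodized_gaussian t) sequentially"
      using uniform_limit_on_subset uniform_limit_periodized_gaussian[OF t] by blast
  qed auto
qed

text \<open>Half-integral endpoints, because the intervals [n - 1/2, n + 1/2] with |n| <= N fill
  exactly this one.\<close>

lemma integral_UNIV_symmetric_limit:
  fixes g :: "real \<Rightarrow> complex"
  assumes "(g has_integral I) UNIV"
  shows "(\<lambda>N. integral {- real N - 1/2..real N + 1/2} g) \<longlonglongrightarrow> I"
proof (rule LIMSEQ_I)
  fix e :: real assume "e > 0"
  then obtain B where B: "B > 0" "\<And>a b. ball 0 B \<subseteq> cbox a b \<Longrightarrow> norm (integral (cbox a b) g - I) < e"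
    using assms unfolding has_integral_alt'[of g] by auto
  show "\<exists>N0. \<forall>N\<ge>N0. norm (integral {- real N - 1/2..real N + 1/2} g - I) < e"
  proof (intro exI[of _ "nat \<lceil>B\<rceil>"] allI impI)
    fix N assume "N \<ge> nat \<lceil>B\<rceil>"
    then have "B \<le> real N" by linarith
    then have "ball 0 B \<subseteq> cbox (- real N - 1/2) (real N + 1/2)" by (auto simp: dist_norm)
    from B(2)[OF this] show "norm (integral {- real N - 1/2..real N + 1/2} g - I) < e" by simp
  qed
qed

text \<open>Unfolding: unit intervals around the integers tile the line and the character has period
  1, so a coefficient of the periodization is the Fourier transform of the Gaussian at
  \<open>k\<close>. Uniform convergence allows the exchange of sum and integral.\<close>

lemma fourier_coeff_periodized_gaussian:
  assumes t: "t > 0"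
  shows "integral {-1/2..1/2} (\<lambda>x. periodized_gaussian t (of_real x) * exp (- 2 * pi * \<i> * of_int k * x))
           = exp (- pi * (of_int k)\<^sup>2 / t) / sqrt t"
proof -
  define g where "g = (\<lambda>x::real. complex_of_real (exp (- pi * t * x\<^sup>2)) * exp (- 2 * pi * \<i> * of_int k * x))"
  have cg: "continuous_on A g" for A unfolding g_def by (intro continuous_intros)
  have "(g has_integral complex_of_real (exp (- pi * (of_int k)\<^sup>2 / t) / sqrt t)) UNIV"
    using has_integral_integral_lborel[OF gaussian_fourier_transform(1)[OF t, of "of_int k"]]
      gaussian_fourier_transform(2)[OF t, of "of_int k"] by (simp add: g_def)
  then have lim1: "(\<lambda>N. integral {- real N - 1/2..real N + 1/2} g) \<longlonglongrightarrow> exp (- pi * (of_int k)\<^sup>2 / t) / sqrt t"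
    by (rule integral_UNIV_symmetric_limit)
  define F where "F = (\<lambda>N x. (\<Sum>n\<in>{- int N..int N}. exp (of_real (- pi * t) * (of_int n + of_real x)\<^sup>2)) * exp (- 2 * pi * \<i> * of_int k * of_real x))"
  have F_g: "F N x = (\<Sum>n\<in>{- int N..int N}. g (of_int n + x))" for N x
  proof -
    have "exp (- 2 * pi * \<i> * of_int k * of_real (of_int n + x)) = exp (- 2 * pi * \<i> * of_int k * of_real x)" for n
      unfolding exp_eq by (intro exI[of _ "- k * n"]) (simp add: algebra_simps)
    moreover have "exp (of_real (- pi * t) * (of_int n + complex_of_real x)\<^sup>2) = complex_of_real (exp (- pi * t * (of_int n + x)\<^sup>2))" for n
      by (simp flip: exp_of_real)
    ultimately show ?thesis by (simp only: F_def g_def sum_distrib_right)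
  qed
  have int_F: "integral {-1/2..1/2} (F N) = integral {- real N - 1/2..real N + 1/2} g" for N
  proof -
    have "integral {-1/2..1/2} (F N) = (\<Sum>n\<in>{- int N..int N}. integral {-1/2..1/2} (\<lambda>x. g (of_int n + x)))"
      unfolding F_g[abs_def]
      by (intro integral_sum integrable_continuous_interval continuous_on_compose2[OF cg[of UNIV]] continuous_intros) auto
    also have "\<dots> = (\<Sum>n\<in>{- int N..int N}. integral {of_int n - 1/2..of_int n + 1/2} g)"
    proof (intro sum.cong refl)
      fix n :: int
      have "- 1/2 + of_int n = of_int n - (1/2 :: real)" "1/2 + of_int n = of_int n + (1/2 :: real)" by simp_all
      then show "integral {-1/2..1/2} (\<lambda>x. g (of_int n + x)) = integral {of_int n - 1/2..of_int n + 1/2} g"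
        using integral_shift_Icc_real[of "-1/2" "1/2" g "of_int n"] by (simp only: o_def)
    qed
    also have "\<dots> = integral {- real N - 1/2..real N + 1/2} g"
    proof (induction N)
      case (Suc N)
      have iv: "{- int (Suc N)..int (Suc N)} = insert (- int N - 1) (insert (int N + 1) {- int N..int N})" by auto
      have i: "g integrable_on {a..b}" for a b by (intro integrable_continuous_interval cg)
      have f1: "integral {- real N - 3/2..- real N - 1/2} g + integral {- real N - 1/2..real N + 1/2} g
          = integral {- real N - 3/2..real N + 1/2} g"
        by (intro Henstock_Kurzweil_Integration.integral_combine i) auto
      have f2: "integral {- real N - 3/2..real N + 1/2} g + integral {real N + 1/2..real N + 3/2} g
          = integral {- real N - 3/2..real N + 3/2} g"
        by (intro Henstock_Kurzweil_Integration.integral_combine i) auto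
      have e: "of_int (- int N - 1) - 1/2 = - real N - 3/2" "of_int (- int N - 1) + 1/2 = - real N - 1/2"
        "of_int (int N + 1) - 1/2 = real N + 1/2" "of_int (int N + 1) + 1/2 = real N + 3/2"
        "- real (Suc N) - 1/2 = - real N - 3/2" "real (Suc N) + 1/2 = real N + 3/2"
        by simp_all
      have "(\<Sum>n\<in>{- int (Suc N)..int (Suc N)}. h n) = h (- int N - 1) + (h (int N + 1) + (\<Sum>n\<in>{- int N..int N}. h n))"
        for h :: "int \<Rightarrow> complex"
        unfolding iv by simp
      then show ?case
        by (simp only: Suc.IH e f1[symmetric] f2[symmetric]) (simp only: ac_simps)
    qed simp
    finally show ?thesis .
  qed
  have "uniform_limit {-1/2..1/2} F (\<lambda>x. periodized_gaussian t (of_real x) * exp (- 2 * pi * \<i> * of_int k * of_real x)) sequentially"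
    unfolding F_def
  proof (rule uniform_lim_mult)
    have "uniform_limit {-1/2..1/2} (\<lambda>N x. (\<Sum>n\<in>{- int N..int N}. exp (of_real (- pi * t) * (of_int n + complex_of_real x)\<^sup>2)))
      (\<lambda>x. periodized_gaussian t (complex_of_real x)) sequentially"
      by (rule uniform_limit_compose'[OF uniform_limit_periodized_gaussian[OF t, of 1]]) auto
    then show "uniform_limit {-1/2..1/2} (\<lambda>N x. (\<Sum>n\<in>{- int N..int N}. exp (of_real (- pi * t) * (of_int n + complex_of_real x)\<^sup>2)))
      (\<lambda>x. periodized_gaussian t (complex_of_real x)) sequentially" .
    show "bounded ((\<lambda>x. periodized_gaussian t (complex_of_real x)) ` {-1/2..1/2})"
      by (intro compact_imp_bounded compact_continuous_image compact_Icc 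
        continuous_on_compose2[OF holomorphic_on_imp_continuous_on[OF periodized_gaussian_holomorphic[OF t]]] continuous_intros) auto
    show "bounded ((\<lambda>x. exp (- 2 * pi * \<i> * of_int k * complex_of_real x)) ` {-1/2..1/2})"
      by (intro compact_imp_bounded compact_continuous_image compact_Icc continuous_intros)
  qed (rule uniform_limit_const)
  then have lim2: "(\<lambda>N. integral {-1/2..1/2} (F N)) \<longlonglongrightarrow>
      integral {-1/2..1/2} (\<lambda>x. periodized_gaussian t (of_real x) * exp (- 2 * pi * \<i> * of_int k * of_real x))"
  proof -
    assume u: "uniform_limit {-1/2..1/2} F (\<lambda>x. periodized_gaussian t (of_real x) * exp (- 2 * pi * \<i> * of_int k * of_real x)) sequentially"
    have "continuous_on {-1/2..1/2} (F N)" for N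
      unfolding F_def by (intro continuous_intros)
    then obtain I J where IJ: "\<And>N. (F N has_integral I N) {-1/2..1/2}"
      "((\<lambda>x. periodized_gaussian t (of_real x) * exp (- 2 * pi * \<i> * of_int k * of_real x)) has_integral J) {-1/2..1/2}"
      "I \<longlonglongrightarrow> J"
      using uniform_limit_integral[OF u _ sequentially_bot] by blast
    have "I = (\<lambda>N. integral {-1/2..1/2} (F N))"
      using integral_unique[OF IJ(1)] by (simp add: fun_eq_iff)
    then show ?thesis using IJ(3) integral_unique[OF IJ(2)] by (simp only:)
  qed
  show ?thesis using LIMSEQ_unique[OF lim2 lim1[folded int_F]] by simp
qed

text \<open>Poisson summation: the Fourier coefficients of the periodized Gaussian sum to its value
  at 0, and up to \<open>sqrt t\<close> they are themselves Gaussian, with \<open>t\<close> replaced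
  by \<open>1 / t\<close>.\<close>

lemma jacobi_theta_identity:
  assumes t: "t > 0"
  shows "(\<Sum>\<^sub>\<infinity>n\<in>(UNIV :: int set). complex_of_real (exp (- pi * t * (of_int n)\<^sup>2)))
       = (\<Sum>\<^sub>\<infinity>n\<in>(UNIV :: int set). complex_of_real (exp (- pi * (1 / t) * (of_int n)\<^sup>2))) / sqrt t"
proof -
  have pg0: "periodized_gaussian s 0 = (\<Sum>\<^sub>\<infinity>n\<in>(UNIV :: int set). complex_of_real (exp (- pi * s * (of_int n)\<^sup>2)))" for s
    unfolding periodized_gaussian_def by (simp flip: exp_of_real)
  have "(\<lambda>K. \<Sum>k=-int K..int K. exp (- pi * (of_int k)\<^sup>2 / t) / sqrt t) \<longlonglongrightarrow> periodized_gaussian t 0"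
    using fourier_series_at_0[OF periodized_gaussian_holomorphic[OF t]]
    unfolding fourier_coeff_periodized_gaussian[OF t] by simp
  moreover have "(\<lambda>K. (\<Sum>k=-int K..int K. exp (of_real (- pi * (1 / t)) * (of_int k + (0::complex))\<^sup>2)) / sqrt t) \<longlonglongrightarrow> periodized_gaussian (1 / t) 0 / sqrt t"
    using t by (intro tendsto_divide tendsto_const tendsto_uniform_limitI[OF uniform_limit_periodized_gaussian[of "1 / t" 0]]) auto
  moreover have "(\<Sum>k=-int K..int K. exp (of_real (- pi * (1 / t)) * (of_int k + (0::complex))\<^sup>2)) / sqrt t
      = (\<Sum>k=-int K..int K. complex_of_real (exp (- pi * (of_int k)\<^sup>2 / t) / sqrt t))" for K
    by (simp add: sum_divide_distrib flip: exp_of_real)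
  ultimately have "periodized_gaussian t 0 = periodized_gaussian (1 / t) 0 / sqrt t"
    by (simp add: LIMSEQ_unique)
  then show ?thesis by (simp only: pg0)
qed

section \<open>The theta multiplier\<close>

lemma norm_theta_term_le:
  assumes "0 < y" "y \<le> Im \<tau>"
  shows "norm (exp (2 * of_real pi * \<i> * of_int (n ^ 2) * \<tau>)) \<le> exp (- (2 * pi * y) * \<bar>of_int n\<bar>)"
proof -
  have "2 * pi * y * \<bar>real_of_int n\<bar> \<le> 2 * pi * Im \<tau> * (real_of_int n)\<^sup>2"
    using assms by (intro mult_mono abs_int_le_square) auto
  then show ?thesis by (simp add: algebra_simps)
qed

lemma uniform_limit_theta:
  assumes "0 < y"
  shows "uniform_limit {\<tau>. y \<le> Im \<tau>}
           (\<lambda>N \<tau>. \<Sum>n\<in>{- int N..int N}. exp (2 * of_real pi * \<i> * of_int (n ^ 2) * \<tau>)) theta sequentially"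
proof -
  have "uniform_limit {\<tau>. y \<le> Im \<tau>} (\<lambda>X (\<tau>::complex). \<Sum>n\<in>X. exp (2 * of_real pi * \<i> * of_int (n ^ 2) * \<tau>))
      (\<lambda>\<tau>. \<Sum>\<^sub>\<infinity>n\<in>(UNIV :: int set). exp (2 * of_real pi * \<i> * of_int (n ^ 2) * \<tau>)) (finite_subsets_at_top UNIV)"
  proof (rule Weierstrass_m_test_general)
    show "(\<lambda>n::int. exp (- (2 * pi * y) * \<bar>of_int n\<bar>)) summable_on UNIV"
      using assms by (intro summable_on_exp_abs_int) auto
  next
    fix n and \<tau> assume "\<tau> \<in> {\<tau>. y \<le> Im \<tau>}"
    then show "norm (exp (2 * of_real pi * \<i> * of_int (n ^ 2) * \<tau>)) \<le> exp (- (2 * pi * y) * \<bar>of_int n\<bar>)"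
      using assms norm_theta_term_le by blast
  qed
  then show ?thesis
    unfolding theta_def[abs_def]
    by (rule filterlim_compose[OF _ filterlim_symmetric_int_interval])
qed

lemma theta_holomorphic: "theta holomorphic_on upper_half_plane"
proof (rule holomorphic_uniform_sequence[OF open_upper_half_plane])
  show "(\<lambda>\<tau>. \<Sum>n\<in>{- int N..int N}. exp (2 * of_real pi * \<i> * of_int (n ^ 2) * \<tau>)) holomorphic_on upper_half_plane" for N
    by (intro holomorphic_intros)
  fix x assume x: "x \<in> upper_half_plane"
  have sub: "cball x (Im x / 2) \<subseteq> {\<tau>. Im x / 2 \<le> Im \<tau>}"
  proof
    fix w assume "w \<in> cball x (Im x / 2)"
    then have "norm (x - w) \<le> Im x / 2" by (simp add: dist_norm)
    then have "\<bar>Im (x - w)\<bar> \<le> Im x / 2" using abs_Im_le_cmod order_trans by blast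
    then show "w \<in> {\<tau>. Im x / 2 \<le> Im \<tau>}" using abs_ge_self[of "Im x - Im w"] by simp
  qed
  show "\<exists>d>0. cball x d \<subseteq> upper_half_plane \<and> uniform_limit (cball x d)
      (\<lambda>N \<tau>. \<Sum>n\<in>{- int N..int N}. exp (2 * of_real pi * \<i> * of_int (n ^ 2) * \<tau>)) theta sequentially"
  proof (intro exI[of _ "Im x / 2"] conjI)
    show "cball x (Im x / 2) \<subseteq> upper_half_plane"
      using sub x by (auto simp: subset_iff)
    show "uniform_limit (cball x (Im x / 2))
      (\<lambda>N \<tau>. \<Sum>n\<in>{- int N..int N}. exp (2 * of_real pi * \<i> * of_int (n ^ 2) * \<tau>)) theta sequentially"
      using uniform_limit_on_subset[OF uniform_limit_theta sub] x by simp
  qed (use x in simp)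
qed

lemma theta_translate: "theta (\<tau> + of_int k) = theta \<tau>"
proof -
  have "exp (2 * of_real pi * \<i> * of_int (n ^ 2) * (\<tau> + of_int k)) = exp (2 * of_real pi * \<i> * of_int (n ^ 2) * \<tau>)" for n :: int
    unfolding exp_eq by (intro exI[of _ "n ^ 2 * k"]) (simp add: algebra_simps)
  then show ?thesis unfolding theta_def by simp
qed

text \<open>The half converts the normalization exp (2 pi i n^2 tau) of \<open>theta\<close> into
  the exp (-pi t n^2) of Jacobi's identity.\<close>

lemma theta_imaginary_axis:
  assumes t: "t > 0"
  shows "theta (of_real (t / 2) * \<i>) = (\<Sum>\<^sub>\<infinity>n\<in>(UNIV :: int set). complex_of_real (exp (- pi * t * (of_int n)\<^sup>2)))"
proof -
  have "2 * of_real pi * \<i> * of_int (n ^ 2) * (of_real (t / 2) * \<i>) = complex_of_real (- pi * t * (of_int n)\<^sup>2)" for n :: int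
    by (simp add: complex_eq_iff)
  then show ?thesis unfolding theta_def by (simp only: exp_of_real)
qed

text \<open>On the imaginary axis this is Jacobi's identity; both sides are holomorphic, so the
  identity principle carries it to the whole half-plane.\<close>

lemma theta_inversion:
  assumes \<tau>: "Im \<tau> > 0"
  shows "theta (- 1 / (4 * \<tau>)) = csqrt (- 2 * \<i> * \<tau>) * theta \<tau>"
proof -
  define U where "U = (\<lambda>s. of_real (s / 2) * \<i>) ` {0<..}"
  have nz: "\<tau> \<noteq> 0" if "Im \<tau> > 0" for \<tau> using that by auto
  have im: "Im (- 1 / (4 * \<tau>)) > 0" if "Im \<tau> > 0" for \<tau>
  proof -
    have "Im (- 1 / (4 * \<tau>)) = Im \<tau> / (4 * (norm \<tau>)\<^sup>2)"
      by (simp add: complex_div_cnj[of _ "4 * \<tau>"] norm_mult power_mult_distrib)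
    then show ?thesis using that nz[OF that] by simp
  qed
  have "theta (- 1 / (4 * \<tau>)) - csqrt (- 2 * \<i> * \<tau>) * theta \<tau> = 0"
  proof (rule analytic_continuation[where f = "\<lambda>\<tau>. theta (- 1 / (4 * \<tau>)) - csqrt (- 2 * \<i> * \<tau>) * theta \<tau>" and w = \<tau> and S = upper_half_plane and U = U and \<xi> = \<i>])
    have 1: "(\<lambda>\<tau>. theta (- 1 / (4 * \<tau>))) holomorphic_on upper_half_plane"
      by (rule holomorphic_on_compose_gen[OF _ theta_holomorphic, unfolded o_def])
         (use im nz in \<open>auto intro!: holomorphic_intros\<close>)
    \<comment> \<open>The real part of -2 i tau is 2 Im tau > 0, so the principal square root stays
      off its cut.\<close>
    have 2: "(\<lambda>\<tau>. csqrt (- 2 * \<i> * \<tau>)) holomorphic_on upper_half_plane"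
    proof (rule holomorphic_on_csqrt')
      show "(\<lambda>\<tau>. - 2 * \<i> * \<tau>) holomorphic_on upper_half_plane" by (intro holomorphic_intros)
    qed (auto simp: complex_nonpos_Reals_iff)
    show "(\<lambda>\<tau>. theta (- 1 / (4 * \<tau>)) - csqrt (- 2 * \<i> * \<tau>) * theta \<tau>) holomorphic_on upper_half_plane"
      using 1 2 theta_holomorphic by (intro holomorphic_on_diff holomorphic_on_mult)
    show "connected upper_half_plane" by (rule convex_connected[OF convex_upper_half_plane])
    show "U \<subseteq> upper_half_plane" by (auto simp: U_def)
    show "\<i> islimpt U"
    proof (rule islimptI)
      fix T assume T: "\<i> \<in> T" "open T"
      then obtain e where e: "e > 0" "ball \<i> e \<subseteq> T" by (meson openE)
      have "\<i> + of_real (e / 2) * \<i> \<in> ball \<i> e" using e by (simp add: dist_norm norm_mult)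
      moreover have "\<i> + of_real (e / 2) * \<i> = of_real ((2 + e) / 2) * \<i>" by (simp add: algebra_simps add_divide_distrib)
      then have "\<i> + of_real (e / 2) * \<i> \<in> U" unfolding U_def using e by (intro image_eqI[of _ _ "2 + e"]) auto
      ultimately show "\<exists>y\<in>U. y \<in> T \<and> y \<noteq> \<i>"
        using e by (intro bexI[of _ "\<i> + of_real (e / 2) * \<i>"]) auto
    qed
    show "theta (- 1 / (4 * z)) - csqrt (- 2 * \<i> * z) * theta z = 0" if zU: "z \<in> U" for z
    proof -
      obtain t where t: "t \<in> {0<..}" "z = of_real (t / 2) * \<i>" using zU unfolding U_def image_iff by blast
      then have t: "t > 0" "z = of_real (t / 2) * \<i>" by simp_all
      have a: "- 1 / (4 * z) = of_real ((1 / t) / 2) * \<i>"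
      proof -
        have "complex_of_real ((1 / t) / 2) * \<i> * (4 * z) = - 1" using t(1) unfolding t(2) by (simp add: complex_eq_iff)
        moreover have "4 * z \<noteq> 0" using t by auto
        ultimately show ?thesis by (metis nonzero_divide_eq_eq)
      qed
      have b: "- 2 * \<i> * z = of_real t" unfolding t(2) by (simp add: complex_eq_iff)
      have "theta z = theta (- 1 / (4 * z)) / sqrt t"
        unfolding a using jacobi_theta_identity[OF t(1)] theta_imaginary_axis[of t] theta_imaginary_axis[of "1 / t"] t(1) unfolding t(2) by simp
      then show ?thesis unfolding b using t(1) by (simp add: csqrt_of_real_nonneg field_simps)
    qed
  qed (use \<tau> open_upper_half_plane in auto)
  then show ?thesis by simp
qed

definition theta_modular :: "int_matrix2 \<Rightarrow> bool" where
  "theta_modular \<gamma> \<longleftrightarrow> (\<forall>\<tau>. Im \<tau> > 0 \<longrightarrow> norm (theta (moebius \<gamma> \<tau>)) = sqrt (norm (cocycle \<gamma> \<tau>)) * norm (theta \<tau>))"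

text \<open>The cocycle relation makes the factors multiply along compositions. Since only absolute
  values are compared, no multiplier has to be tracked and the property can be checked on
  generators.\<close>

lemma theta_modular_mult:
  assumes "theta_modular A" "theta_modular B" "A \<in> SL2Z" "B \<in> SL2Z"
  shows "theta_modular (mat_mult A B)"
  using assms unfolding theta_modular_def
  by (simp add: mat_mult_moebius_cocycle moebius_upper_half_plane norm_mult real_sqrt_mult)

lemma theta_modular_upper: "(a, b, 0, d) \<in> SL2Z \<Longrightarrow> theta_modular (a, b, 0, d)"
proof -
  assume "(a, b, 0, d) \<in> SL2Z"
  then have "a * d = 1" by (simp add: SL2Z_iff)
  then consider "a = 1" "d = 1" | "a = -1" "d = -1" using zmult_eq_1_iff by blast
  then show ?thesis
  proof cases
    case 1
    then show ?thesis by (simp add: theta_modular_def theta_translate)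
  next
    case 2
    then show ?thesis using theta_translate[of _ "- b"] by (simp add: theta_modular_def)
  qed
qed

text \<open>The inversion tau -> -1 / (4 tau) conjugates this matrix to the translation by -m, so
  two inversions and one translation suffice.\<close>

lemma theta_modular_lower: "theta_modular (1, 0, 4 * m, 1)"
  unfolding theta_modular_def
proof (intro allI impI)
  fix \<tau> :: complex assume \<tau>: "Im \<tau> > 0"
  define w where "w = - 1 / (4 * \<tau>)"
  define v where "v = w - of_int m"
  have nz: "\<tau> \<noteq> 0" using \<tau> by auto
  have c: "4 * of_int m * \<tau> + 1 \<noteq> 0"
    using cocycle_nonzero[of "(1, 0, 4 * m, 1)" \<tau>] \<tau> by (simp add: SL2Z_iff)
  have "Im w = Im \<tau> / (4 * (norm \<tau>)\<^sup>2)"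
    by (simp add: w_def complex_div_cnj[of _ "4 * \<tau>"] norm_mult power_mult_distrib)
  then have w: "Im v > 0" using \<tau> nz by (simp add: v_def)
  have eq: "v = - (4 * of_int m * \<tau> + 1) / (4 * \<tau>)" using nz by (simp add: v_def w_def field_simps)
  have mv: "- 1 / (4 * v) = moebius (1, 0, 4 * m, 1) \<tau>"
  proof -
    have "- 1 / (4 * (- D / (4 * \<tau>))) = \<tau> / D" if "D \<noteq> 0" for D
      using that nz by (simp add: field_simps)
    from this[OF c] show ?thesis unfolding eq by simp
  qed
  then have "norm (theta (moebius (1, 0, 4 * m, 1) \<tau>)) = sqrt (norm (2 * v)) * norm (theta v)"
    using theta_inversion[OF w] unfolding mv by (simp add: norm_mult)
  also have "theta v = theta w" using theta_translate[of w "- m"] by (simp add: v_def)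
  also have "norm (theta w) = sqrt (norm (2 * \<tau>)) * norm (theta \<tau>)"
    using theta_inversion[OF \<tau>] by (simp add: norm_mult w_def)
  also have "sqrt (norm (2 * v)) * (sqrt (norm (2 * \<tau>)) * norm (theta \<tau>))
      = sqrt (norm (2 * v * (2 * \<tau>))) * norm (theta \<tau>)"
    by (simp add: norm_mult real_sqrt_mult)
  also have "2 * v * (2 * \<tau>) = - (4 * of_int m * \<tau> + 1)"
    unfolding eq using nz by simp
  also have "norm (- (4 * of_int m * \<tau> + 1)) = norm (cocycle (1, 0, 4 * m, 1) \<tau>)"
    by (simp only: norm_minus_cancel) simp
  finally show "norm (theta (moebius (1, 0, 4 * m, 1) \<tau>)) = sqrt (norm (cocycle (1, 0, 4 * m, 1) \<tau>)) * norm (theta \<tau>)" .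
qed

text \<open>Euclidean descent on the bottom row: a translation reduces \<open>d\<close> modulo
  \<open>c\<close>, then a lower triangular matrix reduces \<open>c\<close> modulo
  \<open>4 * d\<close>, until \<open>c = 0\<close>.\<close>

lemma theta_modular_Gamma0_4:
  assumes "(a, b, c, d) \<in> SL2Z" "4 dvd c"
  shows "theta_modular (a, b, c, d)"
  using assms
proof (induction "nat \<bar>c\<bar>" arbitrary: a b c d rule: less_induct)
  case less
  show ?case
  proof (cases "c = 0")
    case True
    then show ?thesis using less.prems theta_modular_upper by blast
  next
    case False
    have det: "a * d - b * c = 1" using less.prems by (simp add: SL2Z_iff)
    obtain c1 where c1: "c = 4 * c1" using less.prems by auto
    have odd: "odd (d + c * k)" for k
    proof
      assume "even (d + c * k)"
      then have "even d" using c1 by simp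
      then have "even (a * d - b * c)" using c1 by simp
      then show False using det by simp
    qed
    have small: "\<exists>k. 2 * \<bar>x + n * k\<bar> \<le> \<bar>n\<bar>" if "n \<noteq> 0" for x n :: int
    proof -
      define r where "r = x mod \<bar>n\<bar>"
      have r: "0 \<le> r" "r < \<bar>n\<bar>" using that by (simp_all add: r_def)
      have x: "x = \<bar>n\<bar> * (x div \<bar>n\<bar>) + r" by (simp add: r_def)
      have abs_n: "\<bar>n\<bar> = n * sgn n" by (simp add: abs_sgn)
      show ?thesis
      proof (cases "2 * r \<le> \<bar>n\<bar>")
        case True
        have "x + n * (- sgn n * (x div \<bar>n\<bar>)) = r" 
          using x abs_n by (metis add_diff_cancel_left' diff_conv_add_uminus mult.assoc mult_minus_left mult_minus_right)
        then show ?thesis using True r by (intro exI[of _ "- sgn n * (x div \<bar>n\<bar>)"]) simp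
      next
        case False
        have "x + n * (- sgn n * (x div \<bar>n\<bar> + 1)) = x - \<bar>n\<bar> * (x div \<bar>n\<bar>) - \<bar>n\<bar>"
          unfolding abs_n by (simp add: algebra_simps)
        then have "x + n * (- sgn n * (x div \<bar>n\<bar> + 1)) = r - \<bar>n\<bar>" using x by linarith
        then show ?thesis using False r by (intro exI[of _ "- sgn n * (x div \<bar>n\<bar> + 1)"]) simp
      qed
    qed
    obtain k where k: "2 * \<bar>d + c * k\<bar> \<le> \<bar>c\<bar>" using small[OF False] by blast
    define d' where "d' = d + c * k"
    have d': "odd d'" "2 * \<bar>d'\<bar> \<le> \<bar>c\<bar>" using odd k by (simp_all add: d'_def)
    \<comment> \<open>Parity makes the descent strict. As 4 divides \<open>c\<close>, equality would
      make the odd number \<open>d'\<close> even; strictness then gives |c'| <= 2 |d'| <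
      |c|.\<close>
    have "2 * \<bar>d'\<bar> \<noteq> \<bar>c\<bar>"
    proof
      assume "2 * \<bar>d'\<bar> = \<bar>c\<bar>"
      then have "\<bar>d'\<bar> = 2 * \<bar>c1\<bar>" using c1 by simp
      then have "even \<bar>d'\<bar>" by simp
      then show False using d' by simp
    qed
    then have lt: "2 * \<bar>d'\<bar> < \<bar>c\<bar>" using d' by simp
    have "d' \<noteq> 0" using d' by auto
    then obtain m where m: "2 * \<bar>c + (4 * d') * m\<bar> \<le> \<bar>4 * d'\<bar>" using small[of "4 * d'" c] by auto
    define c' where "c' = c + (4 * d') * m"
    have c': "nat \<bar>c'\<bar> < nat \<bar>c\<bar>" "4 dvd c'" 
    proof -
      have "\<bar>4 * d'\<bar> = 4 * \<bar>d'\<bar>" by (simp add: abs_mult)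
      moreover have "X < Z" if "Y = 4 * W" "2 * X \<le> Y" "2 * W < Z" for X Y Z W :: int
        using that by linarith
      ultimately have "\<bar>c'\<bar> < \<bar>c\<bar>" using m lt unfolding c'_def by blast
      then show "nat \<bar>c'\<bar> < nat \<bar>c\<bar>" by simp
      show "4 dvd c'" using c1 by (simp add: c'_def)
    qed
    define b' where "b' = b + a * k"
    define a' where "a' = a + 4 * m * b'"
    have eq: "(a, b, c, d) = mat_mult (mat_mult (a', b', c', d') (1, 0, 4 * (- m), 1)) (1, - k, 0, 1)"
      by (simp add: a'_def b'_def c'_def d'_def algebra_simps)
    have "a' * d' - b' * c' = a * d - b * c"
      unfolding a'_def b'_def c'_def d'_def by algebra
    then have S: "(a', b', c', d') \<in> SL2Z" using det by (simp add: SL2Z_iff)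
    have "theta_modular (a', b', c', d')" using less.hyps[OF c'(1) S c'(2)] .
    then show ?thesis unfolding eq
      by (intro theta_modular_mult mat_mult_SL2Z S theta_modular_lower theta_modular_upper) (auto simp: SL2Z_iff)
  qed
qed

section \<open>Squarefree numbers in progressions\<close>

text \<open>The majorant is 1 at m = 0 and increases to 4/3. Its successive quotients are 1 + 1 /
  ((3 m + 7) (m + 1)), large enough because (3 m + 7) (m + 1) <= (2 m + 3)^2.\<close>

lemma prod_one_plus_inverse_squares_odd_le:
  "(\<Prod>i\<in>{1..m}. 1 + 1 / (2 * real i + 1)\<^sup>2) \<le> 4 * (real m + 1) / (3 * real m + 4)"
proof (induction m)
  case (Suc m)
  have "(\<Prod>i\<in>{1..Suc m}. 1 + 1 / (2 * real i + 1)\<^sup>2)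
      = (\<Prod>i\<in>{1..m}. 1 + 1 / (2 * real i + 1)\<^sup>2) * (1 + 1 / (2 * real m + 3)\<^sup>2)"
    by (simp add: add.commute)
  also have "\<dots> \<le> 4 * (real m + 1) / (3 * real m + 4) * (1 + 1 / (2 * real m + 3)\<^sup>2)"
    using Suc.IH by (intro mult_right_mono) auto
  also have "\<dots> \<le> 4 * (real (Suc m) + 1) / (3 * real (Suc m) + 4)"
  proof -
    define x where "x = real m"
    have x: "x \<ge> 0" by (simp add: x_def)
    have "1 / (2 * x + 3)\<^sup>2 \<le> 1 / ((3 * x + 7) * (x + 1))"
      using x by (intro divide_left_mono mult_pos_pos zero_less_power) (auto simp: power2_eq_square algebra_simps)
    then have "4 * (x + 1) / (3 * x + 4) * (1 + 1 / (2 * x + 3)\<^sup>2)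
        \<le> 4 * (x + 1) / (3 * x + 4) * (1 + 1 / ((3 * x + 7) * (x + 1)))"
      using x by (intro mult_left_mono) auto
    also have "\<dots> = 4 * (x + 2) / (3 * x + 7)"
    proof -
      have nz: "x + 1 \<noteq> 0" "3 * x + 4 \<noteq> 0" "3 * x + 7 \<noteq> 0" using x by auto
      have "1 + 1 / ((3 * x + 7) * (x + 1)) = ((3 * x + 4) * (x + 2)) / ((3 * x + 7) * (x + 1))"
      proof -
        have "(3 * x + 4) * (x + 2) = (3 * x + 7) * (x + 1) + 1" by algebra
        moreover have "(3 * x + 7) * (x + 1) \<noteq> 0" using nz by simp
        moreover have "1 + 1 / D = (D + 1) / D" if "D \<noteq> 0" for D :: real
          using that by (simp add: field_simps)
        ultimately show ?thesis by (simp only: mult.commute)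
      qed
      moreover have "4 * A / C * (C * B / (D * A)) = 4 * B / D" if "A \<noteq> 0" "C \<noteq> 0" "D \<noteq> 0" for A B C D :: real
        using that by (simp add: field_simps)
      ultimately show ?thesis using nz by (simp only: simp_thms)
    qed
    finally show ?thesis by (simp add: x_def algebra_simps)
  qed
  finally show ?case .
qed simp

text \<open>The odd primes are replaced by all odd numbers from 3 on: the prime 2 contributes 5/4
  and the others at most 4/3. What matters later is that the value is below 1 + 9/11.\<close>

lemma prod_one_plus_inverse_squares_primes_le:
  assumes "finite A" "\<And>p. p \<in> A \<Longrightarrow> prime (p :: nat)"
  shows "(\<Prod>p\<in>A. 1 + 1 / (real p)\<^sup>2) \<le> 5 / 3"
proof -
  obtain m where m: "\<forall>p\<in>A. p \<le> m" using assms(1) finite_nat_set_iff_bounded_le by auto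
  define B where "B = insert 2 ((\<lambda>i. 2 * i + 1) ` {1..m})"
  have "A \<subseteq> B"
  proof
    fix p assume p: "p \<in> A"
    then have pr: "prime p" using assms by auto
    show "p \<in> B"
    proof (cases "p = 2")
      case False
      then have "odd p" using pr prime_odd_nat prime_gt_1_nat[OF pr] by (metis One_nat_def Suc_lessI numeral_2_eq_2)
      then obtain i where "p = 2 * i + 1" by (elim oddE)
      moreover have "i \<ge> 1" using \<open>p = 2 * i + 1\<close> prime_gt_1_nat[OF pr] by auto
      moreover have "i \<le> m" using m p \<open>p = 2 * i + 1\<close> by force
      ultimately show ?thesis by (auto simp: B_def)
    qed (simp add: B_def)
  qed
  then have "(\<Prod>p\<in>A. 1 + 1 / (real p)\<^sup>2) \<le> (\<Prod>p\<in>B. 1 + 1 / (real p)\<^sup>2)"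
    by (intro prod_mono2) (auto simp: B_def add_nonneg_nonneg)
  also have "\<dots> = (1 + 1 / 2\<^sup>2) * (\<Prod>p\<in>(\<lambda>i. 2 * i + 1) ` {1..m}. 1 + 1 / (real p)\<^sup>2)"
    unfolding B_def by (subst prod.insert) auto
  also have "(\<Prod>p\<in>(\<lambda>i. 2 * i + 1) ` {1..m}. 1 + 1 / (real p)\<^sup>2) = (\<Prod>i\<in>{1..m}. 1 + 1 / (2 * real i + 1)\<^sup>2)"
    by (subst prod.reindex) (auto simp: inj_on_def add.commute)
  also have "(1 + 1 / 2\<^sup>2) * (\<Prod>i\<in>{1..m}. 1 + 1 / (2 * real i + 1)\<^sup>2) \<le> (1 + 1 / 2\<^sup>2) * (4 * (real m + 1) / (3 * real m + 4))"
    by (intro mult_left_mono prod_one_plus_inverse_squares_odd_le) auto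
  also have "\<dots> \<le> (1 + 1 / 2\<^sup>2) * (4 / 3)"
    by (intro mult_left_mono) (auto simp: field_simps)
  finally show ?thesis by simp
qed

text \<open>Extending the product to all integers from 2 to some bound can only lower it, and then
  it telescopes to (n + 2) / (2 (n + 1)) > 1/2.\<close>

lemma prod_one_minus_inverse_squares_ge:
  assumes "finite A" "\<And>p. p \<in> A \<Longrightarrow> (2 :: nat) \<le> p"
  shows "(\<Prod>p\<in>A. 1 - 1 / (real p)\<^sup>2) \<ge> 1 / 2"
proof -
  obtain m where m: "\<forall>p\<in>A. p \<le> m" using assms(1) finite_nat_set_iff_bounded_le by auto
  have le1: "0 \<le> 1 - 1 / (real p)\<^sup>2" "1 - 1 / (real p)\<^sup>2 \<le> 1" if "p \<ge> 1" for p
  proof -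
    have "1 \<le> (real p)\<^sup>2" using that by simp
    then have "1 / (real p)\<^sup>2 \<le> 1" by (subst divide_le_eq_1_pos) linarith+
    then show "0 \<le> 1 - 1 / (real p)\<^sup>2" by simp
  qed auto
  have eq: "(\<Prod>p\<in>{2..Suc n}. 1 - 1 / (real p)\<^sup>2) = (real n + 2) / (2 * (real n + 1))" for n
  proof (induction n)
    case (Suc n)
    have "(\<Prod>p\<in>{2..Suc (Suc n)}. 1 - 1 / (real p)\<^sup>2)
        = (1 - 1 / (real (Suc (Suc n)))\<^sup>2) * (\<Prod>p\<in>{2..Suc n}. 1 - 1 / (real p)\<^sup>2)"
      by (rule prod.nat_ivl_Suc') simp
    also have "\<dots> = (real n + 2) / (2 * (real n + 1)) * (1 - 1 / (real n + 2)\<^sup>2)"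
      unfolding Suc.IH by (simp add: mult.commute add.commute)
    also have "1 - 1 / (real n + 2)\<^sup>2 = (real n + 1) * (real n + 3) / (real n + 2)\<^sup>2"
    proof -
      have "1 - 1 / N\<^sup>2 = (N - 1) * (N + 1) / N\<^sup>2" if "N \<noteq> 0" for N :: real
        using that by (simp add: field_simps power2_eq_square)
      from this[of "real n + 2"] show ?thesis by (simp add: algebra_simps)
    qed
    also have "(real n + 2) / (2 * (real n + 1)) * ((real n + 1) * (real n + 3) / (real n + 2)\<^sup>2)
        = (real n + 3) / (2 * (real n + 2))"
    proof -
      have "B / (2 * A) * (A * C / B\<^sup>2) = C / (2 * B)" if "A \<noteq> 0" "B \<noteq> 0" for A B C :: real
        using that by (simp add: field_simps power2_eq_square)
      from this[of "real n + 1" "real n + 2" "real n + 3"] show ?thesis by linarith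
    qed
    finally show ?case by (simp add: algebra_simps)
  qed simp
  have "1 / 2 \<le> (real m + 2) / (2 * (real m + 1))" by (simp add: field_simps)
  also have "\<dots> = (\<Prod>p\<in>{2..Suc m}. 1 - 1 / (real p)\<^sup>2)" by (simp only: eq)
  also have "\<dots> = (\<Prod>p\<in>A. 1 - 1 / (real p)\<^sup>2) * (\<Prod>p\<in>{2..Suc m} - A. 1 - 1 / (real p)\<^sup>2)"
    using m assms by (subst prod.subset_diff[of A]) (auto simp: mult.commute)
  also have "\<dots> \<le> (\<Prod>p\<in>A. 1 - 1 / (real p)\<^sup>2) * 1"
  proof (intro mult_left_mono prod_le_1 prod_nonneg)
    fix p assume "p \<in> A" then have "p \<ge> 1" using assms(2) by force
    then show "0 \<le> 1 - 1 / (real p)\<^sup>2" by (rule le1)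
  qed (use le1 in auto)
  finally show ?thesis by simp
qed

text \<open>Take for \<open>t\<close> the product of the primes of \<open>c\<close> that do not
  divide \<open>a\<close>. A prime of \<open>c\<close> dividing \<open>a\<close> divides neither
  \<open>M\<close>, by the gcd condition, nor \<open>t\<close>; any other prime of \<open>c\<close>
  divides \<open>t\<close> but not \<open>a\<close>. In both cases it does not divide
  \<open>a + M * t\<close>.\<close>

lemma coprime_in_progression:
  fixes a M c :: int
  assumes "c \<noteq> 0" "gcd (gcd a M) c = 1"
  shows "\<exists>t. coprime (a + M * t) c"
proof -
  define t where "t = \<Prod>{p \<in> prime_factors c. \<not> p dvd a}"
  have fin: "finite {p \<in> prime_factors c. \<not> p dvd a}" by auto
  have "coprime (a + M * t) c"
  proof (rule ccontr)
    assume "\<not> coprime (a + M * t) c"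
    then have "\<not> is_unit (gcd (a + M * t) c)" by (simp only: is_unit_gcd not_False_eq_True)
    moreover have "gcd (a + M * t) c \<noteq> 0" using assms(1) by simp
    ultimately obtain p where "p dvd gcd (a + M * t) c" "prime p" using prime_divisor_exists by blast
    then have p: "prime p" "p dvd a + M * t" "p dvd c"
      using dvd_trans gcd_dvd1 gcd_dvd2 by blast+
    have pf: "p \<in> prime_factors c" using p assms(1) by (simp add: prime_factors_dvd)
    show False
    proof (cases "p dvd a")
      case True
      then have "p dvd M * t" using p(2) by (simp add: dvd_add_right_iff)
      then consider "p dvd M" | "p dvd t" using p(1) by (auto simp: prime_dvd_mult_iff)
      then show False
      proof cases
        case 1
        then have "p dvd 1" using True p(3) assms(2) by (metis gcd_greatest)
        then show False using p(1) by auto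
      next
        case 2
        then obtain q where q: "q \<in> prime_factors c" "\<not> q dvd a" "p dvd q"
          unfolding t_def using prime_dvd_prod_iff[OF fin p(1), of "\<lambda>x. x"] by auto
        then have "p = q" using p(1) by (metis in_prime_factors_imp_prime primes_dvd_imp_eq)
        then show False using q True by simp
      qed
    next
      case False
      then have "p dvd t" unfolding t_def using pf fin by (intro dvd_prodI) auto
      then show False using False p(2) by (simp add: dvd_add_left_iff)
    qed
  qed
  then show ?thesis by blast
qed

section \<open>Denominators of cusps avoiding the squares of most primes\<close>

lemma sum_inverse_squares_odd_le:
  "(\<Sum>i\<in>{1..m}. 1 / (2 * real i + 1)\<^sup>2) \<le> 1 / 4"
proof -
  have "(\<Sum>i\<in>{1..m}. 1 / (2 * real i + 1)\<^sup>2) \<le> 1 / 4 - 1 / (4 * (real m + 1))"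
  proof (induction m)
    case (Suc m)
    define x where "x = real m"
    have x: "x \<ge> 0" by (simp add: x_def)
    have "1 / (2 * x + 3)\<^sup>2 \<le> 1 / (4 * ((x + 1) * (x + 2)))"
      using x by (intro divide_left_mono mult_pos_pos zero_less_power) (auto simp: power2_eq_square algebra_simps)
    also have "\<dots> = 1 / (4 * (x + 1)) - 1 / (4 * (x + 2))"
    proof -
      have "1 / (4 * (A * (A + 1))) = 1 / (4 * A) - 1 / (4 * (A + 1))" if "A \<noteq> 0" "A + 1 \<noteq> 0" for A :: real
        using that by (simp add: field_simps)
      from this[of "x + 1"] show ?thesis using x by (simp add: add.assoc)
    qed
    finally have "1 / (2 * real (Suc m) + 1)\<^sup>2 \<le> 1 / (4 * (real m + 1)) - 1 / (4 * (real (Suc m) + 1))"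
      by (simp add: x_def algebra_simps)
    moreover have "(\<Sum>i\<in>{1..Suc m}. 1 / (2 * real i + 1)\<^sup>2) = (\<Sum>i\<in>{1..m}. 1 / (2 * real i + 1)\<^sup>2) + 1 / (2 * real (Suc m) + 1)\<^sup>2"
      by simp
    ultimately show ?case using Suc.IH by linarith
  qed simp
  moreover have "1 / (4 * (real m + 1)) \<ge> 0" by simp
  ultimately show ?thesis by linarith
qed

text \<open>Divisibility by \<open>q\<close> fixes \<open>k\<close> modulo \<open>q\<close>, so
  every block of \<open>q\<close> consecutive values holds at most one solution; the summand 1 pays
  for the incomplete block.\<close>

lemma card_dvd_in_progression_le:
  fixes q L c K :: nat
  assumes "q > 0" "coprime q L"
  shows "real (card {k. k < K \<and> q dvd c + L * k}) \<le> real K / real q + 1"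
proof -
  let ?S = "{k. k < K \<and> q dvd c + L * k}"
  have "inj_on (\<lambda>k. k div q) ?S"
  proof (rule inj_onI)
    fix k k' assume k: "k \<in> ?S" and k': "k' \<in> ?S" and eq: "k div q = k' div q"
    have "[c + L * k = c + L * k'] (mod q)" using k k' by (simp add: cong_def)
    then have "[L * k = L * k'] (mod q)" by (simp add: cong_add_lcancel_nat)
    then have "[k = k'] (mod q)" using assms(2) by (simp add: cong_mult_lcancel_nat coprime_commute)
    then have "k mod q = k' mod q" by (simp add: cong_def)
    then show "k = k'" using eq by (metis div_mult_mod_eq)
  qed
  moreover have "(\<lambda>k. k div q) ` ?S \<subseteq> {..K div q}"
    by (auto intro!: div_le_mono)
  ultimately have "card ?S \<le> card {..K div q}" by (intro card_inj_on_le) auto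
  also have "\<dots> = K div q + 1" by simp
  finally have "real (card ?S) \<le> real (K div q) + 1" by linarith
  then show ?thesis using of_nat_div_le_of_nat[of K q, where ?'a = real] by linarith
qed

text \<open>A union bound: if every term failed, the solution sets for the squares of the odd
  numbers \<open>2 * i + 1\<close> prime to \<open>L\<close> would cover all k < K, which they are
  too small to do. Using all such odd numbers in place of primes avoids any estimate on
  primes.\<close>

lemma almost_squarefree_in_progression:
  fixes L c0 :: nat
  assumes "even L" "L > 0"
  shows "\<exists>k. \<forall>p. prime p \<longrightarrow> \<not> p dvd L \<longrightarrow> \<not> p\<^sup>2 dvd (c0 mod L + L) + L * k"
proof (rule ccontr)
  assume neg: "\<not> ?thesis"
  define c where "c = c0 mod L + L"
  \<comment> \<open>With K = 8 L all terms lie below (4 L)^2, so \<open>p < 4 * L\<close> and at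
    most 2 L odd moduli occur. They account for at most K / 4 + 2 L = 4 L < K values of
    \<open>k\<close>.\<close>
  define K where "K = 8 * L"
  define Bad where "Bad = (\<lambda>i::nat. {k. k < K \<and> (2 * i + 1)\<^sup>2 dvd c + L * k})"
  define I where "I = {i \<in> {1..2 * L}. coprime (2 * i + 1) L}"
  have cover: "{..<K} \<subseteq> (\<Union>i\<in>I. Bad i)"
  proof
    fix k assume k: "k \<in> {..<K}"
    obtain p where p: "prime p" "\<not> p dvd L" "p\<^sup>2 dvd c + L * k"
      using neg by (auto simp: c_def)
    have "odd p" using p assms(1) primes_dvd_imp_eq[OF two_is_prime_nat p(1)] by auto
    then obtain i where i: "p = 2 * i + 1" by (elim oddE)
    have "i \<ge> 1" using prime_gt_1_nat[OF p(1)] i by simp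
    have "c + L * k \<le> (2 * L + L * (K - 1))" 
      using k assms(2) mod_less_divisor[of L c0] by (intro add_mono mult_left_mono) (auto simp: c_def)
    also have "\<dots> < (4 * L)\<^sup>2"
    proof -
      have "2 * L + L * (K - 1) = L * (8 * L + 1)" using assms(2) by (simp add: K_def algebra_simps diff_mult_distrib2)
      moreover have "L * (8 * L + 1) \<le> L * (9 * L)" using assms(2) by (intro mult_left_mono) auto
      moreover have "L * (9 * L) < (4 * L)\<^sup>2" using assms(2) by (simp add: power2_eq_square)
      ultimately show ?thesis by linarith
    qed
    finally have "c + L * k < (4 * L)\<^sup>2" .
    moreover have "p\<^sup>2 \<le> c + L * k" using p(3) assms(2) by (intro dvd_imp_le) (auto simp: c_def)
    ultimately have "p\<^sup>2 < (4 * L)\<^sup>2" by linarith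
    then have "p < 4 * L" using power_less_imp_less_base by blast
    then have "i \<le> 2 * L" using i by simp
    moreover have "coprime p L" using p by (simp add: prime_imp_coprime)
    ultimately have "i \<in> I" using i \<open>i \<ge> 1\<close> by (simp add: I_def)
    then show "k \<in> (\<Union>i\<in>I. Bad i)" using k p(3) i by (auto simp: Bad_def)
  qed
  have fin: "finite I" "\<And>i. finite (Bad i)" by (auto simp: I_def Bad_def)
  have "real K = real (card {..<K})" by simp
  also have "\<dots> \<le> real (card (\<Union>i\<in>I. Bad i))" using cover fin by (intro of_nat_mono card_mono) auto
  also have "\<dots> \<le> real (\<Sum>i\<in>I. card (Bad i))" using fin by (intro of_nat_mono card_UN_le) auto
  also have "\<dots> \<le> (\<Sum>i\<in>I. real K * (1 / (2 * real i + 1)\<^sup>2) + 1)"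
    unfolding of_nat_sum
  proof (rule sum_mono)
    fix i assume "i \<in> I"
    then have "coprime ((2 * i + 1)\<^sup>2) L" by (simp add: I_def)
    from card_dvd_in_progression_le[OF _ this, of K c]
    show "real (card (Bad i)) \<le> real K * (1 / (2 * real i + 1)\<^sup>2) + 1" by (simp add: Bad_def add.commute)
  qed
  also have "\<dots> \<le> (\<Sum>i\<in>{1..2 * L}. real K * (1 / (2 * real i + 1)\<^sup>2) + 1)"
    by (intro sum_mono2) (auto simp: I_def)
  also have "\<dots> = real K * (\<Sum>i\<in>{1..2 * L}. 1 / (2 * real i + 1)\<^sup>2) + 2 * real L"
    by (simp only: sum.distrib sum_distrib_left) simp
  also have "\<dots> \<le> real K * (1 / 4) + 2 * real L"
    by (intro add_mono mult_left_mono sum_inverse_squares_odd_le) auto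
  also have "\<dots> < real K" using assms(2) by (simp add: K_def)
  finally show False by simp
qed

text \<open>Only the residues of \<open>a0\<close> and \<open>c0\<close> modulo \<open>M\<close>
  matter for the class of the cusp. The denominator is chosen first within its class; then the
  numerator is moved by a multiple of \<open>M\<close> to become coprime to it.\<close>

lemma cusp_denominator_exists:
  fixes a0 c0 :: int and M :: nat
  assumes "M > 0" "gcd a0 c0 = 1"
  shows "\<exists>a c. c > 0 \<and> coprime a c \<and> [a = a0] (mod int M) \<and> [c = c0] (mod int M) \<and>
           (odd M \<longrightarrow> odd c) \<and> (\<forall>p. prime p \<longrightarrow> odd p \<longrightarrow> \<not> p dvd M \<longrightarrow> \<not> (int p)\<^sup>2 dvd c)"
proof -
  define L where "L = 2 * M"
  \<comment> \<open>For odd \<open>M\<close>, adding \<open>M\<close> flips the parity without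
    leaving the class modulo \<open>M\<close>; the modulus L = 2 M then preserves that parity along
    the progression.\<close>
  define c1 where "c1 = (if odd M \<and> even c0 then c0 + int M else c0)"
  have L: "even L" "L > 0" using assms by (auto simp: L_def)
  define c2 where "c2 = nat (c1 mod int L)"
  have c2: "int c2 = c1 mod int L" "c2 < L" using L by (auto simp: c2_def nat_less_iff)
  obtain k where k: "\<And>p. prime p \<Longrightarrow> \<not> p dvd L \<Longrightarrow> \<not> p\<^sup>2 dvd (c2 + L) + L * k"
    using almost_squarefree_in_progression[OF L, of c2] c2 by auto
  define c where "c = int ((c2 + L) + L * k)"
  have c_c1: "[c = c1] (mod int L)"
  proof -
    have "c = c1 mod int L + int L * (1 + int k)"
      unfolding c_def of_nat_add of_nat_mult c2(1) by (simp add: algebra_simps)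
    then show ?thesis by (simp add: cong_def)
  qed
  have "[c = c1] (mod int M)" using c_c1 by (rule cong_dvd_modulus) (simp add: L_def)
  moreover have "[c1 = c0] (mod int M)" by (simp add: c1_def cong_def)
  ultimately have c_c0: "[c = c0] (mod int M)" by (rule cong_trans)
  have "[c = c1] (mod 2)" using c_c1 by (rule cong_dvd_modulus) (simp add: L_def)
  then have par: "even c \<longleftrightarrow> even c1" by (simp add: cong_dvd_iff)
  have oddc: "odd c" if "odd M" using that par by (auto simp: c1_def)
  have "0 < (c2 + L) + L * k" using L by simp
  then have cpos: "c > 0" unfolding c_def by (simp only: of_nat_0_less_iff)
  have sqf: "\<not> (int p)\<^sup>2 dvd c" if "prime p" "odd p" "\<not> p dvd M" for p
  proof -
    have "\<not> p dvd L" using that by (auto simp: L_def prime_dvd_mult_iff dest: primes_dvd_imp_eq[OF that(1) two_is_prime_nat])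
    from k[OF that(1) this] show ?thesis
      unfolding c_def of_nat_power[symmetric] int_dvd_int_iff .
  qed
  have "gcd c (int M) = gcd c0 (int M)" using c_c0 by (rule cong_gcd_eq)
  then have "gcd (gcd a0 (int M)) c = gcd (gcd a0 c0) (int M)"
    by (metis gcd.assoc gcd.commute)
  then have "gcd (gcd a0 (int M)) c = 1" using assms(2) by simp
  then obtain t where t: "coprime (a0 + int M * t) c"
    using coprime_in_progression[of c a0 "int M"] cpos by auto
  moreover have "[a0 + int M * t = a0] (mod int M)" by (simp add: cong_def)
  ultimately show ?thesis using cpos c_c0 oddc sqf by blast
qed

section \<open>Growth at the cusps\<close>

text \<open>The quotient h^n / (z + i) tends to 0 at infinity because \<open>h\<close> is bounded by
  \<open>B\<close>, so the ordinary maximum principle applies on a large disc cut off by the line Im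
  z = y. The denominator costs a factor |z0 + i| that does not depend on n, negligible after n-th
  roots.\<close>

lemma bounded_half_plane_maximum_principle:
  fixes h :: "complex \<Rightarrow> complex"
  assumes h: "h holomorphic_on upper_half_plane" and y: "y > 0"
    and B: "\<And>z. Im z \<ge> y \<Longrightarrow> norm (h z) \<le> B"
    and b: "b > 0" "\<And>z. Im z = y \<Longrightarrow> norm (h z) \<le> b"
    and z0: "Im z0 \<ge> y"
  shows "norm (h z0) \<le> b"
proof (rule ccontr)
  assume "\<not> norm (h z0) \<le> b"
  then have "norm (h z0) / b > 1" using b(1) by simp
  \<comment> \<open>Powers of a ratio above 1 outgrow the fixed cost |z0 + i|; this exponent gives
    the final contradiction.\<close>
  then obtain n where n: "norm (z0 + \<i>) < (norm (h z0) / b) ^ n" using real_arch_pow by blast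
  define g where "g = (\<lambda>z. h z ^ n / (z + \<i>))"
  \<comment> \<open>On the arc |z| = R this radius forces |z + i| >= 1 + (B / b)^n, enough to bring
    B^n below b^n. The maximum with |z0| keeps \<open>z0\<close> inside.\<close>
  define R where "R = max (norm z0) (2 + (B / b) ^ n)"
  define S where "S = {z. Im z \<ge> y} \<inter> cball 0 R"
  have cont: "continuous_on {z. Im z \<ge> y} h"
    using y by (intro holomorphic_on_imp_continuous_on[OF holomorphic_on_subset[OF h]]) auto
  have nz: "z + \<i> \<noteq> 0" "norm (z + \<i>) \<ge> 1" if "Im z \<ge> y" for z
  proof -
    have "1 \<le> \<bar>Im (z + \<i>)\<bar>" using that y by simp
    then show "norm (z + \<i>) \<ge> 1" using abs_Im_le_cmod order_trans by blast
    then show "z + \<i> \<noteq> 0" by auto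
  qed
  have closed: "closed S" unfolding S_def by (intro closed_Int closed_halfspace_Im_ge closed_cball)
  have sub: "S \<subseteq> {z. Im z \<ge> y}" "S \<subseteq> upper_half_plane" using y by (auto simp: S_def)
  have Bpos: "B \<ge> 0" using B[OF z0] norm_ge_zero order_trans by blast
  have "norm (g z0) \<le> b ^ n"
  proof (rule maximum_modulus_frontier[of g S])
    show "g holomorphic_on interior S"
      unfolding g_def using nz sub interior_subset[of S]
      by (intro holomorphic_intros holomorphic_on_subset[OF h]) auto
    show "continuous_on (closure S) g"
      unfolding g_def closure_closed[OF closed] using nz sub
      by (intro continuous_intros continuous_on_subset[OF cont]) auto
    show "bounded S" unfolding S_def by (intro bounded_Int) auto
    show "z0 \<in> S" using z0 by (simp add: S_def R_def)
    fix z assume z: "z \<in> frontier S"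
    then have zS: "z \<in> S" using closed by (simp add: frontier_def)
    then have zy: "Im z \<ge> y" using sub by auto
    have "z \<notin> {z. Im z > y} \<inter> ball 0 R"
    proof
      assume "z \<in> {z. Im z > y} \<inter> ball 0 R"
      moreover have "open ({z. Im z > y} \<inter> ball 0 R)" by (intro open_Int open_halfspace_Im_gt open_ball)
      moreover have "{z. Im z > y} \<inter> ball 0 R \<subseteq> S" by (auto simp: S_def)
      ultimately have "z \<in> interior S" by (meson interiorI)
      then show False using z by (simp add: frontier_def)
    qed
    then consider "Im z = y" | "norm z = R" using zS by (force simp: S_def)
    then show "norm (g z) \<le> b ^ n"
    proof cases
      case 1
      have "norm (g z) = norm (h z) ^ n / norm (z + \<i>)" by (simp add: g_def norm_divide norm_power)
      also have "\<dots> \<le> norm (h z) ^ n / 1" using nz[OF zy] by (intro divide_left_mono) auto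
      also have "\<dots> \<le> b ^ n" using b(2)[OF 1] by (simp add: power_mono)
      finally show ?thesis .
    next
      case 2
      have "R - 1 \<le> norm (z + \<i>)" using norm_triangle_ineq4[of "z + \<i>" \<i>] 2 by simp
      then have ge: "1 + (B / b) ^ n \<le> norm (z + \<i>)" by (simp add: R_def)
      have pos: "(B / b) ^ n \<ge> 0" using Bpos b by simp
      have "norm (g z) = norm (h z) ^ n / norm (z + \<i>)" by (simp add: g_def norm_divide norm_power)
      also have "\<dots> \<le> B ^ n / (1 + (B / b) ^ n)"
        using ge pos Bpos B[OF zy] by (intro frac_le power_mono) auto
      also have "\<dots> \<le> b ^ n"
      proof -
        have "B ^ n = b ^ n * (B / b) ^ n" using b(1) by (simp add: power_divide)
        also have "\<dots> \<le> b ^ n * (1 + (B / b) ^ n)" using b(1) by (intro mult_left_mono) auto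
        finally show ?thesis using pos by (simp add: pos_divide_le_eq)
      qed
      finally show ?thesis .
    qed
  qed
  then have "norm (h z0) ^ n \<le> b ^ n * norm (z0 + \<i>)"
    using nz[OF z0] by (simp add: g_def norm_divide norm_power pos_divide_le_eq)
  then have "(norm (h z0) / b) ^ n \<le> norm (z0 + \<i>)"
    using b(1) by (simp add: power_divide pos_divide_le_eq mult.commute)
  then show False using n by simp
qed

lemma slash_holomorphic:
  assumes f: "f holomorphic_on upper_half_plane" and \<gamma>: "\<gamma> \<in> SL2Z"
  shows "slash \<kappa> f \<gamma> holomorphic_on upper_half_plane"
proof -
  obtain a b c d where g: "\<gamma> = (a, b, c, d)" by (cases \<gamma>) auto
  have 1: "moebius \<gamma> holomorphic_on upper_half_plane"
  proof -
    have "(\<lambda>\<tau>. (of_int a * \<tau> + of_int b) / (of_int c * \<tau> + of_int d)) holomorphic_on upper_half_plane"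
      using cocycle_nonzero[OF \<gamma>] by (intro holomorphic_intros) (auto simp: g)
    moreover have "moebius \<gamma> = (\<lambda>\<tau>. (of_int a * \<tau> + of_int b) / (of_int c * \<tau> + of_int d))"
      by (rule ext) (simp add: g)
    ultimately show ?thesis by simp
  qed
  have 2: "(\<lambda>\<tau>. f (moebius \<gamma> \<tau>)) holomorphic_on upper_half_plane"
    using holomorphic_on_compose_gen[OF 1 f] moebius_upper_half_plane[OF \<gamma>]
    by (auto simp: o_def image_subset_iff)
  \<comment> \<open>For \<open>c\<close> nonzero the base is never real, so the principal power is
    holomorphic; for \<open>c = 0\<close> it is constant.\<close>
  have 3: "(\<lambda>\<tau>. cocycle \<gamma> \<tau> powr (- of_real \<kappa>)) holomorphic_on upper_half_plane"
  proof (cases "c = 0")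
    case True
    then show ?thesis by (simp add: g)
  next
    case False
    have "(\<lambda>\<tau>. (of_int c * \<tau> + of_int d) powr (- of_real \<kappa>)) holomorphic_on upper_half_plane"
    proof (intro holomorphic_intros)
      fix z assume "z \<in> upper_half_plane"
      then have "Im (of_int c * z + of_int d) \<noteq> 0" using False by simp
      then show "of_int c * z + of_int d \<notin> \<real>\<^sub>\<le>\<^sub>0" by (auto simp: complex_nonpos_Reals_iff)
    qed
    then show ?thesis by (simp add: g)
  qed
  show ?thesis
    unfolding slash_def[abs_def] using 2 3 by (rule holomorphic_on_mult[rotated])
qed

lemma norm_powr_of_real:
  fixes z :: complex
  assumes "z \<noteq> 0"
  shows "norm (z powr of_real r) = norm z powr r"
  using assms by (simp add: powr_def)

section \<open>Absolute values of slashed forms and their dependence on the cusp\<close>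

locale abs_modular_form =
  fixes \<kappa> :: real and M :: nat and f :: "complex \<Rightarrow> complex"
  assumes kappa: "\<kappa> \<ge> 2" and M: "M \<ge> 1"
    and hol: "f holomorphic_on upper_half_plane"
    and transform: "\<And>\<gamma> \<tau>. \<gamma> \<in> principal_congruence_subgroup M \<Longrightarrow> Im \<tau> > 0 \<Longrightarrow>
           norm (f (moebius \<gamma> \<tau>)) = norm (cocycle \<gamma> \<tau>) powr \<kappa> * norm (f \<tau>)"
    and bdd: "\<And>\<gamma>. \<gamma> \<in> SL2Z \<Longrightarrow> bounded_at_i_infinity (slash \<kappa> f \<gamma>)"
begin

definition nslash :: "int_matrix2 \<Rightarrow> complex \<Rightarrow> real" where
  "nslash \<gamma> z = norm (slash \<kappa> f \<gamma> z)"

lemma nslash_eq: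
  assumes "\<gamma> \<in> SL2Z" "Im z > 0"
  shows "nslash \<gamma> z = norm (cocycle \<gamma> z) powr (- \<kappa>) * norm (f (moebius \<gamma> z))"
  using norm_powr_of_real[OF cocycle_nonzero[OF assms], of "- \<kappa>"] by (simp add: nslash_def slash_def norm_mult)

lemma nslash_nonneg: "nslash \<gamma> z \<ge> 0"
  by (simp add: nslash_def)

lemma nslash_left:
  assumes A: "A \<in> principal_congruence_subgroup M" and B: "B \<in> SL2Z" and z: "Im z > 0"
  shows "nslash (mat_mult A B) z = nslash B z"
proof -
  have A': "A \<in> SL2Z" using A by (rule principal_congruence_subgroup_SL2Z)
  have z': "Im (moebius B z) > 0" using moebius_upper_half_plane[OF B z] .
  have pos: "norm (cocycle A (moebius B z)) > 0" "norm (cocycle B z) > 0"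
    using cocycle_nonzero[OF A' z'] cocycle_nonzero[OF B z] by auto
  show ?thesis
    using pos
    by (simp add: nslash_eq mat_mult_SL2Z A' B z mat_mult_moebius_cocycle transform[OF A z'] norm_mult powr_mult powr_minus field_simps)
qed

lemma nslash_translate:
  assumes B: "B \<in> SL2Z" and z: "Im z > 0"
  shows "nslash (mat_mult B (1, k, 0, 1)) z = nslash B (z + of_int k)"
  using assms
  by (simp add: nslash_eq mat_mult_SL2Z mat_mult_moebius_cocycle translation_SL2Z)

text \<open>The principal congruence subgroup is normal in SL2(Z): a translation by a multiple of
  \<open>M\<close> on the right becomes one of its elements on the left.\<close>

lemma nslash_periodic:
  assumes \<gamma>: "\<gamma> \<in> SL2Z" and z: "Im z > 0"
  shows "nslash \<gamma> (z + of_int (j * int M)) = nslash \<gamma> z"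
proof -
  obtain a b c d where g: "\<gamma> = (a, b, c, d)" by (cases \<gamma>) auto
  define k where "k = j * int M"
  \<comment> \<open>The conjugate of the translation by \<open>k\<close> under
    \<open>\<gamma>\<close>, that is, the identity plus \<open>k\<close> times the column (a, c)
    times the row (-c, a).\<close>
  define A where "A = (1 - a * c * k, a * a * k, - c * c * k, 1 + a * c * k)"
  have det: "a * d = 1 + b * c" using \<gamma> by (simp add: g SL2Z_iff)
  have "(1 - a * c * k) * a + a * a * k * c = a" "(1 - a * c * k) * b + a * a * k * d = a * k + b + a * k * (a * d - 1 - b * c)"
    "- c * c * k * a + (1 + a * c * k) * c = c" "- c * c * k * b + (1 + a * c * k) * d = c * k + d + c * k * (a * d - 1 - b * c)"
    by (simp_all add: algebra_simps)
  then have eq: "mat_mult A \<gamma> = mat_mult \<gamma> (1, k, 0, 1)"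
    by (simp add: A_def g det)
  have "A \<in> principal_congruence_subgroup M"
    by (simp add: A_def principal_congruence_subgroup_def SL2Z_iff k_def cong_def mod_eq_dvd_iff)
       (simp add: algebra_simps)
  from nslash_left[OF this \<gamma> z] show ?thesis
    unfolding eq nslash_translate[OF \<gamma> z] by (simp add: k_def)
qed

text \<open>The first column modulo \<open>M\<close> determines the cusp up to the congruence
  subgroup: a translation on the right makes the second columns congruent as well, and the quotient
  of the matrices is then congruent to the identity.\<close>

lemma nslash_same_column:
  assumes g: "(a, b, c, d) \<in> SL2Z" and g': "(a', b', c', d') \<in> SL2Z"
    and cong: "[a = a'] (mod int M)" "[c = c'] (mod int M)"
  shows "\<exists>k. \<forall>z. Im z > 0 \<longrightarrow> nslash (a, b, c, d) z = nslash (a', b', c', d') (z + of_int k)"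
proof -
  have det: "a * d - b * c = 1" "a' * d' - b' * c' = 1" using g g' by (simp_all add: SL2Z_iff)
  obtain u where u: "a = a' + int M * u" using cong(1) by (metis cong_iff_lin cong_sym)
  obtain v where v: "c = c' + int M * v" using cong(2) by (metis cong_iff_lin cong_sym)
  \<comment> \<open>With this \<open>k\<close> the column (b - a k, d - c k) is congruent to (b',
    d'); \<open>w1\<close> and \<open>w2\<close> are the explicit quotients of the differences by
    \<open>M\<close>.\<close>
  define k where "k = d' * b - b' * d"
  define w1 where "w1 = v * b * b' - u * b * d'"
  define w2 where "w2 = v * b' * d - u * d' * d"
  have w1: "b - a * k = b' + int M * w1" 
    unfolding k_def w1_def using det u v by algebra
  have w2: "d - c * k = d' + int M * w2"
    unfolding k_def w2_def using det u v by algebra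
  \<comment> \<open>The product of (a, b - a k, c, d - c k) and the inverse of (a', b', c',
    d').\<close>
  define A where "A = (a * d' - (b - a * k) * c', (b - a * k) * a' - a * b', c * d' - (d - c * k) * c', (d - c * k) * a' - c * b')"
  have A11: "a * d' - (b - a * k) * c' = 1 + int M * (u * d' - w1 * c')"
    using w1 u det(2) by algebra
  have A12: "(b - a * k) * a' - a * b' = int M * (w1 * a' - u * b')"
    using w1 u by algebra
  have A21: "c * d' - (d - c * k) * c' = int M * (v * d' - w2 * c')"
    using w2 v by algebra
  have A22: "(d - c * k) * a' - c * b' = 1 + int M * (w2 * a' - v * b')"
    using w2 v det(2) by algebra
  have detA: "(a * d' - (b - a * k) * c') * ((d - c * k) * a' - c * b')
      - ((b - a * k) * a' - a * b') * (c * d' - (d - c * k) * c') = 1"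
    using det by algebra
  have "A \<in> principal_congruence_subgroup M"
    using detA unfolding A_def principal_congruence_subgroup_def A11 A12 A21 A22
    by (simp add: SL2Z_iff cong_def)
  moreover have "mat_mult A (a', b', c', d') = mat_mult (a, b, c, d) (1, - k, 0, 1)"
  proof -
    have "(a * d' - (b - a * k) * c') * a' + ((b - a * k) * a' - a * b') * c' = a"
      "(a * d' - (b - a * k) * c') * b' + ((b - a * k) * a' - a * b') * d' = b - a * k"
      "(c * d' - (d - c * k) * c') * a' + ((d - c * k) * a' - c * b') * c' = c"
      "(c * d' - (d - c * k) * c') * b' + ((d - c * k) * a' - c * b') * d' = d - c * k"
      using det(2) by algebra+
    then show ?thesis by (simp add: A_def)
  qed
  ultimately have *: "nslash (a, b, c, d) (z + of_int (- k)) = nslash (a', b', c', d') z" if "Im z > 0" for z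
    using nslash_left[OF _ g' that] nslash_translate[OF g that] by metis
  have "nslash (a, b, c, d) z = nslash (a', b', c', d') (z + of_int k)" if "Im z > 0" for z
    using *[of "z + of_int k"] that by simp
  then show ?thesis by blast
qed

text \<open>Periodicity reduces to a strip of width \<open>M\<close>; compactness handles the
  moderate heights and the growth condition at the cusp the large ones.\<close>

lemma nslash_bounded_single:
  assumes \<gamma>: "\<gamma> \<in> SL2Z" and T: "T > 0"
  shows "\<exists>B. \<forall>z. Im z \<ge> T \<longrightarrow> nslash \<gamma> z \<le> B"
proof -
  obtain A B0 where AB: "\<And>\<tau>. Im \<tau> \<ge> A \<Longrightarrow> nslash \<gamma> \<tau> \<le> B0"
    using bdd[OF \<gamma>] unfolding bounded_at_i_infinity_def nslash_def by blast
  let ?K = "cbox (Complex 0 T) (Complex (real M) (max A T))"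
  have "continuous_on ?K (slash \<kappa> f \<gamma>)"
    using T by (intro holomorphic_on_imp_continuous_on[OF holomorphic_on_subset[OF slash_holomorphic[OF hol \<gamma>]]])
       (auto simp: in_cbox_complex_iff)
  then have "bounded (slash \<kappa> f \<gamma> ` ?K)"
    by (intro compact_imp_bounded compact_continuous_image compact_cbox)
  then obtain B1 where B1: "\<And>z. z \<in> ?K \<Longrightarrow> nslash \<gamma> z \<le> B1"
    unfolding bounded_iff nslash_def by blast
  have "nslash \<gamma> z \<le> max B0 B1" if z: "Im z \<ge> T" for z
  proof (cases "Im z \<ge> A")
    case True
    then show ?thesis using AB by (simp add: le_max_iff_disj)
  next
    case False
    define j where "j = - \<lfloor>Re z / real M\<rfloor>"
    have Mpos: "real M > 0" using M by simp
    have "real_of_int \<lfloor>Re z / real M\<rfloor> * real M \<le> Re z"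
      using Mpos by (metis floor_divide_lower)
    moreover have "Re z < (real_of_int \<lfloor>Re z / real M\<rfloor> + 1) * real M"
      using Mpos by (metis floor_divide_upper)
    ultimately have "z + of_int (j * int M) \<in> ?K"
      using z False by (simp add: in_cbox_complex_iff j_def algebra_simps)
    from B1[OF this] show ?thesis using nslash_periodic[OF \<gamma>, of z j] z T by simp
  qed
  then show ?thesis by blast
qed

text \<open>The class of the cusp a / c, which determines \<open>nslash\<close> up to an integer
  translation. That it has finitely many values makes the bounds uniform over SL2(Z).\<close>

definition residue_column :: "int_matrix2 \<Rightarrow> int \<times> int" where
  "residue_column \<gamma> = (fst \<gamma> mod int M, fst (snd (snd \<gamma>)) mod int M)"

lemma residue_column_range: "residue_column \<gamma> \<in> {0..<int M} \<times> {0..<int M}"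
  using M by (simp add: residue_column_def)

lemma nslash_residue_column:
  assumes "\<gamma> \<in> SL2Z" "\<gamma>' \<in> SL2Z" "residue_column \<gamma> = residue_column \<gamma>'"
  shows "\<exists>k. \<forall>z. Im z > 0 \<longrightarrow> nslash \<gamma> z = nslash \<gamma>' (z + of_int k)"
  using assms nslash_same_column
  by (cases \<gamma>; cases \<gamma>') (auto simp: residue_column_def cong_def)

lemma nslash_finite:
  obtains R where "finite R" "R \<subseteq> SL2Z"
    "\<And>\<gamma>. \<gamma> \<in> SL2Z \<Longrightarrow> \<exists>\<gamma>0\<in>R. \<exists>k::int. \<forall>z. Im z > 0 \<longrightarrow> nslash \<gamma> z = nslash \<gamma>0 (z + of_int k)"
proof -
  have fin: "finite (residue_column ` SL2Z)"
    by (rule finite_subset[of _ "{0..<int M} \<times> {0..<int M}"]) (use residue_column_range in blast)+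
  then obtain R where R: "finite R" "R \<subseteq> SL2Z" "residue_column ` SL2Z = residue_column ` R"
    using finite_subset_image[OF fin subset_refl] by blast
  have "\<exists>\<gamma>0\<in>R. \<exists>k::int. \<forall>z. Im z > 0 \<longrightarrow> nslash \<gamma> z = nslash \<gamma>0 (z + of_int k)" if \<gamma>: "\<gamma> \<in> SL2Z" for \<gamma>
  proof -
    obtain \<gamma>0 where "\<gamma>0 \<in> R" "residue_column \<gamma> = residue_column \<gamma>0" using \<gamma> R(3) by blast
    then show ?thesis using nslash_residue_column[OF \<gamma>, of \<gamma>0] R(2) by (metis subsetD)
  qed
  then show ?thesis using that R by blast
qed

text \<open>Integer translations do not change the height, so finitely many representatives decide,
  and the sum of their heights bounds each of them.\<close>

lemma nslash_uniform:
  assumes "\<And>\<gamma>. \<gamma> \<in> SL2Z \<Longrightarrow> \<exists>T>0. \<forall>z. Im z \<ge> T \<longrightarrow> nslash \<gamma> z \<le> b"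
  shows "\<exists>T>0. \<forall>\<gamma>\<in>SL2Z. \<forall>z. Im z \<ge> T \<longrightarrow> nslash \<gamma> z \<le> b"
proof -
  obtain R where R: "finite R" "R \<subseteq> SL2Z"
    "\<And>\<gamma>. \<gamma> \<in> SL2Z \<Longrightarrow> \<exists>\<gamma>0\<in>R. \<exists>k::int. \<forall>z. Im z > 0 \<longrightarrow> nslash \<gamma> z = nslash \<gamma>0 (z + of_int k)"
    using nslash_finite by blast
  obtain T where T: "\<And>\<gamma>. \<gamma> \<in> R \<Longrightarrow> T \<gamma> > 0" "\<And>\<gamma> z. \<gamma> \<in> R \<Longrightarrow> Im z \<ge> T \<gamma> \<Longrightarrow> nslash \<gamma> z \<le> b"
    using assms R(2) by (metis subsetD)
  have le: "T \<gamma> \<le> 1 + sum T R" if "\<gamma> \<in> R" for \<gamma>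
    using member_le_sum[OF that, of T] T(1) R(1) by (force simp: less_imp_le)
  have pos: "1 + sum T R > 0" using T(1) by (intro add_pos_nonneg sum_nonneg) (auto simp: less_imp_le)
  have "nslash \<gamma> z \<le> b" if \<gamma>: "\<gamma> \<in> SL2Z" and z: "Im z \<ge> 1 + sum T R" for \<gamma> z
  proof -
    obtain \<gamma>0 k where \<gamma>0: "\<gamma>0 \<in> R" "\<And>z. Im z > 0 \<Longrightarrow> nslash \<gamma> z = nslash \<gamma>0 (z + of_int k)"
      using R(3)[OF \<gamma>] by blast
    show ?thesis using T(2)[OF \<gamma>0(1), of "z + of_int k"] le[OF \<gamma>0(1)] \<gamma>0(2)[of z] pos z by simp
  qed
  then show ?thesis using pos by blast
qed

lemma nslash_bounded:
  assumes T: "T > 0"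
  shows "\<exists>B. \<forall>\<gamma>\<in>SL2Z. \<forall>z. Im z \<ge> T \<longrightarrow> nslash \<gamma> z \<le> B"
proof -
  obtain R where R: "finite R" "R \<subseteq> SL2Z"
    "\<And>\<gamma>. \<gamma> \<in> SL2Z \<Longrightarrow> \<exists>\<gamma>0\<in>R. \<exists>k::int. \<forall>z. Im z > 0 \<longrightarrow> nslash \<gamma> z = nslash \<gamma>0 (z + of_int k)"
    using nslash_finite by blast
  obtain B where B: "\<And>\<gamma> z. \<gamma> \<in> R \<Longrightarrow> Im z \<ge> T \<Longrightarrow> nslash \<gamma> z \<le> B \<gamma>"
    using nslash_bounded_single[OF _ T] R(2) by (metis subsetD)
  have "nslash \<gamma> z \<le> (\<Sum>\<gamma>\<in>R. \<bar>B \<gamma>\<bar>)" if \<gamma>: "\<gamma> \<in> SL2Z" and z: "Im z \<ge> T" for \<gamma> z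
  proof -
    obtain \<gamma>0 k where \<gamma>0: "\<gamma>0 \<in> R" "\<And>z. Im z > 0 \<Longrightarrow> nslash \<gamma> z = nslash \<gamma>0 (z + of_int k)"
      using R(3)[OF \<gamma>] by blast
    have "B \<gamma>0 \<le> (\<Sum>\<gamma>\<in>R. \<bar>B \<gamma>\<bar>)" using member_le_sum[OF \<gamma>0(1), of "\<lambda>\<gamma>. \<bar>B \<gamma>\<bar>"] R(1) by force
    then show ?thesis using B[OF \<gamma>0(1), of "z + of_int k"] \<gamma>0(2)[of z] T z by simp
  qed
  then show ?thesis by blast
qed

text \<open>\<open>\<Phi>\<close> is the limit superior, as the height grows, of the supremum of
  \<open>nslash\<close> over all cusps. The last clause holds at every height y: if
  \<open>nslash\<close> stayed at or below 9/10 of \<open>\<Phi>\<close> on the line Im z = y, the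
  maximum principle would keep it so above that line, against the choice of the cusp.\<close>

lemma maximal_cusp:
  assumes noncusp: "\<gamma>1 \<in> SL2Z" "\<not> zero_at_i_infinity (slash \<kappa> f \<gamma>1)"
  shows "\<exists>\<Phi> T0 a0 c0. \<Phi> > 0 \<and> T0 > 0 \<and> gcd a0 c0 = 1 \<and>
           (\<forall>\<gamma>\<in>SL2Z. \<forall>z. Im z \<ge> T0 \<longrightarrow> nslash \<gamma> z \<le> 11 / 10 * \<Phi>) \<and>
           (\<forall>a b c d y. (a, b, c, d) \<in> SL2Z \<longrightarrow> [a = a0] (mod int M) \<longrightarrow> [c = c0] (mod int M) \<longrightarrow> y > 0 \<longrightarrow>
              (\<exists>x. 0 \<le> x \<and> x \<le> real M \<and> nslash (a, b, c, d) (Complex x y) > 9 / 10 * \<Phi>))"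
proof -
  define Bd where "Bd = (\<lambda>b. \<exists>T>0. \<forall>\<gamma>\<in>SL2Z. \<forall>z. Im z \<ge> T \<longrightarrow> nslash \<gamma> z \<le> b)"
  define \<Phi> where "\<Phi> = Inf {b. b \<ge> 0 \<and> Bd b}"
  have ne: "{b. b \<ge> 0 \<and> Bd b} \<noteq> {}"
  proof -
    obtain B where "\<forall>\<gamma>\<in>SL2Z. \<forall>z. Im z \<ge> 1 \<longrightarrow> nslash \<gamma> z \<le> B" using nslash_bounded[of 1] by auto
    then have "Bd \<bar>B\<bar>" unfolding Bd_def by (intro exI[of _ 1]) (auto intro: order_trans[OF _ abs_ge_self])
    then have "\<bar>B\<bar> \<in> {b. b \<ge> 0 \<and> Bd b}" by simp
    then show ?thesis by blast
  qed
  have bb: "bdd_below {b. b \<ge> 0 \<and> Bd b}" by (rule bdd_belowI[of _ 0]) auto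
  obtain \<delta> where \<delta>: "\<delta> > 0" "\<And>T. \<exists>z. Im z \<ge> T \<and> nslash \<gamma>1 z \<ge> \<delta>"
  proof -
    obtain e where e: "e > 0" "\<not> (\<forall>\<^sub>F z in filtercomap Im at_top. dist (slash \<kappa> f \<gamma>1 z) 0 < e)"
      using noncusp(2) unfolding zero_at_i_infinity_def tendsto_iff by blast
    have "\<exists>z. Im z \<ge> T \<and> nslash \<gamma>1 z \<ge> e" for T
    proof (rule ccontr)
      assume neg: "\<not> ?thesis"
      have "\<forall>z. Im z \<ge> T \<longrightarrow> dist (slash \<kappa> f \<gamma>1 z) 0 < e"
      proof (intro allI impI)
        fix z assume "T \<le> Im z"
        then have "\<not> nslash \<gamma>1 z \<ge> e" using neg by blast
        then show "dist (slash \<kappa> f \<gamma>1 z) 0 < e" by (simp add: nslash_def)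
      qed
      then have "\<forall>\<^sub>F z in filtercomap Im at_top. dist (slash \<kappa> f \<gamma>1 z) 0 < e"
        unfolding eventually_filtercomap by (intro exI[of _ "\<lambda>y. y \<ge> T"]) (auto simp: eventually_ge_at_top)
      then show False using e(2) by simp
    qed
    then show ?thesis using that e(1) by blast
  qed
  \<comment> \<open>Here non-cuspidality enters: values at least \<open>\<delta>\<close> at
    arbitrarily large heights at one cusp keep every eventual bound, hence \<open>\<Phi>\<close>,
    away from 0.\<close>
  have "\<delta> \<le> b" if "Bd b" for b
    using that \<delta>(2) noncusp(1) unfolding Bd_def by (meson order_trans)
  then have "\<delta> \<le> \<Phi>" unfolding \<Phi>_def using ne by (intro cInf_greatest) auto
  then have \<Phi>: "\<Phi> > 0" using \<delta>(1) by simp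
  have "Bd (11 / 10 * \<Phi>)"
  proof -
    have "\<Phi> < 11 / 10 * \<Phi>" using \<Phi> by simp
    then obtain b where b: "b \<ge> 0" "Bd b" "b < 11 / 10 * \<Phi>"
      using cInf_lessD[OF ne, of "11 / 10 * \<Phi>"] unfolding \<Phi>_def by auto
    then show ?thesis unfolding Bd_def by (meson less_imp_le order_trans)
  qed
  then obtain T0 where T0: "T0 > 0" "\<forall>\<gamma>\<in>SL2Z. \<forall>z. Im z \<ge> T0 \<longrightarrow> nslash \<gamma> z \<le> 11 / 10 * \<Phi>"
    unfolding Bd_def by blast
  have "\<not> Bd (9 / 10 * \<Phi>)"
  proof
    assume "Bd (9 / 10 * \<Phi>)"
    then have "\<Phi> \<le> 9 / 10 * \<Phi>" unfolding \<Phi>_def using \<Phi> bb by (intro cInf_lower) (auto simp: \<Phi>_def)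
    then show False using \<Phi> by simp
  qed
  \<comment> \<open>\<open>nslash_uniform\<close> is read contrapositively: since no height makes
    9/10 of \<open>\<Phi>\<close> a common bound, a single matrix exceeds it at arbitrarily large
    heights.\<close>
  then obtain \<gamma>0 where \<gamma>0: "\<gamma>0 \<in> SL2Z" "\<And>T. T > 0 \<Longrightarrow> \<exists>z. Im z \<ge> T \<and> nslash \<gamma>0 z > 9 / 10 * \<Phi>"
    using nslash_uniform[of "9 / 10 * \<Phi>"] unfolding Bd_def by (meson not_le)
  obtain a0 b0 c0 d0 where g0: "\<gamma>0 = (a0, b0, c0, d0)" by (cases \<gamma>0) auto
  have "gcd a0 c0 dvd a0 * d0 - b0 * c0"
    by (intro dvd_diff dvd_mult2[OF gcd_dvd1] dvd_mult[OF gcd_dvd2])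
  then have "is_unit (gcd a0 c0)" using \<gamma>0(1) by (simp only: g0 SL2Z_iff)
  then have gcd: "gcd a0 c0 = 1" by (simp only: is_unit_gcd coprime_iff_gcd_eq_1)
  have final: "\<exists>x. 0 \<le> x \<and> x \<le> real M \<and> nslash (a, b, c, d) (Complex x y) > 9 / 10 * \<Phi>"
    if g: "(a, b, c, d) \<in> SL2Z" and col: "[a = a0] (mod int M)" "[c = c0] (mod int M)" and y: "y > 0" for a b c d y
  proof (rule ccontr)
    assume neg: "\<not> ?thesis"
    let ?\<gamma> = "(a, b, c, d)"
    obtain k where k: "\<And>z. Im z > 0 \<Longrightarrow> nslash ?\<gamma> z = nslash \<gamma>0 (z + of_int k)"
      using nslash_same_column[OF g _ col] \<gamma>0(1) unfolding g0 by blast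
    obtain B where B: "\<forall>\<gamma>\<in>SL2Z. \<forall>z. Im z \<ge> y \<longrightarrow> nslash \<gamma> z \<le> B" using nslash_bounded[OF y] by blast
    have line: "nslash ?\<gamma> z \<le> 9 / 10 * \<Phi>" if "Im z = y" for z
    proof -
      define j where "j = - \<lfloor>Re z / real M\<rfloor>"
      have Mpos: "real M > 0" using M by simp
      have "real_of_int \<lfloor>Re z / real M\<rfloor> * real M \<le> Re z"
        using Mpos by (metis floor_divide_lower)
      moreover have "Re z < (real_of_int \<lfloor>Re z / real M\<rfloor> + 1) * real M"
        using Mpos by (metis floor_divide_upper)
      ultimately have r: "0 \<le> Re z + real_of_int (j * int M)" "Re z + real_of_int (j * int M) \<le> real M"
        by (simp_all add: j_def algebra_simps)
      have "z + of_int (j * int M) = Complex (Re z + real_of_int (j * int M)) y"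
        using that by (simp add: complex_eq_iff)
      then show ?thesis using neg r nslash_periodic[OF g, of z j] that y by (metis not_le)
    qed
    have all: "nslash ?\<gamma> z \<le> 9 / 10 * \<Phi>" if "Im z \<ge> y" for z
      unfolding nslash_def
      by (rule bounded_half_plane_maximum_principle[OF slash_holomorphic[OF hol g] y, where B = B])
         (use B g \<Phi> line that in \<open>auto simp: nslash_def\<close>)
    obtain w where w: "Im w \<ge> y" "nslash \<gamma>0 w > 9 / 10 * \<Phi>" using \<gamma>0(2)[OF y] by blast
    then show False using all[of "w - of_int k"] k[of "w - of_int k"] y by simp
  qed
  show ?thesis
    by (intro exI[of _ \<Phi>] exI[of _ T0] exI[of _ a0] exI[of _ c0] conjI allI impI \<Phi> T0 gcd final)
qed

end

section \<open>Fourier expansions\<close>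

lemma Im_scaled_log: "Im (of_nat M * l / (2 * of_real pi * \<i>)) = - real M * Re l / (2 * pi)"
proof -
  have "of_nat M * l / (2 * of_real pi * \<i>) = of_real (real M / (2 * pi)) * (l / \<i>)"
    by (simp add: field_simps)
  also have "l / \<i> = - (\<i> * l)" by (simp add: field_simps)
  finally show ?thesis by simp
qed

text \<open>\<open>h\<close> factors through q = exp (2 pi i tau / M): periodicity makes the branch
  of the logarithm irrelevant, boundedness removes the singularity at q = 0, and the Taylor series
  in q is the expansion.\<close>

lemma fourier_expansion_exists:
  fixes h :: "complex \<Rightarrow> complex" and M :: nat
  assumes M: "M > 0" and hol: "h holomorphic_on upper_half_plane"
    and per: "\<And>\<tau>. Im \<tau> > 0 \<Longrightarrow> h (\<tau> + of_nat M) = h \<tau>"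
    and bdd: "bounded_at_i_infinity h"
  shows "\<exists>a. \<forall>\<tau>. Im \<tau> > 0 \<longrightarrow> (\<lambda>n. a n * exp (2 * of_real pi * \<i> * of_nat n * \<tau> / of_nat M)) sums h \<tau>"
proof -
  have per_nat: "h (\<tau> + of_nat M * of_nat k) = h \<tau>" if "Im \<tau> > 0" for \<tau> k
  proof (induction k)
    case (Suc k)
    have "\<tau> + of_nat M * of_nat (Suc k) = (\<tau> + of_nat M * of_nat k) + of_nat M" by (simp add: algebra_simps)
    also have "h \<dots> = h (\<tau> + of_nat M * of_nat k)" using that by (intro per) simp
    finally show ?case using Suc by simp
  qed simp
  have per_int: "h (\<tau> + of_nat M * of_int k) = h \<tau>" if "Im \<tau> > 0" for \<tau> k
  proof (cases "k \<ge> 0")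
    case True
    then show ?thesis using per_nat[OF that, of "nat k"] by simp
  next
    case False
    have "h ((\<tau> + of_nat M * of_int k) + of_nat M * of_nat (nat (- k))) = h (\<tau> + of_nat M * of_int k)"
      using that by (intro per_nat) simp
    then show ?thesis using False by (simp add: algebra_simps)
  qed
  define w where "w = (\<lambda>l. of_nat M * l / (2 * of_real pi * \<i>))"
  have w_Im: "Im (w l) = - real M * Re l / (2 * pi)" for l
    unfolding w_def by (rule Im_scaled_log)
  have h_w: "h (w l) = h (w l')" if "exp l = exp l'" "Re l < 0" for l l'
  proof -
    obtain k :: int where k: "l = l' + (of_int (2 * k) * pi) * \<i>" using \<open>exp l = exp l'\<close> unfolding exp_eq by blast
    have "w l = w l' + of_nat M * of_int k" unfolding w_def k by (simp add: field_simps)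
    moreover have "Im (w l') > 0" using that(2) M by (simp add: w_Im k divide_neg_pos mult_pos_neg)
    ultimately show ?thesis using per_int by simp
  qed
  define g0 where "g0 = (\<lambda>q. h (w (Ln q)))"
  have g0_hol: "g0 holomorphic_on ball 0 1 - {0}"
  proof (rule holomorphic_onI)
    fix q0 :: complex assume q0: "q0 \<in> ball 0 1 - {0}"
    \<comment> \<open>On \<open>U\<close> the branch \<open>Ln (q / q0) + Ln q0\<close> is
      holomorphic even if \<open>q0\<close> lies on the cut of \<open>Ln\<close>; by
      \<open>h_w\<close> it yields the same function \<open>g0\<close>.\<close>
    define U where "U = (ball 0 1 - {0}) \<inter> (\<lambda>q. q / q0) -` (- \<real>\<^sub>\<le>\<^sub>0)"
    have openU: "open U"
    proof -
      have "open ((\<lambda>q. q / q0) -` (- \<real>\<^sub>\<le>\<^sub>0))"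
        using q0 by (intro open_vimage continuous_intros) (auto simp: open_Compl)
      then show ?thesis unfolding U_def by (intro open_Int open_Diff) auto
    qed
    have q0U: "q0 \<in> U" using q0 by (simp add: U_def)
    have eq: "g0 q = h (w (Ln (q / q0) + Ln q0))" if "q \<in> U" for q
    proof -
      have "q \<noteq> 0" "q0 \<noteq> 0" "norm q < 1" using that q0 by (auto simp: U_def)
      then show ?thesis unfolding g0_def
        by (intro h_w) (auto simp: exp_add)
    qed
    have "(\<lambda>q. h (w (Ln (q / q0) + Ln q0))) holomorphic_on U"
    proof (rule holomorphic_on_compose_gen[OF _ hol, unfolded o_def])
      show "(\<lambda>q. w (Ln (q / q0) + Ln q0)) holomorphic_on U"
        unfolding w_def using q0 by (intro holomorphic_intros) (auto simp: U_def)
      show "(\<lambda>q. w (Ln (q / q0) + Ln q0)) ` U \<subseteq> upper_half_plane"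
      proof (rule image_subsetI)
        fix q assume q: "q \<in> U"
        then have q': "q \<noteq> 0" "q0 \<noteq> 0" "norm q < 1" using q0 by (auto simp: U_def)
        have "Re (Ln (q / q0) + Ln q0) = ln (norm q)" using q' by (simp add: norm_divide ln_div)
        also have "\<dots> < 0" using q' by simp
        finally show "w (Ln (q / q0) + Ln q0) \<in> upper_half_plane"
          using M by (simp add: w_Im divide_neg_pos mult_pos_neg)
      qed
    qed
    then have "g0 holomorphic_on U" using eq by (simp cong: holomorphic_cong)
    then have "g0 field_differentiable at q0" using openU q0U holomorphic_on_imp_differentiable_at by blast
    then show "g0 field_differentiable at q0 within ball 0 1 - {0}"
      by (rule field_differentiable_at_within)
  qed
  obtain A B where AB: "\<And>\<tau>. Im \<tau> \<ge> A \<Longrightarrow> norm (h \<tau>) \<le> B" using bdd unfolding bounded_at_i_infinity_def by blast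
  have "\<forall>\<^sub>F q in at 0. norm (g0 q) \<le> B"
  proof -
    \<comment> \<open>The radius that corresponds to height \<open>A\<close> in the variable
      q.\<close>
    define r where "r = exp (- 2 * pi * A / real M)"
    have "norm (g0 q) \<le> B" if "q \<noteq> 0" "norm q < r" for q
    proof -
      have "ln (norm q) \<le> ln r" using that by (subst ln_le_cancel_iff) (auto simp: r_def)
      then have "ln (norm q) \<le> - 2 * pi * A / real M" by (simp add: r_def)
      then have "A \<le> - real M * ln (norm q) / (2 * pi)" using M by (simp add: field_simps)
      then show ?thesis using that unfolding g0_def by (intro AB) (simp add: w_Im)
    qed
    moreover have "r > 0" by (simp add: r_def)
    ultimately show ?thesis unfolding eventually_at by (intro exI[of _ r]) auto
  qed
  then obtain g where g: "g holomorphic_on ball 0 1" "\<And>q. q \<in> ball 0 1 - {0} \<Longrightarrow> g q = g0 q"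
    using holomorphic_on_extend_bounded[OF g0_hol] by (auto simp: interior_open)
  have "(\<lambda>n. (deriv ^^ n) g 0 / fact n * exp (2 * of_real pi * \<i> * of_nat n * \<tau> / of_nat M)) sums h \<tau>" if \<tau>: "Im \<tau> > 0" for \<tau>
  proof -
    define l where "l = 2 * of_real pi * \<i> * \<tau> / of_nat M"
    define q where "q = exp l"
    have "Re l = - 2 * pi * Im \<tau> / real M" 
    proof -
      have "l = of_real (2 * pi / real M) * (\<i> * \<tau>)" by (simp add: l_def)
      then show ?thesis by simp
    qed
    then have Re_l: "Re l < 0" using \<tau> M by (simp add: divide_neg_pos)
    then have q: "q \<in> ball 0 1 - {0}" by (simp add: q_def)
    have "(\<lambda>n. (deriv ^^ n) g 0 / fact n * (q - 0) ^ n) sums g q"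
      using q by (intro holomorphic_power_series[OF g(1)]) auto
    moreover have "g q = h (w l)"
      unfolding g(2)[OF q] g0_def using h_w[of l "Ln q"] Re_l by (simp add: q_def)
    moreover have "w l = \<tau>" using M by (simp add: w_def l_def)
    moreover have "(q - 0) ^ n = exp (2 * of_real pi * \<i> * of_nat n * \<tau> / of_nat M)" for n
      unfolding q_def l_def diff_zero exp_of_nat_mult[symmetric] by (simp add: mult_ac)
    ultimately show ?thesis by simp
  qed
  then show ?thesis by (intro exI[of _ "\<lambda>n. (deriv ^^ n) g 0 / fact n"] allI impI)
qed

text \<open>Once the coefficients below \<open>n\<close> vanish, divide by q^n and let q tend to 0;
  a limit is needed because q = 0 is not attained in the half-plane.\<close>

lemma fourier_coeff_unique_zero:
  fixes c :: "nat \<Rightarrow> complex" and M :: nat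
  assumes M: "M > 0"
    and c: "\<And>\<tau>. Im \<tau> > 0 \<Longrightarrow> (\<lambda>n. c n * exp (2 * of_real pi * \<i> * of_nat n * \<tau> / of_nat M)) sums 0"
  shows "c n = 0"
proof (induction n rule: less_induct)
  case (less n)
  have pow: "(\<lambda>n. c n * q ^ n) sums 0" if "q \<noteq> 0" "norm q < 1" for q
  proof -
    define \<tau> where "\<tau> = of_nat M * Ln q / (2 * of_real pi * \<i>)"
    have "Im \<tau> = - real M * ln (norm q) / (2 * pi)"
      using that(1) Im_scaled_log[of M "Ln q"] by (simp add: \<tau>_def)
    then have "Im \<tau> > 0" using M that by (simp add: divide_neg_pos mult_pos_neg)
    moreover have "exp (2 * of_real pi * \<i> * of_nat n * \<tau> / of_nat M) = q ^ n" for n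
    proof -
      have "2 * of_real pi * \<i> * of_nat n * \<tau> / of_nat M = of_nat n * Ln q" using M by (simp add: \<tau>_def)
      then show ?thesis using that by (simp add: exp_of_nat_mult)
    qed
    ultimately show ?thesis using c[of \<tau>] by (simp only:)
  qed
  have shifted: "(\<lambda>k. c (k + n) * q ^ k) sums 0" if "q \<noteq> 0" "norm q < 1" for q
  proof -
    have "(\<lambda>k. c (k + n) * q ^ (k + n)) sums (0 - (\<Sum>i<n. c i * q ^ i))"
      by (rule sums_split_initial_segment[OF pow[OF that]])
    moreover have "(\<Sum>i<n. c i * q ^ i) = 0" using less by (intro sum.neutral) auto
    ultimately have "(\<lambda>k. c (k + n) * q ^ (k + n) / q ^ n) sums (0 / q ^ n)" by (intro sums_divide) simp
    then show ?thesis using that by (simp add: power_add)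
  qed
  have "((\<lambda>_ :: complex. 0 :: complex) \<longlongrightarrow> c (0 + n)) (at 0)"
    by (rule powser_limit_0_strong[where s = 1 and a = "\<lambda>k. c (k + n)"]) (use shifted in auto)
  then show ?case by (simp add: tendsto_const_iff)
qed

lemma fourier_coeff_eqI:
  assumes M: "M > 0"
    and a: "\<And>\<tau>. Im \<tau> > 0 \<Longrightarrow> (\<lambda>n. a n * exp (2 * of_real pi * \<i> * of_nat n * \<tau> / of_nat M)) sums f \<tau>"
  shows "fourier_coeff M f = a"
  unfolding fourier_coeff_def
proof (rule the_equality)
  show "\<forall>\<tau>\<in>upper_half_plane. (\<lambda>n. a n * exp (2 * of_real pi * \<i> * of_nat n * \<tau> / of_nat M)) sums f \<tau>"
    using a by simp
  fix b assume b: "\<forall>\<tau>\<in>upper_half_plane. (\<lambda>n. b n * exp (2 * of_real pi * \<i> * of_nat n * \<tau> / of_nat M)) sums f \<tau>"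
  have "(\<lambda>n. (b n - a n) * exp (2 * of_real pi * \<i> * of_nat n * \<tau> / of_nat M)) sums 0" if "Im \<tau> > 0" for \<tau>
    using sums_diff[OF bspec[OF b, of \<tau>] a[OF that]] that by (simp add: left_diff_distrib)
  from fourier_coeff_unique_zero[OF M this] show "b = a" by (auto simp: fun_eq_iff)
qed

section \<open>Exponential integrals and sums, and the passage to counting\<close>

lemma has_integral_exp_period:
  fixes M :: nat and k :: int
  assumes M: "M > 0"
  shows "((\<lambda>x. exp (2 * of_real pi * \<i> * of_int k * of_real x / of_nat M)) has_integral (if k = 0 then of_nat M else 0)) {0..real M}"
proof (cases "k = 0")
  case True
  then show ?thesis using has_integral_const_real[of "1 :: complex" 0 "real M"] by (simp add: scaleR_conv_of_real)
next
  case False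
  define c where "c = 2 * of_real pi * \<i> * of_int k / of_nat M"
  have c: "c \<noteq> 0" using False M by (simp add: c_def)
  have "c * of_real (real M) = of_int (2 * k) * of_real pi * \<i>" using M by (simp add: c_def)
  then have "exp (c * of_real (real M)) = 1"
    unfolding exp_eq_1 by (auto intro!: exI[of _ k])
  then show ?thesis using has_integral_exp_times[OF c, of 0 "real M"] False by (simp add: c_def)
qed

text \<open>The full geometric series is e^(-u) / (1 - e^(-u)), and 1 + u <= e^u bounds it by 1 /
  u.\<close>

lemma geometric_exp_sum_le:
  assumes "u > 0"
  shows "(\<Sum>m\<in>{1..<K}. exp (- real m * u)) \<le> 1 / u"
proof -
  define r where "r = exp (- u)"
  have r: "0 < r" "r < 1" using assms by (auto simp: r_def)
  have rm: "exp (- real m * u) = r ^ m" for m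
    unfolding r_def exp_of_nat_mult[symmetric] by simp
  have "(\<Sum>m\<in>{1..<K}. r ^ m) \<le> r / (1 - r)"
  proof (cases "K \<ge> 1")
    case True
    have "(\<Sum>m<K. r ^ m) = (1 - r ^ K) / (1 - r)" using r by (simp add: sum_gp_strict)
    moreover have "(\<Sum>m<K. r ^ m) = 1 + (\<Sum>m\<in>{1..<K}. r ^ m)"
      using True by (simp add: sum.atLeast_Suc_lessThan lessThan_atLeast0)
    ultimately have "(\<Sum>m\<in>{1..<K}. r ^ m) = (1 - r ^ K) / (1 - r) - 1" by simp
    also have "\<dots> \<le> 1 / (1 - r) - 1" using r by (intro diff_right_mono divide_right_mono) auto
    also have "\<dots> = r / (1 - r)" using r by (simp add: field_simps)
    finally show ?thesis .
  qed (use r in auto)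
  also have "\<dots> \<le> 1 / u"
  proof -
    have "1 + u \<le> exp u" by (rule exp_ge_add_one_self)
    then have "r * (1 + u) \<le> r * exp u" using r by (intro mult_left_mono) auto
    then have "r * (1 + u) \<le> 1" by (simp add: r_def flip: exp_add)
    then have "r * u \<le> 1 - r" by (simp add: algebra_simps)
    then show ?thesis using r assms by (simp add: field_simps)
  qed
  finally show ?thesis by (simp only: rm)
qed

lemma sum_inverse_squares_tail_le:
  assumes "D \<ge> (1::nat)"
  shows "(\<Sum>p\<in>{D<..<K}. 1 / (real p)\<^sup>2) \<le> 1 / real D"
proof -
  have "(\<Sum>p\<in>{D<..<Suc (D + m)}. 1 / (real p)\<^sup>2) \<le> 1 / real D - 1 / real (D + m)" for m
  proof (induction m)
    case (Suc m)
    have "{D<..<Suc (D + Suc m)} = insert (D + Suc m) {D<..<Suc (D + m)}" by auto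
    then have "(\<Sum>p\<in>{D<..<Suc (D + Suc m)}. 1 / (real p)\<^sup>2) = 1 / (real (D + Suc m))\<^sup>2 + (\<Sum>p\<in>{D<..<Suc (D + m)}. 1 / (real p)\<^sup>2)"
      by simp
    moreover have "1 / (real (D + Suc m))\<^sup>2 \<le> 1 / real (D + m) - 1 / real (D + Suc m)"
    proof -
      define x where "x = real (D + m)"
      have x: "x > 0" using assms by (simp add: x_def)
      have "1 / (x + 1)\<^sup>2 \<le> 1 / (x * (x + 1))"
        using x by (intro divide_left_mono mult_pos_pos) (auto simp: power2_eq_square)
      also have "\<dots> = 1 / x - 1 / (x + 1)" using x by (simp add: field_simps)
      finally show ?thesis by (simp add: x_def add_ac)
    qed
    ultimately show ?case using Suc.IH by linarith
  next
    case 0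
    have e: "{D<..<Suc (D + 0)} = {}" by auto
    show ?case unfolding e by simp
  qed
  from this[of "K - Suc D"] have *: "(\<Sum>p\<in>{D<..<Suc (D + (K - Suc D))}. 1 / (real p)\<^sup>2) \<le> 1 / real D - 1 / real (D + (K - Suc D))" .
  have "(\<Sum>p\<in>{D<..<K}. 1 / (real p)\<^sup>2) \<le> (\<Sum>p\<in>{D<..<Suc (D + (K - Suc D))}. 1 / (real p)\<^sup>2)"
    by (intro sum_mono2) auto
  moreover have "1 / real (D + (K - Suc D)) \<ge> 0" by simp
  ultimately show ?thesis using * by linarith
qed

text \<open>Such an n is p^2 m with p > D and m >= 1. The sum over m is at most 1 / (p^2 t), and the
  sum of 1 / p^2 over all integers p > D, prime or not, is at most 1 / D.\<close>

lemma exp_sum_square_multiples_le: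
  assumes D: "D \<ge> (1::nat)" and t: "t > 0"
  shows "(\<Sum>n | n < K \<and> n > 0 \<and> (\<exists>p>D. p\<^sup>2 dvd n). exp (- real n * t)) \<le> 1 / (real D * t)"
proof -
  let ?E = "{n. n < K \<and> n > 0 \<and> (\<exists>p>D. p\<^sup>2 dvd n)}"
  have "?E \<subseteq> (\<lambda>(p, m). p\<^sup>2 * m) ` ({D<..<K} \<times> {1..<K})"
  proof
    fix n assume "n \<in> ?E"
    then obtain p m where n: "n < K" "n > 0" "p > D" "n = p\<^sup>2 * m" by (auto elim: dvdE)
    have m: "m \<ge> 1" using n by (cases m) auto
    have p: "p \<ge> 1" using n(3) by simp
    have "p * 1 \<le> p * (p * m)" using m p by (intro mult_left_mono) auto
    then have "p \<le> n" using n(4) by (simp add: power2_eq_square mult.assoc)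
    have "1 * m \<le> p\<^sup>2 * m" using p by (intro mult_right_mono) auto
    then have "m \<le> n" using n(4) by simp
    then have "p < K" "m < K" using \<open>p \<le> n\<close> n(1) by linarith+
    then show "n \<in> (\<lambda>(p, m). p\<^sup>2 * m) ` ({D<..<K} \<times> {1..<K})"
      using n m by (intro image_eqI[of _ _ "(p, m)"]) auto
  qed
  then have "(\<Sum>n\<in>?E. exp (- real n * t)) \<le> (\<Sum>n\<in>(\<lambda>(p, m). p\<^sup>2 * m) ` ({D<..<K} \<times> {1..<K}). exp (- real n * t))"
    by (intro sum_mono2) auto
  also have "\<dots> \<le> (\<Sum>x\<in>{D<..<K} \<times> {1..<K}. exp (- real ((\<lambda>(p, m). p\<^sup>2 * m) x) * t))"
    using sum_image_le[of "{D<..<K} \<times> {1..<K}" "\<lambda>n. exp (- real n * t)" "\<lambda>(p, m). p\<^sup>2 * m"] by (simp add: o_def)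
  also have "\<dots> = (\<Sum>p\<in>{D<..<K}. \<Sum>m\<in>{1..<K}. exp (- real m * ((real p)\<^sup>2 * t)))"
    by (simp add: sum.cartesian_product case_prod_unfold mult_ac)
  also have "\<dots> \<le> (\<Sum>p\<in>{D<..<K}. 1 / ((real p)\<^sup>2 * t))"
    using t D by (intro sum_mono geometric_exp_sum_le) auto
  also have "\<dots> = (\<Sum>p\<in>{D<..<K}. 1 / (real p)\<^sup>2) / t" by (simp add: sum_divide_distrib)
  also have "\<dots> \<le> (1 / real D) / t" using t by (intro divide_right_mono sum_inverse_squares_tail_le D) auto
  finally show ?thesis by simp
qed

lemma summable_exp_indicator:
  assumes "t > 0"
  shows "summable (\<lambda>n. if n \<in> S then exp (- real n * t) else 0)"
proof (rule summable_comparison_test)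
  have "exp (- real n * t) = exp (- t) ^ n" for n unfolding exp_of_nat_mult[symmetric] by simp
  then show "\<exists>N. \<forall>n\<ge>N. norm (if n \<in> S then exp (- real n * t) else 0) \<le> exp (- t) ^ n" by auto
  show "summable (\<lambda>n. exp (- t) ^ n)" using assms by (intro summable_geometric) auto
qed

text \<open>An elementary Tauberian step with t = k / X: the terms n > X contribute at most 2 exp
  (-k) / t, less than half of the lower bound once \<open>k\<close> is large, while each term n <= X
  is at most 1, so that their sum is at most the count.\<close>

lemma counting_lower_bound:
  fixes S :: "nat set"
  assumes c: "c > 0" and t0: "t0 > 0"
    and low: "\<And>t. 0 < t \<Longrightarrow> t < t0 \<Longrightarrow> c / t \<le> (\<Sum>n. if n \<in> S then exp (- real n * t) else 0)"
  shows "\<exists>d>0. \<exists>X0. \<forall>X\<ge>X0. d * X \<le> real (card {n. real n \<le> X \<and> n \<in> S})"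
proof -
  have "((\<lambda>k::real. 2 * exp (- k)) \<longlongrightarrow> 0) at_top" by real_asymp
  then have "eventually (\<lambda>k::real. 2 * exp (- k) < c / 2) at_top" using c by (intro order_tendstoD) auto
  then have "eventually (\<lambda>k::real. 2 * exp (- k) < c / 2 \<and> k > 0) at_top"
    by (intro eventually_conj eventually_gt_at_top)
  then obtain k :: real where k: "2 * exp (- k) < c / 2" "k > 0"
    using eventually_happens by fastforce
  \<comment> \<open>The factors 2 give t <= t0 / 2 < t0 and t <= 1/2; the latter makes 1 - exp (-t)
    >= t / 2 available.\<close>
  define X0 where "X0 = max 1 (max (2 * k / t0) (2 * k))"
  have "c / (2 * k) * X \<le> real (card {n. real n \<le> X \<and> n \<in> S})" if X: "X \<ge> X0" for X
  proof -
    define t where "t = k / X"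
    have Xpos: "X > 0" "X \<ge> 1" using X by (auto simp: X0_def)
    have "2 * k / t0 \<le> X" "2 * k \<le> X" using X by (auto simp: X0_def)
    then have t: "0 < t" "t < t0" "t \<le> 1 / 2" using Xpos k t0 by (auto simp: t_def field_simps)
    let ?g = "\<lambda>n. if n \<in> S then exp (- real n * t) else 0"
    define N where "N = Suc (nat \<lfloor>X\<rfloor>)"
    have N: "real N > X" "\<And>n. n < N \<longleftrightarrow> real n \<le> X"
      using Xpos by (auto simp: N_def le_nat_iff le_floor_iff less_Suc_eq_le) linarith
    have sg: "summable ?g" using summable_exp_indicator[OF t(1)] .
    have split: "suminf ?g = (\<Sum>n. ?g (n + N)) + (\<Sum>n<N. ?g n)"
      by (rule suminf_split_initial_segment[OF sg])
    have "(\<Sum>n<N. ?g n) \<le> (\<Sum>n<N. if n \<in> S then 1 else 0)" using t by (intro sum_mono) auto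
    also have "\<dots> = real (card {n. real n \<le> X \<and> n \<in> S})"
    proof -
      have "{n. real n \<le> X \<and> n \<in> S} = {..<N} \<inter> S" using N(2) by auto
      then show ?thesis by (simp add: sum.If_cases)
    qed
    finally have head: "(\<Sum>n<N. ?g n) \<le> real (card {n. real n \<le> X \<and> n \<in> S})" .
    have "(\<Sum>n. ?g (n + N)) \<le> (\<Sum>n. exp (- real N * t) * exp (- t) ^ n)"
    proof (rule suminf_le)
      show "summable (\<lambda>n. ?g (n + N))" by (rule summable_ignore_initial_segment[OF sg])
      show "summable (\<lambda>n. exp (- real N * t) * exp (- t) ^ n)" using t by (intro summable_mult summable_geometric) auto
      have "exp (- real (n + N) * t) = exp (- real N * t) * exp (- t) ^ n" for n
        unfolding exp_of_nat_mult[symmetric] exp_add[symmetric] by (simp add: algebra_simps)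
      then show "?g (n + N) \<le> exp (- real N * t) * exp (- t) ^ n" for n by simp
    qed
    also have "\<dots> = exp (- real N * t) * (1 / (1 - exp (- t)))"
      using t by (subst suminf_mult) (auto simp: suminf_geometric summable_geometric)
    also have "\<dots> \<le> exp (- k) * (2 / t)"
    proof (intro mult_mono)
      have "k = X * t" using Xpos by (simp add: t_def)
      also have "\<dots> \<le> real N * t" using N(1) t by (intro mult_right_mono) auto
      finally show "exp (- real N * t) \<le> exp (- k)" by simp
      have "exp (- t) \<le> 1 / (1 + t)"
        using exp_ge_add_one_self[of t] t by (simp add: exp_minus field_simps)
      also have "1 / (1 + t) \<le> 1 - t / 2" using t by (simp add: field_simps)
      finally have "t / 2 \<le> 1 - exp (- t)" by simp
      then show "1 / (1 - exp (- t)) \<le> 2 / t" using t by (simp add: field_simps)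
      show "0 \<le> 1 / (1 - exp (- t))" using t by simp
    qed auto
    also have "exp (- k) * (2 / t) = (2 * exp (- k)) / t" by simp
    also have "\<dots> \<le> (c / 2) / t" using k(1) t by (intro divide_right_mono) auto
    finally have "(\<Sum>n. ?g (n + N)) \<le> (c / 2) / t" .
    then have "c / t - (c / 2) / t \<le> real (card {n. real n \<le> X \<and> n \<in> S})"
      using low[OF t(1,2)] split head by linarith
    moreover have "c / t - (c / 2) / t = c / (2 * k) * X" using Xpos k by (simp add: t_def field_simps)
    ultimately show ?thesis by simp
  qed
  moreover have "c / (2 * k) > 0" using c k by simp
  ultimately show ?thesis by blast
qed

section \<open>The second moment of the coefficients\<close>

locale modular_expansion = abs_modular_form +
  fixes a :: "nat \<Rightarrow> complex"
  assumes expansion: "\<And>\<tau>. Im \<tau> > 0 \<Longrightarrow>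
    (\<lambda>n. a n * exp (2 * of_real pi * \<i> * of_nat n * \<tau> / of_nat M)) sums f \<tau>"
begin

lemma norm_exp_term:
  "norm (exp (2 * of_real pi * \<i> * of_nat n * \<tau> / of_nat M)) = exp (- 2 * pi * real n * Im \<tau> / real M)"
proof -
  have "2 * of_real pi * \<i> * of_nat n * \<tau> / of_nat M = of_real (2 * pi * real n / real M) * (\<i> * \<tau>)" by simp
  then show ?thesis by simp
qed

text \<open>Convergence at half the height bounds the terms there; the other half of the height
  supplies a geometric factor.\<close>

lemma summable_norm_coeff:
  assumes "\<eta> > 0"
  shows "summable (\<lambda>n. norm (a n) * exp (- 2 * pi * real n * \<eta> / real M))"
proof -
  define \<tau> where "\<tau> = \<i> * of_real (\<eta> / 2)"
  have "(\<lambda>n. a n * exp (2 * of_real pi * \<i> * of_nat n * \<tau> / of_nat M)) \<longlonglongrightarrow> 0"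
    using expansion[of \<tau>] assms by (intro summable_LIMSEQ_zero sums_summable) (simp add: \<tau>_def)
  then have "Bseq (\<lambda>n. a n * exp (2 * of_real pi * \<i> * of_nat n * \<tau> / of_nat M))"
    by (rule convergent_imp_Bseq[OF convergentI])
  then obtain B where B: "\<And>n. norm (a n) * exp (- 2 * pi * real n * (\<eta> / 2) / real M) \<le> B"
    unfolding Bseq_def norm_mult norm_exp_term by (auto simp: \<tau>_def)
  define r where "r = exp (- pi * \<eta> / real M)"
  have r: "0 < r" "r < 1" using assms M by (auto simp: r_def divide_neg_pos)
  have rn: "r ^ n = exp (- 2 * pi * real n * (\<eta> / 2) / real M)" for n
    unfolding r_def exp_of_nat_mult[symmetric] by (simp add: mult_ac)
  have rn2: "exp (- 2 * pi * real n * \<eta> / real M) = r ^ n * r ^ n" for n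
    unfolding rn exp_add[symmetric] by (simp add: field_simps)
  show ?thesis
  proof (rule summable_comparison_test)
    show "summable (\<lambda>n. B * r ^ n)" using r by (intro summable_mult summable_geometric) auto
    have "norm (norm (a n) * exp (- 2 * pi * real n * \<eta> / real M)) \<le> B * r ^ n" for n
    proof -
      have "norm (norm (a n) * exp (- 2 * pi * real n * \<eta> / real M)) = (norm (a n) * r ^ n) * r ^ n"
        unfolding rn2 using r by (simp add: abs_mult mult.assoc)
      also have "\<dots> \<le> B * r ^ n" using B[of n] r by (intro mult_right_mono) (simp_all add: rn)
      finally show ?thesis .
    qed
    then show "\<exists>N. \<forall>n\<ge>N. norm (norm (a n) * exp (- 2 * pi * real n * \<eta> / real M)) \<le> B * r ^ n" by blast
  qed
qed

lemma parseval_partial: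
  fixes b :: "nat \<Rightarrow> complex"
  shows "((\<lambda>x. complex_of_real ((norm (\<Sum>n<N. b n * exp (2 * of_real pi * \<i> * of_nat n * of_real x / of_nat M)))\<^sup>2))
      has_integral of_real (real M * (\<Sum>n<N. (norm (b n))\<^sup>2))) {0..real M}"
proof -
  let ?e = "\<lambda>n x. exp (2 * of_real pi * \<i> * of_nat n * of_real x / of_nat M)"
  have "((\<lambda>x. \<Sum>n<N. \<Sum>m<N. b n * cnj (b m) * exp (2 * of_real pi * \<i> * of_int (int n - int m) * of_real x / of_nat M))
      has_integral (\<Sum>n<N. \<Sum>m<N. b n * cnj (b m) * (if int n - int m = 0 then of_nat M else 0))) {0..real M}"
    using M by (intro has_integral_sum has_integral_mult_right has_integral_exp_period) auto
  moreover have "(\<Sum>n<N. \<Sum>m<N. b n * cnj (b m) * (if int n - int m = 0 then of_nat M else 0))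
      = of_real (real M * (\<Sum>n<N. (norm (b n))\<^sup>2))"
  proof -
    have "(\<Sum>m<N. b n * cnj (b m) * (if int n - int m = 0 then of_nat M else 0)) = of_real (real M * (norm (b n))\<^sup>2)" if "n < N" for n
    proof -
      have "(\<Sum>m<N. b n * cnj (b m) * (if int n - int m = 0 then of_nat M else 0))
          = (\<Sum>m<N. if n = m then b n * cnj (b m) * of_nat M else 0)"
        by (intro sum.cong) auto
      also have "\<dots> = b n * cnj (b n) * of_nat M" using that by simp
      finally show ?thesis
        by (simp only: of_real_mult complex_norm_square of_real_of_nat_eq mult.commute)
    qed
    then show ?thesis by (simp add: sum_distrib_left)
  qed
  moreover have "(\<Sum>n<N. \<Sum>m<N. b n * cnj (b m) * exp (2 * of_real pi * \<i> * of_int (int n - int m) * of_real x / of_nat M))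
      = complex_of_real ((norm (\<Sum>n<N. b n * ?e n x))\<^sup>2)" for x :: real
  proof -
    have "exp (2 * of_real pi * \<i> * of_int (int n - int m) * of_real x / of_nat M) = ?e n x * cnj (?e m x)" for n m
      by (simp add: exp_cnj exp_add[symmetric] diff_divide_distrib algebra_simps)
    then have "(\<Sum>n<N. \<Sum>m<N. b n * cnj (b m) * exp (2 * of_real pi * \<i> * of_int (int n - int m) * of_real x / of_nat M))
        = (\<Sum>n<N. \<Sum>m<N. (b n * ?e n x) * cnj (b m * ?e m x))" by (simp add: mult_ac)
    also have "\<dots> = (\<Sum>n<N. b n * ?e n x) * cnj (\<Sum>m<N. b m * ?e m x)" by (simp add: sum_product)
    finally show ?thesis by (simp only: complex_norm_square)
  qed
  ultimately show ?thesis by simp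
qed

text \<open>The trigonometric partial sums satisfy Parseval and converge uniformly over a period, so
  their mean squares tend, increasingly, to that of \<open>f\<close>.\<close>

lemma bessel_inequality:
  assumes \<eta>: "\<eta> > 0"
  shows "real M * (\<Sum>n<K. (norm (a n))\<^sup>2 * exp (- 4 * pi * real n * \<eta> / real M))
           \<le> integral {0..real M} (\<lambda>x. (norm (f (Complex x \<eta>)))\<^sup>2)"
proof -
  define b where "b = (\<lambda>n. a n * exp (- 2 * pi * real n * \<eta> / real M))"
  define s where "s = (\<lambda>N x. \<Sum>n<N. b n * exp (2 * of_real pi * \<i> * of_nat n * of_real x / of_nat M))"
  have norm_b: "(norm (b n))\<^sup>2 = (norm (a n))\<^sup>2 * exp (- 4 * pi * real n * \<eta> / real M)" for n
    by (simp add: b_def norm_mult power_mult_distrib power2_eq_square exp_add[symmetric])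
  have term_eq: "a n * exp (2 * of_real pi * \<i> * of_nat n * Complex x \<eta> / of_nat M)
      = b n * exp (2 * of_real pi * \<i> * of_nat n * of_real x / of_nat M)" for n x
  proof -
    have "2 * of_real pi * \<i> * of_nat n * Complex x \<eta> / of_nat M
        = of_real (- 2 * pi * real n * \<eta> / real M) + 2 * of_real pi * \<i> * of_nat n * of_real x / of_nat M"
      by (simp add: complex_eq_iff)
    then have "exp (2 * of_real pi * \<i> * of_nat n * Complex x \<eta> / of_nat M)
        = of_real (exp (- 2 * pi * real n * \<eta> / real M)) * exp (2 * of_real pi * \<i> * of_nat n * of_real x / of_nat M)"
      by (simp only: exp_add exp_of_real)
    then show ?thesis by (simp add: b_def)
  qed
  have unif: "uniform_limit {0..real M} s (\<lambda>x. f (Complex x \<eta>)) sequentially"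
  proof -
    have "uniform_limit {0..real M} s (\<lambda>x. \<Sum>n. b n * exp (2 * of_real pi * \<i> * of_nat n * of_real x / of_nat M)) sequentially"
      unfolding s_def
    proof (rule Weierstrass_m_test)
      show "summable (\<lambda>n. norm (a n) * exp (- 2 * pi * real n * \<eta> / real M))" using summable_norm_coeff[OF \<eta>] .
      fix n and x :: real
      have "norm (b n * exp (2 * of_real pi * \<i> * of_nat n * of_real x / of_nat M)) = norm (b n)"
        unfolding norm_mult using norm_exp_term[of n "of_real x"] by simp
      then show "norm (b n * exp (2 * of_real pi * \<i> * of_nat n * of_real x / of_nat M)) \<le> norm (a n) * exp (- 2 * pi * real n * \<eta> / real M)"
        by (simp add: b_def norm_mult)
    qed
    moreover have "(\<Sum>n. b n * exp (2 * of_real pi * \<i> * of_nat n * of_real x / of_nat M)) = f (Complex x \<eta>)" for x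
      using expansion[of "Complex x \<eta>"] \<eta> unfolding term_eq by (simp add: sums_iff)
    ultimately show ?thesis by simp
  qed
  have cont: "continuous_on {0..real M} (s N)" for N unfolding s_def using M by (intro continuous_intros) auto
  have contf: "continuous_on {0..real M} (\<lambda>x. f (Complex x \<eta>))"
    by (rule uniform_limit_theorem[OF _ unif]) (use cont in auto)
  have bf: "bounded ((\<lambda>x. f (Complex x \<eta>)) ` {0..real M})"
    by (intro compact_imp_bounded compact_continuous_image contf compact_Icc)
  have "uniform_limit {0..real M} (\<lambda>N x. s N x * cnj (s N x)) (\<lambda>x. f (Complex x \<eta>) * cnj (f (Complex x \<eta>))) sequentially"
  proof (rule uniform_lim_mult[OF unif _ bf])
    show "uniform_limit {0..real M} (\<lambda>N x. cnj (s N x)) (\<lambda>x. cnj (f (Complex x \<eta>))) sequentially"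
      using unif unfolding uniform_limit_iff by (simp add: dist_norm flip: complex_cnj_diff)
    show "bounded ((\<lambda>x. cnj (f (Complex x \<eta>))) ` {0..real M})"
      using bf unfolding bounded_iff by simp
  qed
  then have unif2: "uniform_limit {0..real M} (\<lambda>N x. of_real ((norm (s N x))\<^sup>2)) (\<lambda>x. complex_of_real ((norm (f (Complex x \<eta>)))\<^sup>2)) sequentially"
    by (simp only: complex_norm_square)
  have "continuous_on {0..real M} (\<lambda>x. complex_of_real ((norm (s N x))\<^sup>2))" for N
    by (intro continuous_intros cont)
  then obtain I J where IJ: "\<And>N. ((\<lambda>x. complex_of_real ((norm (s N x))\<^sup>2)) has_integral I N) {0..real M}"
    "((\<lambda>x. complex_of_real ((norm (f (Complex x \<eta>)))\<^sup>2)) has_integral J) {0..real M}" "I \<longlonglongrightarrow> J"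
    using uniform_limit_integral[OF unif2 _ sequentially_bot] by blast
  have I: "I N = of_real (real M * (\<Sum>n<N. (norm (b n))\<^sup>2))" for N
    using has_integral_unique[OF IJ(1)[unfolded s_def] parseval_partial] .
  have J: "J = of_real (integral {0..real M} (\<lambda>x. (norm (f (Complex x \<eta>)))\<^sup>2))"
  proof -
    have "((\<lambda>x. (norm (f (Complex x \<eta>)))\<^sup>2) has_integral (integral {0..real M} (\<lambda>x. (norm (f (Complex x \<eta>)))\<^sup>2))) {0..real M}"
      by (intro integrable_integral integrable_continuous_interval continuous_intros contf)
    from has_integral_of_real[OF this] have "((\<lambda>x. complex_of_real ((norm (f (Complex x \<eta>)))\<^sup>2)) has_integral
        of_real (integral {0..real M} (\<lambda>x. (norm (f (Complex x \<eta>)))\<^sup>2))) {0..real M}" .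
    then show ?thesis using IJ(2) has_integral_unique by blast
  qed
  have "(\<lambda>N. Re (I N)) \<longlonglongrightarrow> Re J" using IJ(3) by (rule tendsto_Re)
  then have lim: "(\<lambda>N. real M * (\<Sum>n<N. (norm (b n))\<^sup>2)) \<longlonglongrightarrow> integral {0..real M} (\<lambda>x. (norm (f (Complex x \<eta>)))\<^sup>2)"
    by (simp only: I J Re_complex_of_real)
  have "real M * (\<Sum>n<K. (norm (b n))\<^sup>2) \<le> integral {0..real M} (\<lambda>x. (norm (f (Complex x \<eta>)))\<^sup>2)"
  proof (rule tendsto_lowerbound[OF lim])
    show "\<forall>\<^sub>F N in sequentially. real M * (\<Sum>n<K. (norm (b n))\<^sup>2) \<le> real M * (\<Sum>n<N. (norm (b n))\<^sup>2)"
      unfolding eventually_sequentially by (intro exI[of _ K] allI impI mult_left_mono sum_mono2) auto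
  qed simp
  then show ?thesis by (simp only: norm_b)
qed

text \<open>\<open>\<tau>\<close> is pulled back by the inverse matrix, whose cocycle has modulus |r
  tau - p|, the reciprocal of the modulus of the original cocycle at \<open>z\<close>. This
  separates the growth of \<open>f\<close> near p / r from a factor that is bounded as long as Im z
  stays away from 0.\<close>

lemma norm_f_via_cusp:
  assumes \<gamma>: "(p, q, r, s) \<in> SL2Z" and \<tau>: "Im \<tau> > 0"
  defines "z \<equiv> moebius (mat_inv (p, q, r, s)) \<tau>"
  shows "norm (f \<tau>) = norm (of_int r * \<tau> - of_int p) powr (- \<kappa>) * nslash (p, q, r, s) z"
    and "Im z = Im \<tau> / (norm (of_int r * \<tau> - of_int p))\<^sup>2" and "Im z > 0"
    and "norm (of_int r * \<tau> - of_int p) > 0" and "moebius (p, q, r, s) z = \<tau>"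
proof -
  let ?\<gamma> = "(p, q, r, s)"
  have inv: "mat_inv ?\<gamma> \<in> SL2Z" using \<gamma> by (rule mat_inv_SL2Z)
  have coc: "norm (cocycle (mat_inv ?\<gamma>) \<tau>) = norm (of_int r * \<tau> - of_int p)"
    by (simp add: norm_minus_commute)
  show pos: "norm (of_int r * \<tau> - of_int p) > 0"
    using cocycle_nonzero[OF inv \<tau>] unfolding coc[symmetric] by simp
  show "Im z = Im \<tau> / (norm (of_int r * \<tau> - of_int p))\<^sup>2"
    unfolding z_def Im_moebius[OF inv \<tau>] coc ..
  show z: "Im z > 0" unfolding z_def by (rule moebius_upper_half_plane[OF inv \<tau>])
  show gz: "moebius ?\<gamma> z = \<tau>" unfolding z_def by (rule moebius_inv(1)[OF \<gamma> \<tau>])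
  have "cocycle ?\<gamma> z * cocycle (mat_inv ?\<gamma>) \<tau> = 1"
    using mat_mult_moebius_cocycle(2)[OF \<gamma> inv \<tau>] unfolding z_def mat_mult_inv(1)[OF \<gamma>] by simp
  then have "norm (cocycle ?\<gamma> z) * norm (of_int r * \<tau> - of_int p) = 1"
    unfolding coc[symmetric] norm_mult[symmetric] by simp
  then have n1: "norm (cocycle ?\<gamma> z) = 1 / norm (of_int r * \<tau> - of_int p)" using pos by (simp add: field_simps)
  have "nslash ?\<gamma> z = (1 / norm (of_int r * \<tau> - of_int p)) powr (- \<kappa>) * norm (f \<tau>)"
    unfolding nslash_eq[OF \<gamma> z] n1 gz ..
  also have "(1 / norm (of_int r * \<tau> - of_int p)) powr (- \<kappa>) = norm (of_int r * \<tau> - of_int p) powr \<kappa>"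
    using pos by (simp add: powr_minus powr_divide)
  finally have "nslash ?\<gamma> z = norm (of_int r * \<tau> - of_int p) powr \<kappa> * norm (f \<tau>)" .
  then show "norm (f \<tau>) = norm (of_int r * \<tau> - of_int p) powr (- \<kappa>) * nslash ?\<gamma> z"
    using pos by (simp add: powr_minus field_simps)
qed

section \<open>The mean square of \<open>f\<close> along a horizontal line\<close>

lemma SL2Z_complete:
  assumes "coprime p r"
  obtains q s where "(p, q, r, s) \<in> SL2Z"
proof -
  obtain u v where "u * p + v * r = gcd p r" using bezout_int by blast
  then have "p * u - (- v) * r = 1" using assms by (simp add: algebra_simps)
  then show ?thesis using that[of "- v" u] by (simp add: SL2Z_iff)
qed

text \<open>Dirichlet approximation finds, for each \<open>x\<close>, a cusp h / k seen from which
  the point has height at least 1/5, where \<open>nslash\<close> is bounded. Summing over all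
  fractions that can occur removes the dependence of h / k on \<open>x\<close>, so that the bound
  can be integrated term by term.\<close>

lemma norm_f_sq_le_sum:
  "\<exists>B\<ge>0. \<forall>x \<eta>. 0 \<le> x \<longrightarrow> x \<le> real M \<longrightarrow> 0 < \<eta> \<longrightarrow> \<eta> \<le> 1 \<longrightarrow>
     (norm (f (Complex x \<eta>)))\<^sup>2 \<le> B * (\<Sum>c\<in>{1..nat \<lceil>1 / sqrt \<eta>\<rceil>}. \<Sum>p\<in>{0..c * M}.
        ((real c * x - real p)\<^sup>2 + (real c)\<^sup>2 * \<eta>\<^sup>2) powr (- \<kappa>))"
proof -
  obtain B where B: "\<And>\<gamma> z. \<gamma> \<in> SL2Z \<Longrightarrow> Im z \<ge> 1 / 5 \<Longrightarrow> nslash \<gamma> z \<le> B"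
    using nslash_bounded[of "1 / 5"] by auto
  have "(norm (f (Complex x \<eta>)))\<^sup>2 \<le> B\<^sup>2 * (\<Sum>c\<in>{1..nat \<lceil>1 / sqrt \<eta>\<rceil>}. \<Sum>p\<in>{0..c * M}.
        ((real c * x - real p)\<^sup>2 + (real c)\<^sup>2 * \<eta>\<^sup>2) powr (- \<kappa>))"
    if x: "0 \<le> x" "x \<le> real M" and \<eta>: "0 < \<eta>" "\<eta> \<le> 1" for x \<eta>
  proof -
    \<comment> \<open>Denominators up to about eta^(-1/2) balance the two parts of |k tau - h|^2,
      namely (k x - h)^2 <= eta and k^2 eta^2 <= 4 eta; this is the origin of 1/5.\<close>
    define N where "N = nat \<lceil>1 / sqrt \<eta>\<rceil>"
    have sq: "0 < sqrt \<eta>" "sqrt \<eta> \<le> 1" using \<eta> by auto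
    have N1: "1 / sqrt \<eta> \<le> real N" unfolding N_def using sq by (simp add: real_nat_ceiling_ge)
    have "1 \<le> 1 / sqrt \<eta>" using sq by simp
    then have N2: "real N \<le> 2 / sqrt \<eta>" unfolding N_def using sq by linarith
    have Npos: "N > 0" using N1 sq by (metis divide_le_0_1_iff gr_zeroI not_le of_nat_0)
    obtain h k where hk: "coprime h k" "0 < k" "k \<le> int N" "\<bar>of_int k * x - of_int h\<bar> < 1 / real N"
      using Dirichlet_approx_coprime[OF Npos] by blast
    have invN: "1 / real N \<le> 1" "1 / real N \<le> sqrt \<eta>" using Npos N1 sq by (auto simp: field_simps)
    define p where "p = nat h"
    define c where "c = nat k"
    have c: "real_of_int k = real c" "c \<in> {1..N}" using hk by (auto simp: c_def)
    have "0 \<le> real c * x" using x by simp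
    then have "real_of_int h > -1" using hk(4) invN(1) unfolding c(1) by linarith
    then have h0: "h \<ge> 0" by linarith
    have "real_of_int h < real c * x + 1" using hk(4) invN(1) unfolding c(1) by linarith
    also have "\<dots> \<le> real c * real M + 1" using x by (intro add_mono mult_left_mono) auto
    finally have "real_of_int h < real_of_int (int (c * M) + 1)" by simp
    then have "h < int (c * M) + 1" by (simp only: of_int_less_iff)
    then have "nat h \<le> c * M" by linarith
    then have p: "real_of_int h = real p" "p \<in> {0..c * M}" using h0 by (simp_all add: p_def)
    let ?\<tau> = "Complex x \<eta>"
    obtain q s where \<gamma>: "(h, q, k, s) \<in> SL2Z" using SL2Z_complete[OF hk(1)] by blast
    define z where "z = moebius (mat_inv (h, q, k, s)) ?\<tau>"
    have \<tau>: "Im ?\<tau> > 0" using \<eta> by simp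
    note via = norm_f_via_cusp[OF \<gamma> \<tau>, folded z_def]
    have nsq: "(norm (of_int k * ?\<tau> - of_int h))\<^sup>2 = (real c * x - real p)\<^sup>2 + (real c)\<^sup>2 * \<eta>\<^sup>2"
      by (simp add: cmod_def c(1) p(1) power_mult_distrib)
    have "(real c * x - real p)\<^sup>2 \<le> (sqrt \<eta>)\<^sup>2"
      using hk(4) invN \<eta> unfolding c(1) p(1) by (intro power2_le_iff_abs_le[THEN iffD2]) auto
    moreover have "(real c)\<^sup>2 * \<eta>\<^sup>2 \<le> (2 / sqrt \<eta>)\<^sup>2 * \<eta>\<^sup>2"
      using c(2) N2 by (intro mult_right_mono power_mono) auto
    moreover have "(2 / sqrt \<eta>)\<^sup>2 * \<eta>\<^sup>2 = 4 * \<eta>" using \<eta> by (simp add: power_divide power2_eq_square)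
    moreover have "(sqrt \<eta>)\<^sup>2 = \<eta>" using \<eta> by simp
    ultimately have "(norm (of_int k * ?\<tau> - of_int h))\<^sup>2 \<le> 5 * \<eta>" unfolding nsq by linarith
    then have "Im z \<ge> 1 / 5" unfolding via(2) using via(4) by (simp add: field_simps)
    then have "nslash (h, q, k, s) z \<le> B" using B \<gamma> by blast
    then have "(nslash (h, q, k, s) z)\<^sup>2 \<le> B\<^sup>2" by (intro power_mono nslash_nonneg)
    then have "(norm (f ?\<tau>))\<^sup>2 \<le> B\<^sup>2 * (norm (of_int k * ?\<tau> - of_int h) powr (- \<kappa>))\<^sup>2"
      unfolding via(1) power_mult_distrib by (simp add: mult.commute mult_right_mono)
    also have "(norm (of_int k * ?\<tau> - of_int h) powr (- \<kappa>))\<^sup>2 = ((norm (of_int k * ?\<tau> - of_int h))\<^sup>2) powr (- \<kappa>)"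
      using via(4) by (simp add: power2_eq_square powr_mult)
    also have "B\<^sup>2 * \<dots> \<le> B\<^sup>2 * (\<Sum>c\<in>{1..N}. \<Sum>p\<in>{0..c * M}. ((real c * x - real p)\<^sup>2 + (real c)\<^sup>2 * \<eta>\<^sup>2) powr (- \<kappa>))"
    proof (rule mult_left_mono)
      have "((real c * x - real p)\<^sup>2 + (real c)\<^sup>2 * \<eta>\<^sup>2) powr (- \<kappa>)
          \<le> (\<Sum>p\<in>{0..c * M}. ((real c * x - real p)\<^sup>2 + (real c)\<^sup>2 * \<eta>\<^sup>2) powr (- \<kappa>))"
        using p(2) by (intro member_le_sum) auto
      also have "\<dots> \<le> (\<Sum>c\<in>{1..N}. \<Sum>p\<in>{0..c * M}. ((real c * x - real p)\<^sup>2 + (real c)\<^sup>2 * \<eta>\<^sup>2) powr (- \<kappa>))"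
        using c(2) by (intro member_le_sum[of c _ "\<lambda>c. \<Sum>p\<in>{0..c * M}. ((real c * x - real p)\<^sup>2 + (real c)\<^sup>2 * \<eta>\<^sup>2) powr (- \<kappa>)"] sum_nonneg) auto
      finally show "((norm (of_int k * ?\<tau> - of_int h))\<^sup>2) powr (- \<kappa>)
          \<le> (\<Sum>c\<in>{1..N}. \<Sum>p\<in>{0..c * M}. ((real c * x - real p)\<^sup>2 + (real c)\<^sup>2 * \<eta>\<^sup>2) powr (- \<kappa>))"
        unfolding nsq .
    qed simp
    finally show ?thesis unfolding N_def .
  qed
  then show ?thesis by (intro exI[of _ "B\<^sup>2"]) auto
qed

text \<open>With w = (x - r)^2 + eta^2, the factor w^(1 - kappa) is at most eta^(2 - 2 kappa) and
  the remaining 1 / w integrates to at most pi / eta. The factor c^(-4), from kappa >= 2, later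
  outweighs the c M + 1 numerators.\<close>

lemma integral_cusp_term_le:
  fixes c :: nat
  assumes c: "c \<ge> 1" and \<eta>: "\<eta> > 0"
  shows "(\<lambda>x. ((real c * x - u)\<^sup>2 + (real c)\<^sup>2 * \<eta>\<^sup>2) powr (- \<kappa>)) integrable_on {0..real M}"
    and "integral {0..real M} (\<lambda>x. ((real c * x - u)\<^sup>2 + (real c)\<^sup>2 * \<eta>\<^sup>2) powr (- \<kappa>))
           \<le> pi * \<eta> powr (1 - 2 * \<kappa>) / (real c) ^ 4"
proof -
  let ?g = "\<lambda>x. ((real c * x - u)\<^sup>2 + (real c)\<^sup>2 * \<eta>\<^sup>2) powr (- \<kappa>)"
  have cpos: "real c > 0" using c by simp
  have pos: "(real c * x - u)\<^sup>2 + (real c)\<^sup>2 * \<eta>\<^sup>2 > 0" for x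
    using cpos \<eta> by (intro add_nonneg_pos) auto
  show int: "?g integrable_on {0..real M}"
    using pos by (intro integrable_continuous_interval continuous_intros) (auto simp: less_imp_neq[symmetric])
  define r where "r = u / real c"
  define C where "C = \<eta> powr (2 - 2 * \<kappa>) / (real c) ^ 4"
  have le: "?g x \<le> C * (1 / ((x - r)\<^sup>2 + \<eta>\<^sup>2))" for x
  proof -
    define w where "w = (x - r)\<^sup>2 + \<eta>\<^sup>2"
    have w: "w > 0" "w \<ge> \<eta>\<^sup>2" using \<eta> by (auto simp: w_def intro: add_nonneg_pos)
    have "(real c * x - u)\<^sup>2 + (real c)\<^sup>2 * \<eta>\<^sup>2 = (real c)\<^sup>2 * w"
      using cpos by (simp add: w_def r_def power2_eq_square field_simps)
    then have g: "?g x = ((real c)\<^sup>2) powr (- \<kappa>) * w powr (- \<kappa>)" using w cpos by (simp add: powr_mult)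
    have "((real c)\<^sup>2) powr (- \<kappa>) \<le> ((real c)\<^sup>2) powr (- 2)"
      using c kappa by (intro powr_mono) auto
    also have "((real c)\<^sup>2) powr (- 2) = 1 / (real c) ^ 4"
      using cpos by (simp add: powr_minus powr_numeral field_simps flip: power_mult)
    finally have e1: "((real c)\<^sup>2) powr (- \<kappa>) \<le> 1 / (real c) ^ 4" .
    have "w powr (1 - \<kappa>) \<le> (\<eta>\<^sup>2) powr (1 - \<kappa>)" using w \<eta> kappa by (intro powr_mono2') auto
    also have "(\<eta>\<^sup>2) powr (1 - \<kappa>) = \<eta> powr (2 - 2 * \<kappa>)"
      using \<eta> by (simp add: power2_eq_square powr_mult flip: powr_add)
    finally have "w powr (1 - \<kappa>) * (1 / w) \<le> \<eta> powr (2 - 2 * \<kappa>) * (1 / w)" using w by (intro mult_right_mono) auto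
    moreover have "w powr (- \<kappa>) = w powr (1 - \<kappa>) * (1 / w)" using w by (simp add: powr_diff powr_minus field_simps)
    ultimately have e2: "w powr (- \<kappa>) \<le> \<eta> powr (2 - 2 * \<kappa>) * (1 / w)" by simp
    have "?g x \<le> 1 / (real c) ^ 4 * (\<eta> powr (2 - 2 * \<kappa>) * (1 / w))" unfolding g using e1 e2 by (intro mult_mono) auto
    then show ?thesis by (simp add: C_def w_def)
  qed
  have int2: "((\<lambda>x. 1 / ((x - r)\<^sup>2 + \<eta>\<^sup>2)) has_integral (arctan ((real M - r) / \<eta>) / \<eta> - arctan ((0 - r) / \<eta>) / \<eta>)) {0..real M}"
  proof (rule fundamental_theorem_of_calculus)
    fix x :: real
    have "((\<lambda>x. arctan ((x - r) / \<eta>) / \<eta>) has_real_derivative (1 / ((x - r)\<^sup>2 + \<eta>\<^sup>2))) (at x within {0..real M})"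
    proof -
      have "((\<lambda>x. arctan ((x - r) / \<eta>) / \<eta>) has_real_derivative (inverse (1 + ((x - r) / \<eta>)\<^sup>2) * (1 / \<eta>) / \<eta>)) (at x within {0..real M})"
        using \<eta> by (auto intro!: derivative_eq_intros)
      moreover have "inverse (1 + ((x - r) / \<eta>)\<^sup>2) * (1 / \<eta>) / \<eta> = 1 / ((x - r)\<^sup>2 + \<eta>\<^sup>2)"
      proof -
        have "(1 + ((x - r) / \<eta>)\<^sup>2) * \<eta> * \<eta> = (x - r)\<^sup>2 + \<eta>\<^sup>2"
          using \<eta> by (simp add: power_divide power2_eq_square field_simps)
        then show ?thesis by (metis divide_inverse divide_divide_eq_left inverse_eq_divide mult.assoc mult_1)
      qed
      ultimately show ?thesis by simp
    qed
    then show "((\<lambda>x. arctan ((x - r) / \<eta>) / \<eta>) has_vector_derivative (1 / ((x - r)\<^sup>2 + \<eta>\<^sup>2))) (at x within {0..real M})"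
      by (simp add: has_real_derivative_iff_has_vector_derivative)
  qed simp
  have "integral {0..real M} ?g \<le> C * (arctan ((real M - r) / \<eta>) / \<eta> - arctan ((0 - r) / \<eta>) / \<eta>)"
    using le by (intro has_integral_le[OF integrable_integral[OF int] has_integral_mult_right[OF int2]]) auto
  also have "\<dots> \<le> C * (pi / \<eta>)"
  proof (rule mult_left_mono)
    have "arctan ((real M - r) / \<eta>) - arctan ((0 - r) / \<eta>) \<le> pi"
      using arctan_ubound[of "(real M - r) / \<eta>"] arctan_lbound[of "(0 - r) / \<eta>"] by linarith
    then show "arctan ((real M - r) / \<eta>) / \<eta> - arctan ((0 - r) / \<eta>) / \<eta> \<le> pi / \<eta>"
      using \<eta> by (simp add: divide_right_mono flip: diff_divide_distrib)
  qed (simp add: C_def)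
  also have "C * (pi / \<eta>) = pi * \<eta> powr (1 - 2 * \<kappa>) / (real c) ^ 4"
  proof -
    have "\<eta> powr (2 - 2 * \<kappa>) / \<eta> = \<eta> powr (1 - 2 * \<kappa>)"
      using \<eta> powr_diff[of \<eta> "2 - 2 * \<kappa>" 1] by simp
    moreover have "C * (pi / \<eta>) = pi * (\<eta> powr (2 - 2 * \<kappa>) / \<eta>) / (real c) ^ 4" by (simp add: C_def mult_ac)
    ultimately show ?thesis by (simp only:)
  qed
  finally show "integral {0..real M} ?g \<le> pi * \<eta> powr (1 - 2 * \<kappa>) / (real c) ^ 4" .
qed

lemma sum_inverse_squares_le_two: "(\<Sum>c\<in>{1..N}. 1 / (real c)\<^sup>2) \<le> 2"
proof -
  have "(\<Sum>c\<in>{1..Suc N}. 1 / (real c)\<^sup>2) \<le> 2 - 1 / (real N + 1)" for N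
  proof (induction N)
    case (Suc N)
    have "1 / (real N + 2)\<^sup>2 \<le> 1 / ((real N + 1) * (real N + 2))"
      by (intro divide_left_mono mult_pos_pos) (auto simp: power2_eq_square)
    also have "\<dots> = 1 / (real N + 1) - 1 / (real N + 2)"
    proof -
      have "1 / (A * (A + 1)) = 1 / A - 1 / (A + 1)" if "A \<noteq> 0" "A + 1 \<noteq> 0" for A :: real
        using that by (simp add: field_simps)
      from this[of "real N + 1"] show ?thesis by (simp add: add.assoc)
    qed
    finally have "1 / (real (Suc (Suc N)))\<^sup>2 \<le> 1 / (real N + 1) - 1 / (real (Suc N) + 1)"
      by (simp add: add.commute)
    moreover have "(\<Sum>c\<in>{1..Suc (Suc N)}. 1 / (real c)\<^sup>2) = (\<Sum>c\<in>{1..Suc N}. 1 / (real c)\<^sup>2) + 1 / (real (Suc (Suc N)))\<^sup>2"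
      by simp
    ultimately show ?case using Suc.IH by linarith
  qed simp
  note bound = this
  show ?thesis
  proof (cases N)
    case (Suc m)
    have "0 \<le> 1 / (real m + 1)" by simp
    then show ?thesis using bound[of m] unfolding Suc by linarith
  qed simp
qed

text \<open>The exponent is what Cauchy-Schwarz requires: the sieved form will be at least of order
  eta^(-kappa), and eta^(-2 kappa) / eta^(1 - 2 kappa) = 1 / eta is the order of the number of
  relevant n.\<close>

lemma second_moment:
  "\<exists>C>0. \<forall>\<eta> K. 0 < \<eta> \<longrightarrow> \<eta> \<le> 1 \<longrightarrow>
     (\<Sum>n<K. (norm (a n))\<^sup>2 * exp (- 4 * pi * real n * \<eta> / real M)) \<le> C * \<eta> powr (1 - 2 * \<kappa>)"
proof -
  obtain B where B: "B \<ge> 0" "\<And>x \<eta>. 0 \<le> x \<Longrightarrow> x \<le> real M \<Longrightarrow> 0 < \<eta> \<Longrightarrow> \<eta> \<le> 1 \<Longrightarrow>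
     (norm (f (Complex x \<eta>)))\<^sup>2 \<le> B * (\<Sum>c\<in>{1..nat \<lceil>1 / sqrt \<eta>\<rceil>}. \<Sum>p\<in>{0..c * M}.
        ((real c * x - real p)\<^sup>2 + (real c)\<^sup>2 * \<eta>\<^sup>2) powr (- \<kappa>))"
    using norm_f_sq_le_sum by auto
  \<comment> \<open>The added 1 keeps \<open>C\<close> positive when B = 0.\<close>
  define C where "C = B * (4 * real M * pi) / real M + 1"
  have Mpos: "real M > 0" using M by simp
  have "(\<Sum>n<K. (norm (a n))\<^sup>2 * exp (- 4 * pi * real n * \<eta> / real M)) \<le> C * \<eta> powr (1 - 2 * \<kappa>)"
    if \<eta>: "0 < \<eta>" "\<eta> \<le> 1" for \<eta> K
  proof -
    define N where "N = nat \<lceil>1 / sqrt \<eta>\<rceil>"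
    let ?g = "\<lambda>c p x. ((real c * x - real p)\<^sup>2 + (real c)\<^sup>2 * \<eta>\<^sup>2) powr (- \<kappa>)"
    define P where "P = pi * \<eta> powr (1 - 2 * \<kappa>)"
    have Ppos: "P \<ge> 0" by (simp add: P_def)
    have int: "((\<lambda>x. B * (\<Sum>c\<in>{1..N}. \<Sum>p\<in>{0..c * M}. ?g c p x)) has_integral
        B * (\<Sum>c\<in>{1..N}. \<Sum>p\<in>{0..c * M}. integral {0..real M} (?g c p))) {0..real M}"
      using \<eta> by (intro has_integral_mult_right has_integral_sum integrable_integral integral_cusp_term_le) auto
    have contf: "continuous_on {0..real M} (\<lambda>x. (norm (f (Complex x \<eta>)))\<^sup>2)"
    proof -
      have "continuous_on {0..real M} (\<lambda>x. f (of_real x + \<i> * of_real \<eta>))"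
        using \<eta> by (intro continuous_on_compose2[OF holomorphic_on_imp_continuous_on[OF hol]] continuous_intros) auto
      then show ?thesis unfolding Complex_eq by (intro continuous_intros)
    qed
    have "real M * (\<Sum>n<K. (norm (a n))\<^sup>2 * exp (- 4 * pi * real n * \<eta> / real M))
        \<le> integral {0..real M} (\<lambda>x. (norm (f (Complex x \<eta>)))\<^sup>2)"
      by (rule bessel_inequality[OF \<eta>(1)])
    also have "\<dots> \<le> B * (\<Sum>c\<in>{1..N}. \<Sum>p\<in>{0..c * M}. integral {0..real M} (?g c p))"
      using B(2) \<eta> unfolding N_def
      by (intro has_integral_le[OF integrable_integral[OF integrable_continuous_interval[OF contf]] int[unfolded N_def]]) auto
    also have "\<dots> \<le> B * (\<Sum>c\<in>{1..N}. \<Sum>p\<in>{0..c * M}. P / (real c) ^ 4)"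
      using B(1) \<eta> unfolding P_def by (intro mult_left_mono sum_mono integral_cusp_term_le) auto
    also have "\<dots> \<le> B * (\<Sum>c\<in>{1..N}. (2 * real M * P) * (1 / (real c)\<^sup>2))"
    proof (intro mult_left_mono sum_mono B(1))
      fix c assume "c \<in> {1..N}"
      then have c: "real c \<ge> 1" by simp
      have "(\<Sum>p\<in>{0..c * M}. P / (real c) ^ 4) = (real c * real M + 1) * P / (real c) ^ 4" by simp
      also have "\<dots> \<le> ((real c)\<^sup>2 * (2 * real M)) * P / (real c) ^ 4"
      proof (intro divide_right_mono mult_right_mono Ppos)
        have "1 \<le> real M" using M by simp
        have "real c * real M \<le> (real c)\<^sup>2 * real M" using c by (intro mult_right_mono) (auto simp: power2_eq_square)
        moreover have "1 * 1 \<le> (real c)\<^sup>2 * real M" using c \<open>1 \<le> real M\<close> by (intro mult_mono) auto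
        ultimately show "real c * real M + 1 \<le> (real c)\<^sup>2 * (2 * real M)" by simp
      qed auto
      also have "\<dots> = (2 * real M * P) * (1 / (real c)\<^sup>2)"
        using c by (simp add: field_simps power2_eq_square power4_eq_xxxx)
      finally show "(\<Sum>p\<in>{0..c * M}. P / (real c) ^ 4) \<le> (2 * real M * P) * (1 / (real c)\<^sup>2)" .
    qed
    also have "\<dots> = B * (2 * real M * P) * (\<Sum>c\<in>{1..N}. 1 / (real c)\<^sup>2)"
      by (simp only: sum_distrib_left mult.assoc)
    also have "\<dots> \<le> B * (2 * real M * P) * 2"
      using B(1) Ppos by (intro mult_left_mono sum_inverse_squares_le_two) auto
    finally have "(\<Sum>n<K. (norm (a n))\<^sup>2 * exp (- 4 * pi * real n * \<eta> / real M)) \<le> B * (2 * real M * P) * 2 / real M"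
      using Mpos by (simp add: pos_le_divide_eq mult.commute)
    also have "\<dots> = (B * (4 * real M * pi) / real M) * \<eta> powr (1 - 2 * \<kappa>)" by (simp add: P_def)
    also have "\<dots> \<le> C * \<eta> powr (1 - 2 * \<kappa>)" unfolding C_def by (intro mult_right_mono) auto
    finally show ?thesis .
  qed
  moreover have "C > 0" unfolding C_def using B(1) Mpos by (intro add_nonneg_pos) auto
  ultimately show ?thesis by blast
qed

section \<open>Sieving by additive shifts\<close>

text \<open>Rational shifts act diagonally on the Fourier expansion. Applying them one prime at a
  time lets the cusps they reach be followed by induction on the list.\<close>

primrec sieved :: "(nat \<Rightarrow> nat \<Rightarrow> complex) \<Rightarrow> nat list \<Rightarrow> complex \<Rightarrow> complex" where
  "sieved u [] \<tau> = f \<tau>"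
| "sieved u (p # ps) \<tau> = (\<Sum>j<p\<^sup>2. u p j * sieved u ps (\<tau> + of_nat M * of_nat j / of_nat (p\<^sup>2)))"

text \<open>The finite Fourier transform of the shift coefficients modulo p^2, which is the factor
  picked up by the n-th Fourier coefficient.\<close>

definition weight :: "(nat \<Rightarrow> complex) \<Rightarrow> nat \<Rightarrow> nat \<Rightarrow> complex" where
  "weight v p n = (\<Sum>j<p\<^sup>2. v j * exp (2 * of_real pi * \<i> * of_nat n * of_nat j / of_nat (p\<^sup>2)))"

lemma sieved_sums:
  assumes "Im \<tau> > 0"
  shows "(\<lambda>n. a n * (\<Prod>p\<leftarrow>ps. weight (u p) p n) * exp (2 * of_real pi * \<i> * of_nat n * \<tau> / of_nat M)) sums sieved u ps \<tau>"
  using assms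
proof (induction ps arbitrary: \<tau>)
  case Nil
  then show ?case using expansion by simp
next
  case (Cons p ps)
  let ?e = "\<lambda>n \<tau>. exp (2 * of_real pi * \<i> * of_nat n * \<tau> / of_nat M)"
  let ?W = "\<lambda>n. \<Prod>p\<leftarrow>ps. weight (u p) p n"
  have "(\<lambda>n. \<Sum>j<p\<^sup>2. u p j * (a n * ?W n * ?e n (\<tau> + of_nat M * of_nat j / of_nat (p\<^sup>2)))) sums sieved u (p # ps) \<tau>"
    using Cons.prems by (auto intro!: sums_sum sums_mult Cons.IH)
  moreover have "(\<Sum>j<p\<^sup>2. u p j * (a n * ?W n * ?e n (\<tau> + of_nat M * of_nat j / of_nat (p\<^sup>2))))
      = a n * (\<Prod>p\<leftarrow>p # ps. weight (u p) p n) * ?e n \<tau>" for n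
  proof -
    have "?e n (\<tau> + of_nat M * of_nat j / of_nat (p\<^sup>2))
        = ?e n \<tau> * exp (2 * of_real pi * \<i> * of_nat n * of_nat j / of_nat (p\<^sup>2))" for j
      unfolding exp_add[symmetric] using M by (simp add: add_divide_distrib distrib_left mult_ac)
    then have "(\<Sum>j<p\<^sup>2. u p j * (a n * ?W n * ?e n (\<tau> + of_nat M * of_nat j / of_nat (p\<^sup>2))))
        = (\<Sum>j<p\<^sup>2. (a n * ?W n * ?e n \<tau>) * (u p j * exp (2 * of_real pi * \<i> * of_nat n * of_nat j / of_nat (p\<^sup>2))))"
      by (simp only: mult_ac)
    also have "\<dots> = (a n * ?W n * ?e n \<tau>) * weight (u p) p n" unfolding weight_def sum_distrib_left ..
    finally show ?thesis by (simp add: mult_ac)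
  qed
  ultimately show ?case by (simp only:)
qed

text \<open>\<open>k\<close> is the coefficient of the trivial shift. Every other shift is charged
  m^(-2), a bound for m^(-kappa), where m is the growth of the denominator: p if p divides
  \<open>c\<close> or \<open>j\<close>, and p^2 otherwise. The total charge may not exceed p^(-2)
  relative to \<open>k\<close>.\<close>

definition sieve_weight :: "int \<Rightarrow> (nat \<Rightarrow> complex) \<Rightarrow> real \<Rightarrow> nat \<Rightarrow> bool" where
  "sieve_weight c v k p \<longleftrightarrow> prime p \<and> \<not> p dvd M \<and> k > 0 \<and> v 0 = of_real k \<and>
     (int p dvd c \<longrightarrow> \<not> (int p)\<^sup>2 dvd c \<and> (\<forall>j\<in>{2..<p\<^sup>2}. v j = 0)) \<and>
     (\<Sum>j\<in>{1..<p\<^sup>2}. norm (v j) * (if int p dvd c \<or> p dvd j then 1 / (real p)\<^sup>2 else 1 / (real p) ^ 4)) \<le> k / (real p)\<^sup>2"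

text \<open>Over the common denominator, p divides only the first summand of the numerator, and the
  part of the denominator prime to p is coprime to the first summand and divides the second. So the
  fraction is already reduced.\<close>

lemma shifted_cusp:
  fixes a' c' c :: int and j p :: nat
  assumes p: "prime p" "\<not> p dvd M" and cop: "coprime a' c'" "c' > 0"
    and same: "int p dvd c' \<longleftrightarrow> int p dvd c" and sq: "int p dvd c \<longrightarrow> \<not> (int p)\<^sup>2 dvd c'"
    and j: "0 < j" "j < p\<^sup>2" "int p dvd c \<longrightarrow> j = 1"
  obtains a'' m where "coprime a'' (c' * int m)" "m = (if int p dvd c \<or> p dvd j then p else p\<^sup>2)"
    "of_int a'' / of_int (c' * int m) = of_int a' / of_int c' + of_nat M * of_nat j / (of_nat (p\<^sup>2) :: complex)"
proof -
  have pp: "prime (int p)" using p(1) by simp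
  have pM: "\<not> int p dvd int M" using p(2) by simp
  have p0: "p > 0" using prime_gt_0_nat[OF p(1)] .
  have nz: "of_int c' \<noteq> (0::complex)" "of_nat p \<noteq> (0::complex)" using cop(2) p0 by auto
  \<comment> \<open>\<open>e\<close> is the part of the denominator prime to p and \<open>s\<close>
    the power of p multiplying \<open>a'\<close>; \<open>t\<close> is the further factor p that
    occurs when p divides \<open>c\<close>.\<close>
  have main: "coprime (a' * s + int M * i * e) (e * s * t)"
    if "\<not> int p dvd int M * i * e" "coprime a' e" "s = int p \<or> s = int p * int p" "t = 1 \<or> t = int p" for s i e t
  proof -
    have "\<not> int p dvd a' * s + int M * i * e" using that(1,3) by (auto simp: dvd_add_right_iff)
    then have "coprime (a' * s + int M * i * e) (int p)" using pp by (meson coprime_commute prime_imp_coprime)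
    moreover have "coprime (a' * s + int M * i * e) e"
    proof -
      have "coprime s e"
      proof -
        have "\<not> int p dvd e" using that(1) by auto
        then have "coprime (int p) e" using pp by (rule prime_imp_coprime[rotated])
        then show ?thesis using that(3) by auto
      qed
      then have "coprime (a' * s) e" using that(2) by simp
      then show ?thesis by (metis coprime_iff_gcd_eq_1 gcd_add_mult add.commute mult.commute gcd.commute)
    qed
    ultimately show ?thesis using that(3,4) by auto
  qed
  show thesis
  proof (cases "int p dvd c")
    case True
    then obtain e where e: "c' = int p * e" using same by auto
    have pe: "\<not> int p dvd e" using sq True e by (auto simp: power2_eq_square)
    have "coprime a' e" using cop(1) e by simp
    moreover have "\<not> int p dvd int M * 1 * e" using pe pM pp by (simp add: prime_dvd_mult_iff)
    ultimately have "coprime (a' * int p + int M * 1 * e) (e * int p * int p)" by (intro main) auto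
    moreover have "of_int (a' * int p + int M * 1 * e) / of_int (c' * int p) = of_int a' / of_int c' + of_nat M * of_nat j / (of_nat (p\<^sup>2) :: complex)"
      using j(3) True nz e by (simp add: field_simps power2_eq_square)
    ultimately show thesis using True that[of "a' * int p + int M * 1 * e" p] by (simp add: e mult_ac)
  next
    case False
    then have pc: "\<not> int p dvd c'" using same by simp
    show thesis
    proof (cases "p dvd j")
      case True
      then obtain i where i: "j = p * i" by auto
      have "\<not> p dvd i"
      proof
        assume "p dvd i"
        then have "p * p dvd j" using i by simp
        then have "p\<^sup>2 \<le> j" using j(1) by (auto simp: power2_eq_square dest: dvd_imp_le)
        then show False using j(2) by simp
      qed
      then have "\<not> int p dvd int M * int i * c'" using pc pM pp by (simp add: prime_dvd_mult_iff)
      then have "coprime (a' * int p + int M * int i * c') (c' * int p * 1)" using cop by (intro main) auto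
      moreover have "of_int (a' * int p + int M * int i * c') / of_int (c' * int p) = of_int a' / of_int c' + of_nat M * of_nat j / (of_nat (p\<^sup>2) :: complex)"
        using nz i by (simp add: field_simps power2_eq_square)
      ultimately show thesis using True that[of "a' * int p + int M * int i * c'" p] by simp
    next
      case nd: False
      then have "\<not> int p dvd int M * int j * c'" using pc pM pp by (simp add: prime_dvd_mult_iff)
      then have "coprime (a' * (int p * int p) + int M * int j * c') (c' * (int p * int p) * 1)" using cop by (intro main) auto
      moreover have "of_int (a' * (int p * int p) + int M * int j * c') / of_int (c' * (int p * int p)) = of_int a' / of_int c' + of_nat M * of_nat j / (of_nat (p\<^sup>2) :: complex)"
        using nz by (simp add: field_simps power2_eq_square)
      ultimately show thesis using False nd that[of "a' * (int p * int p) + int M * int j * c'" "p\<^sup>2"]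
        by (simp add: power2_eq_square)
    qed
  qed
qed

lemma f_near_cusp:
  assumes "coprime p r" "r > 0" "Im \<xi> > 0" "T0 \<le> Im \<xi> / (norm \<xi> * of_int r)\<^sup>2"
    and T0: "\<And>\<gamma> z. \<gamma> \<in> SL2Z \<Longrightarrow> Im z \<ge> T0 \<Longrightarrow> nslash \<gamma> z \<le> \<Psi>"
  shows "norm (f (of_int p / of_int r + \<xi>)) \<le> norm \<xi> powr (- \<kappa>) * \<Psi> * of_int r powr (- \<kappa>)"
proof -
  obtain q s where g: "(p, q, r, s) \<in> SL2Z" using SL2Z_complete[OF assms(1)] by blast
  let ?\<tau> = "of_int p / of_int r + \<xi>"
  have im: "Im ?\<tau> = Im \<xi>"
  proof -
    have "of_int p / of_int r = complex_of_real (of_int p / of_int r)" by simp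
    then show ?thesis by (simp only: plus_complex.simps Im_complex_of_real)
  qed
  then have \<tau>: "Im ?\<tau> > 0" using assms(3) by simp
  note via = norm_f_via_cusp[OF g \<tau>]
  have eq: "of_int r * ?\<tau> - of_int p = of_int r * \<xi>" using assms(2) by (simp add: field_simps)
  have n: "norm (of_int r * \<xi>) = norm \<xi> * of_int r" using assms(2) by (simp add: norm_mult mult.commute)
  have "T0 \<le> Im (moebius (mat_inv (p, q, r, s)) ?\<tau>)" unfolding via(2) eq n im by (rule assms(4))
  then have "nslash (p, q, r, s) (moebius (mat_inv (p, q, r, s)) ?\<tau>) \<le> \<Psi>" by (rule T0[OF g])
  then have "norm (f ?\<tau>) \<le> (norm \<xi> * of_int r) powr (- \<kappa>) * \<Psi>"
    unfolding via(1) eq n by (intro mult_left_mono) auto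
  then show ?thesis using assms(2) by (simp add: powr_mult mult_ac)
qed

section \<open>Propagation of the bounds through the sieve\<close>

lemma powr_neg_le_inverse_square:
  assumes "m \<ge> (1::nat)" shows "real m powr (- \<kappa>) \<le> 1 / (real m)\<^sup>2"
proof -
  have "real m powr (- \<kappa>) \<le> real m powr (- 2)" using assms kappa by (intro powr_mono) auto
  also have "\<dots> = 1 / (real m)\<^sup>2" using assms by (simp add: powr_minus powr_numeral field_simps)
  finally show ?thesis .
qed

text \<open>\<open>g\<close> stands for the form sieved by the remaining primes; keeping it abstract
  lets the estimate serve both the upper bound and the main term. The growth of the denominator is
  paid for by the charges in \<open>sieve_weight\<close>.\<close>

lemma sieved_step_bound:
  fixes \<xi> :: complex and a' c' c :: int and V K :: real
  assumes sw: "sieve_weight c v k p"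
    and cop: "coprime a' c'" "c' > 0"
    and same: "int p dvd c' \<longleftrightarrow> int p dvd c" and sq: "int p dvd c \<longrightarrow> \<not> (int p)\<^sup>2 dvd c'"
    and K: "K \<ge> 0" "V \<ge> 0"
    and g: "\<And>a'' m. m = p \<or> m = p\<^sup>2 \<Longrightarrow> coprime a'' (c' * int m) \<Longrightarrow>
        norm (g (of_int a'' / of_int (c' * int m) + \<xi>)) \<le> K * V * of_int (c' * int m) powr (- \<kappa>)"
  shows "norm (\<Sum>j\<in>{1..<p\<^sup>2}. v j * g (of_int a' / of_int c' + \<xi> + of_nat M * of_nat j / of_nat (p\<^sup>2)))
           \<le> k / (real p)\<^sup>2 * (K * V * of_int c' powr (- \<kappa>))"
proof -
  have p: "prime p" "\<not> p dvd M" using sw by (auto simp: sieve_weight_def)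
  have p1: "p \<ge> 1" using prime_gt_0_nat[OF p(1)] by simp
  let ?r = "\<lambda>j. if int p dvd c \<or> p dvd j then 1 / (real p)\<^sup>2 else 1 / (real p) ^ 4"
  have "norm (v j * g (of_int a' / of_int c' + \<xi> + of_nat M * of_nat j / of_nat (p\<^sup>2)))
      \<le> norm (v j) * ?r j * (K * V * of_int c' powr (- \<kappa>))" if j: "j \<in> {1..<p\<^sup>2}" for j
  proof (cases "v j = 0")
    case False
    have j1: "int p dvd c \<longrightarrow> j = 1"
    proof (intro impI, rule ccontr)
      assume c: "int p dvd c" "j \<noteq> 1"
      then have "j \<in> {2..<p\<^sup>2}" using j by auto
      then have "v j = 0" using sw c(1) unfolding sieve_weight_def by blast
      then show False using False by simp
    qed
    obtain a'' m where am: "coprime a'' (c' * int m)" "m = (if int p dvd c \<or> p dvd j then p else p\<^sup>2)"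
      "of_int a'' / of_int (c' * int m) = of_int a' / of_int c' + of_nat M * of_nat j / (of_nat (p\<^sup>2) :: complex)"
      using shifted_cusp[OF p cop same sq _ _ j1] j by auto
    have m: "m \<ge> 1" using p1 am(2) by simp
    have eq: "of_int a' / of_int c' + \<xi> + of_nat M * of_nat j / of_nat (p\<^sup>2) = of_int a'' / of_int (c' * int m) + \<xi>"
      unfolding am(3) by (simp only: add_ac)
    have "norm (g (of_int a'' / of_int (c' * int m) + \<xi>)) \<le> K * V * of_int (c' * int m) powr (- \<kappa>)"
      using am(2) by (intro g am(1)) auto
    also have "of_int (c' * int m) powr (- \<kappa>) = of_int c' powr (- \<kappa>) * real m powr (- \<kappa>)"
      using cop(2) m by (simp add: powr_mult)
    also have "real m powr (- \<kappa>) \<le> ?r j"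
    proof -
      have "?r j = 1 / (real m)\<^sup>2" using am(2) by (auto simp flip: power_mult)
      then show ?thesis using powr_neg_le_inverse_square[OF m] by (simp only:)
    qed
    finally have "norm (g (of_int a'' / of_int (c' * int m) + \<xi>)) \<le> K * V * (of_int c' powr (- \<kappa>) * ?r j)"
      using K cop(2) by (simp add: mult_left_mono)
    then have "norm (v j) * norm (g (of_int a'' / of_int (c' * int m) + \<xi>)) \<le> norm (v j) * (K * V * (of_int c' powr (- \<kappa>) * ?r j))"
      by (intro mult_left_mono) auto
    then show ?thesis unfolding eq norm_mult by (simp only: mult_ac)
  qed simp
  then have "norm (\<Sum>j\<in>{1..<p\<^sup>2}. v j * g (of_int a' / of_int c' + \<xi> + of_nat M * of_nat j / of_nat (p\<^sup>2)))
      \<le> (\<Sum>j\<in>{1..<p\<^sup>2}. norm (v j) * ?r j * (K * V * of_int c' powr (- \<kappa>)))"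
    by (rule sum_norm_le)
  also have "\<dots> = (\<Sum>j\<in>{1..<p\<^sup>2}. norm (v j) * ?r j) * (K * V * of_int c' powr (- \<kappa>))"
    by (simp only: sum_distrib_right)
  also have "\<dots> \<le> k / (real p)\<^sup>2 * (K * V * of_int c' powr (- \<kappa>))"
    using sw K by (intro mult_right_mono) (auto simp: sieve_weight_def)
  finally show ?thesis .
qed

lemma sieved_Cons_split:
  assumes "p > 0" "v = u p"
  shows "sieved u (p # ps) \<tau> = v 0 * sieved u ps \<tau> + (\<Sum>j\<in>{1..<p\<^sup>2}. v j * sieved u ps (\<tau> + of_nat M * of_nat j / of_nat (p\<^sup>2)))"
proof -
  have "{..<p\<^sup>2} = insert 0 {1..<p\<^sup>2}" using assms(1) by auto
  then show ?thesis by (simp add: assms(2))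
qed

text \<open>The product reserves a factor p^2 for each prime still to be applied, so that the height
  stays at least \<open>T0\<close> at every cusp reached later. The divisibility clauses make
  \<open>c'\<close> behave like \<open>c\<close> at these primes, so that weights designed for
  \<open>c\<close> also suit \<open>c'\<close>.\<close>

definition near_cusp :: "complex \<Rightarrow> int \<Rightarrow> real \<Rightarrow> nat list \<Rightarrow> int \<Rightarrow> bool" where
  "near_cusp \<xi> c T0 ps c' \<longleftrightarrow> c' > 0 \<and> T0 \<le> Im \<xi> / (norm \<xi> * (of_int c' * (\<Prod>p\<leftarrow>ps. (real p)\<^sup>2)))\<^sup>2 \<and>
     (\<forall>p\<in>set ps. (int p dvd c' \<longleftrightarrow> int p dvd c) \<and> (int p dvd c \<longrightarrow> \<not> (int p)\<^sup>2 dvd c'))"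

context
  fixes \<xi> :: complex and c :: int and T0 \<Psi> :: real
  assumes \<xi>: "Im \<xi> > 0" and \<Psi>: "\<Psi> \<ge> 0"
    and T0: "\<And>\<gamma> z. \<gamma> \<in> SL2Z \<Longrightarrow> Im z \<ge> T0 \<Longrightarrow> nslash \<gamma> z \<le> \<Psi>"
begin

text \<open>The factor m <= p^2 is paid from the reserve for p, and it is coprime to all remaining
  primes.\<close>

lemma near_cusp_step:
  assumes nc: "near_cusp \<xi> c T0 (p # ps) c'" and d: "distinct (p # ps)" and pr: "\<And>q. q \<in> set (p # ps) \<Longrightarrow> prime q"
    and m: "m = 1 \<or> m = p \<or> m = p\<^sup>2"
  shows "near_cusp \<xi> c T0 ps (c' * int m)"
proof -
  let ?P = "\<Prod>p\<leftarrow>ps. (real p)\<^sup>2"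
  have p1: "p \<ge> 1" using prime_gt_0_nat[of p] pr[of p] by simp
  have c': "c' > 0" using nc by (simp add: near_cusp_def)
  have P: "?P > 0"
  proof -
    have "\<forall>x\<in>set (map (\<lambda>p. (real p)\<^sup>2) ps). x > 0" using pr prime_gt_0_nat by auto
    then show ?thesis by (induction ps) auto
  qed
  have m1: "1 \<le> m" "real m \<le> (real p)\<^sup>2"
  proof -
    have "1 \<le> real p" using p1 by simp
    then have "1 \<le> (real p)\<^sup>2" "real p \<le> (real p)\<^sup>2" by (simp_all add: self_le_power)
    then show "1 \<le> m" "real m \<le> (real p)\<^sup>2" using m p1 by auto
  qed
  have \<xi>0: "norm \<xi> > 0" using \<xi> by auto
  have "T0 \<le> Im \<xi> / (norm \<xi> * (of_int c' * ((real p)\<^sup>2 * ?P)))\<^sup>2" using nc by (simp add: near_cusp_def)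
  also have "\<dots> \<le> Im \<xi> / (norm \<xi> * (of_int (c' * int m) * ?P))\<^sup>2"
  proof (intro divide_left_mono power_mono mult_left_mono mult_pos_pos zero_less_power)
    have "of_int c' * (real m * ?P) \<le> of_int c' * ((real p)\<^sup>2 * ?P)"
      using m1 P c' by (intro mult_left_mono mult_right_mono) auto
    then show "of_int (c' * int m) * ?P \<le> of_int c' * ((real p)\<^sup>2 * ?P)" by (simp add: mult_ac)
  qed (use \<xi> \<xi>0 c' m1 P p1 in auto)
  finally have "T0 \<le> Im \<xi> / (norm \<xi> * (of_int (c' * int m) * ?P))\<^sup>2" .
  moreover have "(int q dvd c' * int m \<longleftrightarrow> int q dvd c) \<and> (int q dvd c \<longrightarrow> \<not> (int q)\<^sup>2 dvd c' * int m)" if q: "q \<in> set ps" for q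
  proof -
    have "q \<noteq> p" using d q by auto
    then have "coprime q p" using pr q by (intro primes_coprime) auto
    then have cop: "coprime q m" using m by auto
    then have "coprime (int q) (int m)" "coprime ((int q)\<^sup>2) (int m)" by auto
    then have "int q dvd c' * int m \<longleftrightarrow> int q dvd c'" "(int q)\<^sup>2 dvd c' * int m \<longleftrightarrow> (int q)\<^sup>2 dvd c'"
      by (simp_all add: coprime_dvd_mult_left_iff)
    then show ?thesis using nc q by (simp add: near_cusp_def)
  qed
  ultimately show ?thesis using c' m1 by (simp add: near_cusp_def)
qed

abbreviation (input) "V \<equiv> norm \<xi> powr (- \<kappa>) * \<Psi>"

text \<open>At each prime the trivial shift contributes k p, and the other shifts together at most k
  p / p^2, of the bound for the remaining primes. The cusp is arbitrary because the shifts move it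
  during the induction.\<close>

lemma sieved_upper_bound:
  assumes "distinct ps" "\<And>p. p \<in> set ps \<Longrightarrow> sieve_weight c (u p) (k p) p"
    and "near_cusp \<xi> c T0 ps c'" "coprime a' c'"
  shows "norm (sieved u ps (of_int a' / of_int c' + \<xi>)) \<le> (\<Prod>p\<leftarrow>ps. k p * (1 + 1 / (real p)\<^sup>2)) * V * of_int c' powr (- \<kappa>)"
  using assms
proof (induction ps arbitrary: a' c')
  case Nil
  then have "c' > 0" "T0 \<le> Im \<xi> / (norm \<xi> * of_int c')\<^sup>2" by (simp_all add: near_cusp_def)
  from f_near_cusp[OF Nil.prems(4) this(1) \<xi> this(2) T0] show ?case by simp
next
  case (Cons p ps)
  let ?K = "\<Prod>p\<leftarrow>ps. k p * (1 + 1 / (real p)\<^sup>2)"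
  have pr: "prime q" if "q \<in> set (p # ps)" for q using Cons.prems(2)[OF that] by (simp add: sieve_weight_def)
  have kpos: "k q > 0" if "q \<in> set (p # ps)" for q using Cons.prems(2)[OF that] by (simp add: sieve_weight_def)
  have sw: "sieve_weight c (u p) (k p) p" using Cons.prems(2) by simp
  have v0: "u p 0 = of_real (k p)" using sw by (simp add: sieve_weight_def)
  have K: "?K \<ge> 0"
  proof (intro prod_list_nonneg)
    fix x assume "x \<in> set (map (\<lambda>p. k p * (1 + 1 / (real p)\<^sup>2)) ps)"
    then obtain q where "q \<in> set ps" "x = k q * (1 + 1 / (real q)\<^sup>2)" by auto
    then show "x \<ge> 0" using kpos[of q] by (simp add: add_nonneg_nonneg)
  qed
  have V: "V \<ge> 0" using \<Psi> by simp
  have IH: "norm (sieved u ps (of_int a'' / of_int (c' * int m) + \<xi>)) \<le> ?K * V * of_int (c' * int m) powr (- \<kappa>)"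
    if "m = 1 \<or> m = p \<or> m = p\<^sup>2" "coprime a'' (c' * int m)" for a'' m
    using Cons.prems that by (intro Cons.IH near_cusp_step[OF Cons.prems(3,1) pr]) auto
  have "norm (sieved u (p # ps) (of_int a' / of_int c' + \<xi>)) \<le> norm (u p 0 * sieved u ps (of_int a' / of_int c' + \<xi>))
     + norm (\<Sum>j\<in>{1..<p\<^sup>2}. u p j * sieved u ps (of_int a' / of_int c' + \<xi> + of_nat M * of_nat j / of_nat (p\<^sup>2)))"
    unfolding sieved_Cons_split[OF prime_gt_0_nat[OF pr[of p, simplified]] refl] by (rule norm_triangle_ineq)
  also have "norm (u p 0 * sieved u ps (of_int a' / of_int c' + \<xi>)) \<le> k p * (?K * V * of_int c' powr (- \<kappa>))"
    using IH[of 1 a'] Cons.prems(4) kpos[of p] unfolding v0 norm_mult by (intro mult_mono) auto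
  also have "norm (\<Sum>j\<in>{1..<p\<^sup>2}. u p j * sieved u ps (of_int a' / of_int c' + \<xi> + of_nat M * of_nat j / of_nat (p\<^sup>2)))
      \<le> k p / (real p)\<^sup>2 * (?K * V * of_int c' powr (- \<kappa>))"
    using Cons.prems(3) by (intro sieved_step_bound[OF sw Cons.prems(4) _ _ _ K V] IH) (auto simp: near_cusp_def)
  finally show ?case by (simp add: field_simps)
qed

text \<open>The main term takes the trivial shift at every prime, so its cusp keeps the denominator
  \<open>c\<close>. With E the product over the remaining primes, the relative error grows as (1 + 1
  / p^2) E - 1 = (E - 1) + E / p^2: the induction hypothesis plus the upper bound at the moved
  cusps.\<close>

lemma sieved_main_term:
  assumes "distinct ps" "\<And>p. p \<in> set ps \<Longrightarrow> sieve_weight c (u p) (k p) p"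
    and "near_cusp \<xi> c T0 ps c" "coprime a' c"
  shows "norm (sieved u ps (of_int a' / of_int c + \<xi>) - of_real (\<Prod>p\<leftarrow>ps. k p) * f (of_int a' / of_int c + \<xi>))
      \<le> (\<Prod>p\<leftarrow>ps. k p) * ((\<Prod>p\<leftarrow>ps. 1 + 1 / (real p)\<^sup>2) - 1) * V * of_int c powr (- \<kappa>)"
  using assms
proof (induction ps)
  case (Cons p ps)
  let ?K = "\<Prod>p\<leftarrow>ps. k p * (1 + 1 / (real p)\<^sup>2)" and ?k = "\<Prod>p\<leftarrow>ps. k p" and ?E = "\<Prod>p\<leftarrow>ps. 1 + 1 / (real p)\<^sup>2"
  have KkE: "?K = ?k * ?E" by (induction ps) (auto simp: mult_ac)
  have pr: "prime q" if "q \<in> set (p # ps)" for q using Cons.prems(2)[OF that] by (simp add: sieve_weight_def)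
  have kpos: "k q > 0" if "q \<in> set (p # ps)" for q using Cons.prems(2)[OF that] by (simp add: sieve_weight_def)
  have sw: "sieve_weight c (u p) (k p) p" using Cons.prems(2) by simp
  have v0: "u p 0 = of_real (k p)" using sw by (simp add: sieve_weight_def)
  have K: "?K \<ge> 0"
  proof (intro prod_list_nonneg)
    fix x assume "x \<in> set (map (\<lambda>p. k p * (1 + 1 / (real p)\<^sup>2)) ps)"
    then obtain q where "q \<in> set ps" "x = k q * (1 + 1 / (real q)\<^sup>2)" by auto
    then show "x \<ge> 0" using kpos[of q] by (simp add: add_nonneg_nonneg)
  qed
  have V: "V \<ge> 0" using \<Psi> by simp
  let ?\<tau> = "of_int a' / of_int c + \<xi>"
  let ?S = "\<Sum>j\<in>{1..<p\<^sup>2}. u p j * sieved u ps (?\<tau> + of_nat M * of_nat j / of_nat (p\<^sup>2))"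
  have up: "norm (sieved u ps (of_int a'' / of_int (c * int m) + \<xi>)) \<le> ?K * V * of_int (c * int m) powr (- \<kappa>)"
    if "m = p \<or> m = p\<^sup>2" "coprime a'' (c * int m)" for a'' m
    using Cons.prems that by (intro sieved_upper_bound near_cusp_step[OF Cons.prems(3,1) pr]) auto
  have nS: "norm ?S \<le> k p / (real p)\<^sup>2 * (?K * V * of_int c powr (- \<kappa>))"
    using Cons.prems(3) by (intro sieved_step_bound[OF sw Cons.prems(4) _ _ _ K V] up) (auto simp: near_cusp_def)
  have nD: "norm (of_real (k p) * (sieved u ps ?\<tau> - of_real ?k * f ?\<tau>)) \<le> k p * (?k * (?E - 1) * V * of_int c powr (- \<kappa>))"
    unfolding norm_mult
  proof (rule mult_mono)
    have "near_cusp \<xi> c T0 ps (c * int 1)" by (rule near_cusp_step[OF Cons.prems(3,1) pr]) auto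
    then show "norm (sieved u ps ?\<tau> - of_real ?k * f ?\<tau>) \<le> ?k * (?E - 1) * V * of_int c powr (- \<kappa>)"
      using Cons.prems by (intro Cons.IH) auto
  qed (use kpos[of p] in auto)
  have eq: "sieved u (p # ps) ?\<tau> - of_real (\<Prod>p\<leftarrow>p # ps. k p) * f ?\<tau> = of_real (k p) * (sieved u ps ?\<tau> - of_real ?k * f ?\<tau>) + ?S"
    unfolding sieved_Cons_split[OF prime_gt_0_nat[OF pr[of p, simplified]] refl] v0 by (simp add: algebra_simps)
  have "norm (sieved u (p # ps) ?\<tau> - of_real (\<Prod>p\<leftarrow>p # ps. k p) * f ?\<tau>)
      \<le> k p * (?k * (?E - 1) * V * of_int c powr (- \<kappa>)) + k p / (real p)\<^sup>2 * (?K * V * of_int c powr (- \<kappa>))"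
    unfolding eq by (intro order_trans[OF norm_triangle_ineq] add_mono nS nD)
  also have "\<dots> = (\<Prod>p\<leftarrow>p # ps. k p) * ((\<Prod>p\<leftarrow>p # ps. 1 + 1 / (real p)\<^sup>2) - 1) * V * of_int c powr (- \<kappa>)"
    unfolding KkE by (simp add: algebra_simps)
  finally show ?case .
qed simp

end

end

text \<open>The weight attached to \<open>p\<close> is, up to a factor, the indicator of \<open>p\<^sup>2\<close> not dividing \<open>n\<close> unless \<open>p\<close> is
  2 or divides the denominator \<open>c\<close> of the cusp; for \<open>p = 2\<close> it selects the odd \<open>n\<close>. If \<open>p\<close>
  divides \<open>c\<close>, a shift by a multiple of \<open>p\<close> could lower the denominator of the cusp; there \<open>1 - exp (2 * pi * \<i> * n / p\<^sup>2)\<close> is used,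
  which also vanishes when \<open>p\<^sup>2\<close> divides \<open>n\<close> and needs a single shift.\<close>

definition local_weight :: "int \<Rightarrow> nat \<Rightarrow> nat \<Rightarrow> complex" where
  "local_weight c p j =
     (if p = 2 then (if j = 0 then 1 else if j = 2 then - 1 else 0)
      else if int p dvd c then (if j = 0 then 1 else if j = 1 then - 1 else 0)
      else (if j = 0 then 1 else 0) - 1 / of_nat (p\<^sup>2))"

text \<open>The coefficient of the trivial shift, which is the mean of the weight over n modulo
  p^2.\<close>

definition local_mean :: "int \<Rightarrow> nat \<Rightarrow> real" where
  "local_mean c p = (if p = 2 \<or> int p dvd c then 1 else 1 - 1 / (real p)\<^sup>2)"

section \<open>Values and sizes of the concrete weights\<close>

lemma exp_root_of_unity_eq_1_iff:
  fixes n q :: nat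
  assumes "q > 0"
  shows "exp (2 * of_real pi * \<i> * of_nat n / of_nat q) = 1 \<longleftrightarrow> q dvd n"
proof
  assume "q dvd n"
  then obtain k where "n = q * k" by auto
  then have "2 * of_real pi * \<i> * of_nat n / of_nat q = (2 * of_int (int k) * of_real pi) * \<i>" using assms by simp
  then show "exp (2 * of_real pi * \<i> * of_nat n / of_nat q) = 1"
    unfolding exp_eq_1 by (auto intro!: exI[of _ "int k"])
next
  assume "exp (2 * of_real pi * \<i> * of_nat n / of_nat q) = 1"
  then obtain k :: int where "Im (2 * of_real pi * \<i> * of_nat n / of_nat q) = of_int (2 * k) * pi"
    unfolding exp_eq_1 by blast
  moreover have "Im (2 * of_real pi * \<i> * of_nat n / of_nat q) = 2 * pi * real n / real q"
  proof -
    have "2 * of_real pi * \<i> * of_nat n / of_nat q = of_real (2 * pi * real n / real q) * \<i>" by simp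
    then show ?thesis by simp
  qed
  ultimately have "2 * pi * real n / real q = of_int (2 * k) * pi" by simp
  then have "real n = of_int k * real q" using assms by (simp add: field_simps)
  then have "real_of_int (int n) = real_of_int (k * int q)" by simp
  then have "int n = k * int q" by (simp only: of_int_eq_iff)
  then show "q dvd n" by (metis dvd_triv_right int_dvd_int_iff)
qed

lemma sum_exp_roots_of_unity:
  fixes n q :: nat
  assumes "q > 0"
  shows "(\<Sum>j<q. exp (2 * of_real pi * \<i> * of_nat n * of_nat j / of_nat q)) = (if q dvd n then of_nat q else 0)"
proof -
  define x where "x = exp (2 * of_real pi * \<i> * of_nat n / of_nat q)"
  have xj: "exp (2 * of_real pi * \<i> * of_nat n * of_nat j / of_nat q) = x ^ j" for j
    unfolding x_def exp_of_nat_mult[symmetric] by (simp add: mult_ac)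
  have "x ^ q = exp (2 * of_real pi * \<i> * of_nat (n * q) / of_nat q)"
    unfolding x_def exp_of_nat_mult[symmetric] by (simp add: mult_ac)
  then have xq: "x ^ q = 1" using exp_root_of_unity_eq_1_iff[OF assms, of "n * q"] by simp
  show ?thesis
  proof (cases "q dvd n")
    case True
    then have "x = 1" using exp_root_of_unity_eq_1_iff[OF assms] by (simp add: x_def)
    then show ?thesis using True by (simp only: xj) simp
  next
    case False
    then have "x \<noteq> 1" using exp_root_of_unity_eq_1_iff[OF assms] by (simp add: x_def)
    then have "(\<Sum>j<q. x ^ j) = 0" using xq by (simp add: geometric_sum)
    then show ?thesis using False by (simp only: xj) simp
  qed
qed

context modular_expansion
begin

lemma weight_two: "weight (local_weight c 2) 2 n = (if even n then 0 else 2)"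
proof -
  have "weight (local_weight c 2) 2 n = 1 - exp (2 * of_real pi * \<i> * of_nat n * 2 / 4)"
    by (simp add: weight_def local_weight_def numeral_eq_Suc lessThan_Suc mult_ac)
  also have "2 * of_real pi * \<i> * of_nat n * 2 / 4 = of_nat n * (of_real pi * \<i>)" by simp
  also have "exp \<dots> = (- 1) ^ n" by (simp only: exp_of_nat_mult exp_pi_i)
  finally show ?thesis by simp
qed

lemma weight_dividing:
  assumes p: "prime p" "p \<noteq> 2" "int p dvd c"
  shows "weight (local_weight c p) p n = 1 - exp (2 * of_real pi * \<i> * of_nat n / of_nat (p\<^sup>2))"
proof -
  have "p > 2" using p prime_gt_1_nat[of p] by simp
  then have "1 * 2 < p * p" by (intro mult_strict_mono) auto
  then have "{..<p\<^sup>2} = {0, 1} \<union> {2..<p\<^sup>2}" using \<open>p > 2\<close> by (auto simp: power2_eq_square)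
  then have "weight (local_weight c p) p n = (\<Sum>j\<in>{0, 1} \<union> {2..<p\<^sup>2}. local_weight c p j * exp (2 * of_real pi * \<i> * of_nat n * of_nat j / of_nat (p\<^sup>2)))"
    by (simp only: weight_def)
  also have "\<dots> = (\<Sum>j\<in>{0, 1}. local_weight c p j * exp (2 * of_real pi * \<i> * of_nat n * of_nat j / of_nat (p\<^sup>2)))"
    using p by (intro sum.mono_neutral_right) (auto simp: local_weight_def)
  finally show ?thesis using p by (simp add: local_weight_def)
qed

lemma weight_generic:
  assumes p: "prime p" "p \<noteq> 2" "\<not> int p dvd c"
  shows "weight (local_weight c p) p n = (if p\<^sup>2 dvd n then 0 else 1)"
proof -
  have q: "p\<^sup>2 > 0" using prime_gt_0_nat[OF p(1)] by simp
  let ?e = "\<lambda>j. exp (2 * of_real pi * \<i> * of_nat n * of_nat j / of_nat (p\<^sup>2))"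
  have "weight (local_weight c p) p n = (\<Sum>j<p\<^sup>2. (if j = 0 then ?e j else 0) - ?e j / of_nat (p\<^sup>2))"
    unfolding weight_def using p by (intro sum.cong refl) (simp add: local_weight_def left_diff_distrib)
  also have "\<dots> = (\<Sum>j<p\<^sup>2. (if j = 0 then ?e j else 0)) - (\<Sum>j<p\<^sup>2. ?e j) / of_nat (p\<^sup>2)"
    by (simp only: sum_subtractf sum_divide_distrib)
  also have "(\<Sum>j<p\<^sup>2. (if j = 0 then ?e j else 0)) = 1" using q by simp
  finally show ?thesis unfolding sum_exp_roots_of_unity[OF q] using q by simp
qed

text \<open>The bound exceeds 1 only at the divisors of \<open>2 * c\<close>, whose number is
  independent of the sieving range; this keeps the product of all weights bounded in terms of the
  cusp.\<close>

lemma norm_weight_le: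
  assumes "prime p"
  shows "norm (weight (local_weight c p) p n) \<le> (if int p dvd 2 * c then 2 else 1)"
proof -
  consider "p = 2" | "p \<noteq> 2" "int p dvd c" | "p \<noteq> 2" "\<not> int p dvd c" by blast
  then show ?thesis
  proof cases
    case 1
    then show ?thesis by (simp add: weight_two)
  next
    case 2
    have "2 * of_real pi * \<i> * of_nat n / of_nat (p\<^sup>2) = \<i> * of_real (2 * pi * real n / real (p\<^sup>2))" by simp
    then have "norm (exp (2 * of_real pi * \<i> * of_nat n / of_nat (p\<^sup>2))) = 1" by (simp only: norm_exp_i_times)
    then have "norm (1 - exp (2 * of_real pi * \<i> * of_nat n / of_nat (p\<^sup>2))) \<le> 2"
      using norm_triangle_ineq4[of 1 "exp (2 * of_real pi * \<i> * of_nat n / of_nat (p\<^sup>2))"] by simp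
    then show ?thesis using 2 assms by (simp add: weight_dividing)
  next
    case 3
    then show ?thesis using assms by (simp add: weight_generic)
  qed
qed

lemma weight_vanishes:
  assumes "prime p" "p = 2 \<Longrightarrow> even n" "p \<noteq> 2 \<Longrightarrow> p\<^sup>2 dvd n"
  shows "weight (local_weight c p) p n = 0"
proof -
  consider "p = 2" | "p \<noteq> 2" "int p dvd c" | "p \<noteq> 2" "\<not> int p dvd c" by blast
  then show ?thesis
  proof cases
    case 1
    then show ?thesis using assms by (simp add: weight_two)
  next
    case 2
    have "p\<^sup>2 > 0" using prime_gt_0_nat[OF assms(1)] by simp
    then show ?thesis using 2 assms exp_root_of_unity_eq_1_iff[of "p\<^sup>2" n] by (simp add: weight_dividing)
  next
    case 3
    then show ?thesis using assms by (simp add: weight_generic)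
  qed
qed

text \<open>At 2 and at the primes dividing \<open>c\<close> a single nontrivial shift is used,
  charged exactly 1 / p^2. At the others, at most p shifts with p dividing \<open>j\<close> cost 1 /
  p^4 each and fewer than p^2 shifts cost 1 / p^6 each, in all at most (1 / p + 1 / p^2) /
  p^2.\<close>

lemma sieve_weight_local_weight:
  assumes p: "prime p" "\<not> p dvd M" and odd: "p = 2 \<Longrightarrow> odd c" and sq: "p \<noteq> 2 \<Longrightarrow> \<not> (int p)\<^sup>2 dvd c"
  shows "sieve_weight c (local_weight c p) (local_mean c p) p"
proof -
  have p2: "p \<ge> 2" using prime_ge_2_nat[OF p(1)] .
  have rp: "real p \<ge> 2" using p2 by simp
  have psq: "(real p)\<^sup>2 \<ge> 4" using power_mono[OF rp, of 2] by simp
  let ?r = "\<lambda>j. if int p dvd c \<or> p dvd j then 1 / (real p)\<^sup>2 else 1 / (real p) ^ 4"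
  have kpos: "local_mean c p > 0" using psq rp by (auto simp: local_mean_def divide_less_eq_1)
  have v0: "local_weight c p 0 = of_real (local_mean c p)"
    using odd by (auto simp: local_weight_def local_mean_def)
  have div: "int p dvd c \<longrightarrow> \<not> (int p)\<^sup>2 dvd c \<and> (\<forall>j\<in>{2..<p\<^sup>2}. local_weight c p j = 0)"
  proof (cases "p = 2")
    case True
    then show ?thesis using odd by simp
  next
    case False
    then show ?thesis using sq by (auto simp: local_weight_def)
  qed
  have "(\<Sum>j\<in>{1..<p\<^sup>2}. norm (local_weight c p j) * ?r j) \<le> local_mean c p / (real p)\<^sup>2"
  proof -
    consider "p = 2" | "p \<noteq> 2" "int p dvd c" | "p \<noteq> 2" "\<not> int p dvd c" by blast
    then show ?thesis
    proof cases
      case 1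
      have "{1..<2\<^sup>2} = {1, 2, 3 :: nat}" by auto
      then show ?thesis using 1 odd by (simp add: local_weight_def local_mean_def)
    next
      case 2
      have "2 * 2 \<le> p * p" using p2 by (intro mult_mono) auto
      then have "Suc 0 < p * p" by simp
      then have "(\<Sum>j\<in>{1..<p\<^sup>2}. norm (local_weight c p j) * ?r j) = (\<Sum>j\<in>{1}. norm (local_weight c p j) * ?r j)"
        using 2 p2 by (intro sum.mono_neutral_right) (auto simp: local_weight_def power2_eq_square)
      then show ?thesis using 2 by (simp add: local_weight_def local_mean_def)
    next
      case 3
      have "norm (local_weight c p j) * ?r j \<le> 1 / (real p)\<^sup>2 * (if p dvd j then 1 / (real p)\<^sup>2 else 0) + 1 / (real p) ^ 6"
        if "j \<in> {1..<p\<^sup>2}" for j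
      proof -
        have "norm (local_weight c p j) = 1 / (real p)\<^sup>2" using 3 that by (simp add: local_weight_def norm_divide norm_power)
        moreover have "1 / (real p)\<^sup>2 * (1 / (real p) ^ 4) = 1 / (real p) ^ 6" by (simp flip: power_add)
        ultimately show ?thesis using 3 by simp
      qed
      then have "(\<Sum>j\<in>{1..<p\<^sup>2}. norm (local_weight c p j) * ?r j)
          \<le> (\<Sum>j\<in>{1..<p\<^sup>2}. 1 / (real p)\<^sup>2 * (if p dvd j then 1 / (real p)\<^sup>2 else 0) + 1 / (real p) ^ 6)"
        by (rule sum_mono)
      also have "\<dots> = 1 / (real p)\<^sup>2 * (1 / (real p)\<^sup>2 * real (card {j \<in> {1..<p\<^sup>2}. p dvd j})) + real (p\<^sup>2 - 1) * (1 / (real p) ^ 6)"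
      proof -
        have "(\<Sum>j\<in>{1..<p\<^sup>2}. if p dvd j then x else 0) = x * real (card {j \<in> {1..<p\<^sup>2}. p dvd j})" for x :: real
          by (subst sum.inter_filter[symmetric]) auto
        moreover have "(\<Sum>j\<in>{1..<p\<^sup>2}. x) = real (p\<^sup>2 - 1) * x" for x :: real by simp
        ultimately show ?thesis by (simp only: sum.distrib sum_distrib_left[symmetric])
      qed
      also have "\<dots> \<le> 1 / (real p)\<^sup>2 * (1 / (real p)\<^sup>2 * real p) + (real p)\<^sup>2 * (1 / (real p) ^ 6)"
      proof (intro add_mono mult_left_mono mult_right_mono)
        have "{j \<in> {1..<p\<^sup>2}. p dvd j} \<subseteq> (\<lambda>i. p * i) ` {..<p}"
          by (auto simp: power2_eq_square elim!: dvdE)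
        then have "card {j \<in> {1..<p\<^sup>2}. p dvd j} \<le> card ((\<lambda>i. p * i) ` {..<p})" by (intro card_mono) auto
        also have "\<dots> \<le> card {..<p}" by (intro card_image_le) auto
        finally show "real (card {j \<in> {1..<p\<^sup>2}. p dvd j}) \<le> real p" by simp
        have "real (p\<^sup>2 - 1) \<le> real (p\<^sup>2)" by (intro of_nat_mono) simp
        then show "real (p\<^sup>2 - 1) \<le> (real p)\<^sup>2" by simp
      qed auto
      also have "\<dots> = (1 / real p + 1 / (real p)\<^sup>2) / (real p)\<^sup>2"
      proof -
        have "1 / x\<^sup>2 * (1 / x\<^sup>2 * x) + x\<^sup>2 * (1 / x ^ 6) = (1 / x + 1 / x\<^sup>2) / x\<^sup>2" if "x > 0" for x :: real
          using that by (simp add: field_simps eval_nat_numeral)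
        from this[of "real p"] show ?thesis using rp by simp
      qed
      also have "\<dots> \<le> (1 - 1 / (real p)\<^sup>2) / (real p)\<^sup>2"
      proof (rule divide_right_mono)
        \<comment> \<open>The two numerical bounds just suffice: 1/2 + 1/4 = 1 - 1/4.\<close>
        have "1 / real p \<le> 1 / 2" using rp by (intro divide_left_mono) auto
        moreover have "1 / (real p)\<^sup>2 \<le> 1 / 4" using psq rp by (intro divide_left_mono) auto
        ultimately show "1 / real p + 1 / (real p)\<^sup>2 \<le> 1 - 1 / (real p)\<^sup>2" by linarith
      qed simp
      finally show ?thesis using 3 by (simp add: local_mean_def)
    qed
  qed
  then show ?thesis unfolding sieve_weight_def using p kpos v0 div by blast
qed

section \<open>The lower bound for the sieved support\<close>

text \<open>At primes dividing \<open>M\<close> the sieving is already done by the vanishing of the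
  coefficients.\<close>

definition sieve_primes :: "nat \<Rightarrow> nat list" where
  "sieve_primes D = filter (\<lambda>p. prime p \<and> \<not> p dvd M) [2..<Suc D]"

lemma set_sieve_primes: "set (sieve_primes D) = {p. prime p \<and> \<not> p dvd M \<and> p \<le> D}"
  by (auto simp: sieve_primes_def dest: prime_ge_2_nat)

lemma distinct_sieve_primes: "distinct (sieve_primes D)"
  by (simp add: sieve_primes_def)

lemma norm_sieve_le:
  assumes c: "c > 0"
  shows "norm (\<Prod>p\<leftarrow>sieve_primes D. weight (local_weight c p) p n) \<le> 2 ^ nat (2 * c)"
proof -
  let ?A = "set (sieve_primes D)"
  have "norm (\<Prod>p\<leftarrow>sieve_primes D. weight (local_weight c p) p n) = (\<Prod>p\<in>?A. norm (weight (local_weight c p) p n))"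
    by (simp add: prod.distinct_set_conv_list[OF distinct_sieve_primes, symmetric] prod_norm)
  also have "\<dots> \<le> (\<Prod>p\<in>?A. if int p dvd 2 * c then 2 else 1)"
    by (intro prod_mono conjI norm_ge_zero norm_weight_le) (simp add: set_sieve_primes)
  also have "\<dots> = 2 ^ card (?A \<inter> {p. int p dvd 2 * c})"
    by (simp add: prod.If_cases)
  also have "\<dots> \<le> 2 ^ nat (2 * c)"
  proof (rule power_increasing)
    have "?A \<inter> {p. int p dvd 2 * c} \<subseteq> {1..nat (2 * c)}"
    proof
      fix p assume p: "p \<in> ?A \<inter> {p. int p dvd 2 * c}"
      then have "int p \<le> 2 * c" using c by (intro zdvd_imp_le) auto
      moreover have "p \<ge> 1" using p prime_ge_1_nat by (auto simp: set_sieve_primes)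
      ultimately show "p \<in> {1..nat (2 * c)}" by auto
    qed
    then have "card (?A \<inter> {p. int p dvd 2 * c}) \<le> card {1..nat (2 * c)}" by (intro card_mono) auto
    then show "card (?A \<inter> {p. int p dvd 2 * c}) \<le> nat (2 * c)" by simp
  qed simp
  finally show ?thesis .
qed

text \<open>A surviving n is coprime to \<open>M\<close>, and the weights at p <= D rule out even n
  and squares of odd primes; so a square factor can only come from a prime beyond \<open>D\<close>.
  The condition D >= 2 puts the prime 2 in range.\<close>

lemma sieve_support:
  assumes vanish: "\<And>n. gcd n M > 1 \<Longrightarrow> a n = 0" and D: "D \<ge> 2"
    and nz: "a n \<noteq> 0" "(\<Prod>p\<leftarrow>sieve_primes D. weight (local_weight c p) p n) \<noteq> 0"
  shows "n \<in> {n. odd n \<and> squarefree n \<and> a n \<noteq> 0} \<or> (n > 0 \<and> (\<exists>p>D. p\<^sup>2 dvd n))"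
proof -
  have "gcd n M > 0" using M by (simp add: gcd_pos_nat)
  then have cop: "gcd n M = 1" using vanish[of n] nz(1) by linarith
  have wnz: "weight (local_weight c p) p n \<noteq> 0" if "prime p" "\<not> p dvd M" "p \<le> D" for p
    using nz(2) that by (auto simp: prod_list_zero_iff set_sieve_primes)
  have not_M: "\<not> p dvd M" if "prime p" "p dvd n" for p
  proof
    assume "p dvd M"
    then have "p dvd gcd n M" using that by simp
    then show False using cop that by auto
  qed
  have odd: "odd n"
  proof
    assume ev: "even n"
    then have "weight (local_weight c 2) 2 n = 0" by (intro weight_vanishes) auto
    then show False using wnz[of 2] not_M[of 2] ev D by simp
  qed
  then have n0: "n > 0" by (cases n) auto
  show ?thesis
  proof (cases "squarefree n")
    case True
    then show ?thesis using odd nz(1) by simp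
  next
    case False
    then obtain p where p: "prime p" "p\<^sup>2 dvd n" using n0 by (auto simp: squarefree_factorial_semiring)
    have pn: "p dvd n" using p(2) by (meson dvd_power dvd_trans pos2)
    have "weight (local_weight c p) p n = 0" using p odd pn by (intro weight_vanishes) auto
    then have "\<not> p \<le> D" using wnz[OF p(1) not_M[OF p(1) pn]] by blast
    then show ?thesis using p(2) n0 by (auto simp: not_le)
  qed
qed

text \<open>Cauchy--Schwarz in the form \<open>|a| \<le> \<mu> / 2 * |a|\<^sup>2 + 1 / (2 * \<mu>)\<close>, so that \<open>\<mu>\<close> can be chosen
  at the end.\<close>

lemma norm_sieved_le:
  fixes \<tau> :: complex and c :: int and C \<eta> \<mu> :: real
  defines "\<eta> \<equiv> Im \<tau>" and "t \<equiv> 2 * pi * Im \<tau> / real M"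
  assumes vanish: "\<And>n. gcd n M > 1 \<Longrightarrow> a n = 0" and D: "D \<ge> 2" and c: "c > 0"
    and C: "\<And>\<eta> K. 0 < \<eta> \<Longrightarrow> \<eta> \<le> 1 \<Longrightarrow> (\<Sum>n<K. (norm (a n))\<^sup>2 * exp (- 4 * pi * real n * \<eta> / real M)) \<le> C * \<eta> powr (1 - 2 * \<kappa>)"
    and \<tau>: "Im \<tau> > 0" "Im \<tau> \<le> 1" and \<mu>: "\<mu> > 0"
  shows "norm (sieved (local_weight c) (sieve_primes D) \<tau>) \<le> 2 ^ nat (2 * c) *
     (\<mu> / 2 * (C * (\<eta> / 2) powr (1 - 2 * \<kappa>)) + 1 / (2 * \<mu>) *
       ((\<Sum>n. if n \<in> {n. odd n \<and> squarefree n \<and> a n \<noteq> 0} then exp (- real n * t) else 0) + 1 / (real D * t)))"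
proof -
  let ?S = "{n. odd n \<and> squarefree n \<and> a n \<noteq> 0}"
  let ?E = "{n. n > 0 \<and> (\<exists>p>D. p\<^sup>2 dvd n)}"
  let ?W = "\<lambda>n. \<Prod>p\<leftarrow>sieve_primes D. weight (local_weight c p) p n"
  let ?L = "2 ^ nat (2 * c) :: real"
  let ?g = "\<lambda>n. a n * ?W n * exp (2 * of_real pi * \<i> * of_nat n * \<tau> / of_nat M)"
  have t: "t > 0" using \<tau> M by (simp add: t_def)
  have e_t: "exp (- 2 * pi * real n * Im \<tau> / real M) = exp (- real n * t)" for n by (simp add: t_def)
  have term_le: "norm (?g n) \<le> ?L * (\<mu> / 2 * ((norm (a n))\<^sup>2 * exp (- real n * t)) + 1 / (2 * \<mu>) *
      ((if n \<in> ?S then exp (- real n * t) else 0) + (if n \<in> ?E then exp (- real n * t) else 0)))" for n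
  proof (cases "a n = 0 \<or> ?W n = 0")
    case True
    then have "norm (?g n) = 0" by auto
    also have "0 \<le> ?L * (\<mu> / 2 * ((norm (a n))\<^sup>2 * exp (- real n * t)) + 1 / (2 * \<mu>) *
      ((if n \<in> ?S then exp (- real n * t) else 0) + (if n \<in> ?E then exp (- real n * t) else 0)))"
      using \<mu> by (intro mult_nonneg_nonneg add_nonneg_nonneg) auto
    finally show ?thesis .
  next
    case False
    then have "n \<in> ?S \<or> n \<in> ?E" using sieve_support[OF vanish D, of n c] by blast
    then have ind: "exp (- real n * t) \<le> (if n \<in> ?S then exp (- real n * t) else 0) + (if n \<in> ?E then exp (- real n * t) else 0)"
      by (elim disjE) (simp_all del: mem_Collect_eq)
    have amgm: "norm (a n) \<le> \<mu> / 2 * (norm (a n))\<^sup>2 + 1 / (2 * \<mu>)"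
    proof -
      have "0 \<le> (\<mu> * norm (a n) - 1)\<^sup>2 / (2 * \<mu>)" using \<mu> by simp
      also have "\<dots> = \<mu> / 2 * (norm (a n))\<^sup>2 + 1 / (2 * \<mu>) - norm (a n)"
        using \<mu> by (simp add: field_simps power2_eq_square)
      finally show ?thesis by simp
    qed
    have "norm (?g n) = norm (?W n) * (norm (a n) * exp (- real n * t))"
      unfolding norm_mult norm_exp_term e_t by (simp only: mult_ac)
    also have "\<dots> \<le> ?L * ((\<mu> / 2 * (norm (a n))\<^sup>2 + 1 / (2 * \<mu>)) * exp (- real n * t))"
      using amgm by (intro mult_mono norm_sieve_le[OF c] mult_right_mono) auto
    also have "\<dots> = ?L * (\<mu> / 2 * ((norm (a n))\<^sup>2 * exp (- real n * t)) + 1 / (2 * \<mu>) * exp (- real n * t))"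
      by (simp only: distrib_right mult.assoc)
    also have "\<dots> \<le> ?L * (\<mu> / 2 * ((norm (a n))\<^sup>2 * exp (- real n * t)) + 1 / (2 * \<mu>) *
      ((if n \<in> ?S then exp (- real n * t) else 0) + (if n \<in> ?E then exp (- real n * t) else 0)))"
      using \<mu> ind by (intro mult_left_mono add_left_mono) auto
    finally show ?thesis .
  qed
  have partial: "norm (\<Sum>n<K. ?g n) \<le> ?L * (\<mu> / 2 * (C * (\<eta> / 2) powr (1 - 2 * \<kappa>)) + 1 / (2 * \<mu>) *
       ((\<Sum>n. if n \<in> ?S then exp (- real n * t) else 0) + 1 / (real D * t)))" for K
  proof -
    have "norm (\<Sum>n<K. ?g n) \<le> (\<Sum>n<K. ?L * (\<mu> / 2 * ((norm (a n))\<^sup>2 * exp (- real n * t)) + 1 / (2 * \<mu>) *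
      ((if n \<in> ?S then exp (- real n * t) else 0) + (if n \<in> ?E then exp (- real n * t) else 0))))"
      using term_le by (rule sum_norm_le)
    also have "\<dots> = ?L * (\<mu> / 2 * (\<Sum>n<K. (norm (a n))\<^sup>2 * exp (- real n * t)) + 1 / (2 * \<mu>) *
      ((\<Sum>n<K. if n \<in> ?S then exp (- real n * t) else 0) + (\<Sum>n<K. if n \<in> ?E then exp (- real n * t) else 0)))"
      by (simp only: sum_distrib_left[symmetric] sum.distrib)
    also have "\<dots> \<le> ?L * (\<mu> / 2 * (C * (\<eta> / 2) powr (1 - 2 * \<kappa>)) + 1 / (2 * \<mu>) *
       ((\<Sum>n. if n \<in> ?S then exp (- real n * t) else 0) + 1 / (real D * t)))"
    proof (intro mult_left_mono add_mono)
      \<comment> \<open>The inequality between |a| and |a|^2 leaves only one exponential factor with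
        |a|^2, so the second moment is taken at half the height.\<close>
      have "(\<Sum>n<K. (norm (a n))\<^sup>2 * exp (- real n * t)) = (\<Sum>n<K. (norm (a n))\<^sup>2 * exp (- 4 * pi * real n * (\<eta> / 2) / real M))"
        by (intro sum.cong refl) (simp add: t_def \<eta>_def field_simps)
      also have "\<dots> \<le> C * (\<eta> / 2) powr (1 - 2 * \<kappa>)" using \<tau> by (intro C) (auto simp: \<eta>_def)
      finally show "(\<Sum>n<K. (norm (a n))\<^sup>2 * exp (- real n * t)) \<le> C * (\<eta> / 2) powr (1 - 2 * \<kappa>)" .
      show "(\<Sum>n<K. if n \<in> ?S then exp (- real n * t) else 0) \<le> (\<Sum>n. if n \<in> ?S then exp (- real n * t) else 0)"
        by (intro sum_le_suminf summable_exp_indicator t) auto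
      have "(\<Sum>n<K. if n \<in> ?E then exp (- real n * t) else 0) = (\<Sum>n | n < K \<and> n > 0 \<and> (\<exists>p>D. p\<^sup>2 dvd n). exp (- real n * t))"
        by (subst sum.inter_filter[symmetric]) (auto intro!: sum.cong)
      also have "\<dots> \<le> 1 / (real D * t)" using D t by (intro exp_sum_square_multiples_le) auto
      finally show "(\<Sum>n<K. if n \<in> ?E then exp (- real n * t) else 0) \<le> 1 / (real D * t)" .
    qed (use \<mu> in auto)
    finally show ?thesis .
  qed
  have "(\<lambda>K. \<Sum>n<K. ?g n) \<longlonglongrightarrow> sieved (local_weight c) (sieve_primes D) \<tau>"
    using sieved_sums[OF \<tau>(1), where ps = "sieve_primes D" and u = "local_weight c"] unfolding sums_def by simp
  then have "(\<lambda>K. norm (\<Sum>n<K. ?g n)) \<longlonglongrightarrow> norm (sieved (local_weight c) (sieve_primes D) \<tau>)"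
    by (rule tendsto_norm)
  then show ?thesis using partial by (intro LIMSEQ_le_const2) auto
qed


lemma prod_list_positive:
  fixes xs :: "real list"
  shows "\<forall>x\<in>set xs. x > 0 \<Longrightarrow> prod_list xs > 0"
  by (induction xs) auto

lemma sieve_constants:
  fixes c :: int
  shows "(\<Prod>p\<leftarrow>sieve_primes D. local_mean c p) \<ge> 1 / 2"
    and "(\<Prod>p\<leftarrow>sieve_primes D. 1 + 1 / (real p)\<^sup>2) \<le> 5 / 3"
proof -
  let ?A = "set (sieve_primes D)"
  have pr: "prime p" if "p \<in> ?A" for p using that by (simp add: set_sieve_primes)
  have nonneg: "0 \<le> 1 - 1 / (real p)\<^sup>2" if "p \<in> ?A" for p
  proof -
    have "1 \<le> (real p)\<^sup>2" using prime_ge_1_nat[OF pr[OF that]] by simp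
    then have "1 / (real p)\<^sup>2 \<le> 1" by (subst divide_le_eq_1_pos) linarith+
    then show ?thesis by simp
  qed
  have "1 / 2 \<le> (\<Prod>p\<in>?A. 1 - 1 / (real p)\<^sup>2)"
    using pr prime_ge_2_nat by (intro prod_one_minus_inverse_squares_ge) auto
  also have "\<dots> \<le> (\<Prod>p\<in>?A. local_mean c p)"
    using nonneg by (intro prod_mono) (auto simp: local_mean_def)
  finally show "(\<Prod>p\<leftarrow>sieve_primes D. local_mean c p) \<ge> 1 / 2"
    by (simp only: prod.distinct_set_conv_list[OF distinct_sieve_primes])
  have "(\<Prod>p\<in>?A. 1 + 1 / (real p)\<^sup>2) \<le> 5 / 3"
    using pr by (intro prod_one_plus_inverse_squares_primes_le) auto
  then show "(\<Prod>p\<leftarrow>sieve_primes D. 1 + 1 / (real p)\<^sup>2) \<le> 5 / 3"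
    by (simp only: prod.distinct_set_conv_list[OF distinct_sieve_primes])
qed

text \<open>In units of the main term there remains k (9/10 - (E - 1) 11/10) with k >= 1/2 and E <=
  5/3, hence at least 1/2 * 1/6 = 1/12. The lower bound on Im z provides the reserve of height
  demanded by \<open>near_cusp\<close>.\<close>

lemma norm_sieved_ge:
  fixes p q c s :: int and \<tau> :: complex and \<Phi> T0 y :: real
  assumes \<Phi>: "\<Phi> > 0" and T0: "\<And>\<gamma> z. \<gamma> \<in> SL2Z \<Longrightarrow> Im z \<ge> T0 \<Longrightarrow> nslash \<gamma> z \<le> 11 / 10 * \<Phi>"
    and \<gamma>: "(p, q, c, s) \<in> SL2Z" and c: "c > 0" "odd M \<Longrightarrow> odd c"
    and sqf: "\<And>r. prime r \<Longrightarrow> odd r \<Longrightarrow> \<not> r dvd M \<Longrightarrow> \<not> (int r)\<^sup>2 dvd c"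
    and z: "Im z > 0" "T0 * (\<Prod>p\<leftarrow>sieve_primes D. (real p)\<^sup>2)\<^sup>2 \<le> Im z"
      "nslash (p, q, c, s) z > 9 / 10 * \<Phi>"
  shows "norm (sieved (local_weight c) (sieve_primes D) (moebius (p, q, c, s) z))
     \<ge> \<Phi> / 12 * norm (cocycle (p, q, c, s) z) powr \<kappa>"
proof -
  let ?ps = "sieve_primes D" and ?u = "local_weight c"
  let ?P = "\<Prod>p\<leftarrow>?ps. (real p)\<^sup>2" and ?k = "\<Prod>p\<leftarrow>?ps. local_mean c p" and ?E = "\<Prod>p\<leftarrow>?ps. 1 + 1 / (real p)\<^sup>2"
  define \<tau> where "\<tau> = moebius (p, q, c, s) z"
  define \<xi> where "\<xi> = \<tau> - of_int p / of_int c"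
  define N where "N = norm (of_int c * \<tau> - of_int p)"
  have \<tau>: "Im \<tau> > 0" unfolding \<tau>_def by (rule moebius_upper_half_plane[OF \<gamma> z(1)])
  have inv: "moebius (mat_inv (p, q, c, s)) \<tau> = z" unfolding \<tau>_def by (rule moebius_inv(2)[OF \<gamma> z(1)])
  note via = norm_f_via_cusp[OF \<gamma> \<tau>, unfolded inv, folded N_def]
  have \<tau>\<xi>: "\<tau> = of_int p / of_int c + \<xi>" by (simp add: \<xi>_def)
  have Im\<xi>: "Im \<xi> = Im \<tau>"
  proof -
    have "of_int p / of_int c = complex_of_real (of_int p / of_int c)" by simp
    then show ?thesis unfolding \<xi>_def by (simp only: minus_complex.simps Im_complex_of_real)
  qed
  have "of_int c * \<xi> = of_int c * \<tau> - of_int p" using c(1) by (simp add: \<xi>_def field_simps)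
  then have "norm (of_int c * \<xi>) = N" by (simp only: N_def)
  then have N: "N = norm \<xi> * of_int c" using c(1) by (simp add: norm_mult mult.commute)
  have NV: "norm \<xi> powr (- \<kappa>) * (11 / 10 * \<Phi>) * of_int c powr (- \<kappa>) = N powr (- \<kappa>) * (11 / 10 * \<Phi>)"
    unfolding N using c(1) by (simp add: powr_mult)
  have P: "?P > 0"
  proof -
    have "\<forall>x\<in>set (map (\<lambda>p. (real p)\<^sup>2) ?ps). x > 0" using prime_gt_0_nat by (auto simp: set_sieve_primes)
    then show ?thesis using prod_list_positive[of "map (\<lambda>p. (real p)\<^sup>2) ?ps"] by blast
  qed
  have \<Psi>: "0 \<le> 11 / 10 * \<Phi>" using \<Phi> by simp
  have \<xi>pos: "Im \<xi> > 0" using Im\<xi> \<tau> by simp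
  have sw: "sieve_weight c (?u r) (local_mean c r) r" if "r \<in> set ?ps" for r
  proof (rule sieve_weight_local_weight)
    show r: "prime r" "\<not> r dvd M" using that by (auto simp: set_sieve_primes)
    show "r = 2 \<Longrightarrow> odd c" using r c(2) by auto
    show "r \<noteq> 2 \<Longrightarrow> \<not> (int r)\<^sup>2 dvd c"
      using sqf[OF r(1) _ r(2)] primes_dvd_imp_eq[OF two_is_prime_nat r(1)] by auto
  qed
  have nc: "near_cusp \<xi> c T0 ?ps c"
    unfolding near_cusp_def
  proof (intro conjI ballI c(1))
    have "Im \<xi> / (norm \<xi> * (of_int c * ?P))\<^sup>2 = Im z / ?P\<^sup>2"
      unfolding via(2) Im\<xi> N by (simp add: power_mult_distrib)
    moreover have "T0 \<le> Im z / ?P\<^sup>2" using z(2) P by (simp add: pos_le_divide_eq)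
    ultimately show "T0 \<le> Im \<xi> / (norm \<xi> * (of_int c * ?P))\<^sup>2" by simp
    fix r assume "r \<in> set ?ps"
    then show "int r dvd c \<longrightarrow> \<not> (int r)\<^sup>2 dvd c" using sw by (simp add: sieve_weight_def)
  qed simp
  have "gcd p c dvd p * s - q * c"
    by (intro dvd_diff dvd_mult2[OF gcd_dvd1] dvd_mult[OF gcd_dvd2])
  then have "is_unit (gcd p c)" using \<gamma> by (simp only: SL2Z_iff)
  then have cop: "coprime p c" by (simp only: is_unit_gcd)
  \<comment> \<open>The modulus of the cocycle at \<open>z\<close> is 1 / N; it is recovered by
    composing the formulas for Im tau and Im z.\<close>
  have cocN: "norm (cocycle (p, q, c, s) z) powr \<kappa> = N powr (- \<kappa>)"
  proof -
    have im: "Im \<tau> = Im z / (norm (cocycle (p, q, c, s) z))\<^sup>2" unfolding \<tau>_def by (rule Im_moebius[OF \<gamma> z(1)])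
    have cpos: "norm (cocycle (p, q, c, s) z) > 0" using cocycle_nonzero[OF \<gamma> z(1)] by simp
    have "Im z = Im z / (norm (cocycle (p, q, c, s) z))\<^sup>2 / N\<^sup>2" using via(2) unfolding im .
    also have "\<dots> = Im z / (norm (cocycle (p, q, c, s) z) * N)\<^sup>2" by (simp only: power_mult_distrib divide_divide_eq_left)
    finally have "Im z = Im z / (norm (cocycle (p, q, c, s) z) * N)\<^sup>2" .
    moreover have "w = 1" if "x = x / w" "x > 0" "w > 0" for x w :: real
      using that by (simp add: field_simps)
    moreover have "(norm (cocycle (p, q, c, s) z) * N)\<^sup>2 > 0" using cpos via(4) by simp
    ultimately have "(norm (cocycle (p, q, c, s) z) * N)\<^sup>2 = 1\<^sup>2" using z(1) unfolding one_power2 by blast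
    then have "norm (cocycle (p, q, c, s) z) * N = 1"
      by (rule power2_eq_imp_eq) (use cpos via(4) in \<open>simp_all add: less_imp_le\<close>)
    then have "norm (cocycle (p, q, c, s) z) = inverse N" using via(4) by (simp add: field_simps)
    then show ?thesis using via(4) by (simp add: inverse_powr powr_minus)
  qed
  have main: "norm (sieved ?u ?ps \<tau> - of_real ?k * f \<tau>) \<le> ?k * (?E - 1) * (N powr (- \<kappa>) * (11 / 10 * \<Phi>))"
  proof -
    have "norm (sieved ?u ?ps (of_int p / of_int c + \<xi>) - of_real ?k * f (of_int p / of_int c + \<xi>))
      \<le> ?k * (?E - 1) * (norm \<xi> powr (- \<kappa>) * (11 / 10 * \<Phi>)) * of_int c powr (- \<kappa>)"
      by (rule sieved_main_term[OF \<xi>pos \<Psi> T0 distinct_sieve_primes sw nc cop])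
    then show ?thesis unfolding \<tau>\<xi> NV[symmetric] by (simp only: mult.assoc)
  qed
  have k: "?k \<ge> 1 / 2" and E: "?E \<le> 5 / 3" using sieve_constants by auto
  have Nk: "N powr (- \<kappa>) > 0" using via(4) by simp
  have fl: "norm (f \<tau>) \<ge> N powr (- \<kappa>) * (9 / 10 * \<Phi>)"
    unfolding via(1) using z(3) by (intro mult_left_mono) auto
  have "norm (of_real ?k * f \<tau>) - norm (sieved ?u ?ps \<tau>) \<le> norm (of_real ?k * f \<tau> - sieved ?u ?ps \<tau>)"
    by (rule norm_triangle_ineq2)
  then have "norm (sieved ?u ?ps \<tau>) \<ge> ?k * norm (f \<tau>) - norm (sieved ?u ?ps \<tau> - of_real ?k * f \<tau>)"
    using k by (simp add: norm_mult norm_minus_commute)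
  moreover have "?k * norm (f \<tau>) \<ge> ?k * (N powr (- \<kappa>) * (9 / 10 * \<Phi>))" using k fl by (intro mult_left_mono) auto
  ultimately have "norm (sieved ?u ?ps \<tau>) \<ge> ?k * (N powr (- \<kappa>) * (9 / 10 * \<Phi>)) - ?k * (?E - 1) * (N powr (- \<kappa>) * (11 / 10 * \<Phi>))"
    using main by linarith
  also have "?k * (N powr (- \<kappa>) * (9 / 10 * \<Phi>)) - ?k * (?E - 1) * (N powr (- \<kappa>) * (11 / 10 * \<Phi>))
      = (N powr (- \<kappa>) * \<Phi>) * (?k * (9 / 10 - (?E - 1) * (11 / 10)))"
    by (simp add: algebra_simps)
  finally have "norm (sieved ?u ?ps \<tau>) \<ge> (N powr (- \<kappa>) * \<Phi>) * (?k * (9 / 10 - (?E - 1) * (11 / 10)))" .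
  moreover have "(N powr (- \<kappa>) * \<Phi>) * (?k * (9 / 10 - (?E - 1) * (11 / 10))) \<ge> (N powr (- \<kappa>) * \<Phi>) * (1 / 2 * (1 / 6))"
  proof -
    have "1 / 6 \<le> 9 / 10 - (e - 1) * (11 / 10)" if "e \<le> 5 / 3" for e :: real
      using that by (simp add: field_simps)
    from this[OF E] show ?thesis using k Nk \<Phi> by (intro mult_left_mono mult_mono) auto
  qed
  moreover have "(N powr (- \<kappa>) * \<Phi>) * (1 / 2 * (1 / 6)) = \<Phi> / 12 * N powr (- \<kappa>)" by simp
  ultimately have "\<Phi> / 12 * N powr (- \<kappa>) \<le> norm (sieved ?u ?ps \<tau>)" by linarith
  then show ?thesis unfolding \<tau>_def cocN .
qed

text \<open>The order of choices is essential: the cusp and with it \<open>L\<close>,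
  \<open>c3\<close>, \<open>C'\<close>, \<open>c4\<close>; then \<open>D\<close> in terms of
  \<open>c4\<close>; then the height \<open>Y\<close> in terms of \<open>D\<close>. Restricting to
  small \<open>t\<close> absorbs \<open>Y\<close>.\<close>

theorem support_exp_sum_ge:
  assumes vanish: "\<And>n. gcd n M > 1 \<Longrightarrow> a n = 0"
    and noncusp: "\<gamma>1 \<in> SL2Z" "\<not> zero_at_i_infinity (slash \<kappa> f \<gamma>1)"
  shows "\<exists>d>0. \<exists>t0>0. \<forall>t. 0 < t \<longrightarrow> t < t0 \<longrightarrow>
     d / t \<le> (\<Sum>n. if n \<in> {n. odd n \<and> squarefree n \<and> a n \<noteq> 0} then exp (- real n * t) else 0)"
proof -
  let ?S = "{n. odd n \<and> squarefree n \<and> a n \<noteq> 0}"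
  let ?\<Sigma> = "\<lambda>t. \<Sum>n. if n \<in> ?S then exp (- real n * t) else 0"
  obtain \<Phi> T0 a0 c0 where \<Phi>: "\<Phi> > 0" "T0 > 0" "gcd a0 c0 = 1"
    and T0': "\<forall>\<gamma>\<in>SL2Z. \<forall>z. Im z \<ge> T0 \<longrightarrow> nslash \<gamma> z \<le> 11 / 10 * \<Phi>"
    and big': "\<forall>a b c d y. (a, b, c, d) \<in> SL2Z \<longrightarrow> [a = a0] (mod int M) \<longrightarrow> [c = c0] (mod int M) \<longrightarrow> y > 0 \<longrightarrow>
              (\<exists>x. 0 \<le> x \<and> x \<le> real M \<and> nslash (a, b, c, d) (Complex x y) > 9 / 10 * \<Phi>)"
    using maximal_cusp[OF noncusp] by (elim exE conjE) (rule that)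
  have T0: "\<And>\<gamma> z. \<gamma> \<in> SL2Z \<Longrightarrow> Im z \<ge> T0 \<Longrightarrow> nslash \<gamma> z \<le> 11 / 10 * \<Phi>"
    using T0' by simp
  have big: "\<And>a b c d y. (a, b, c, d) \<in> SL2Z \<Longrightarrow> [a = a0] (mod int M) \<Longrightarrow> [c = c0] (mod int M) \<Longrightarrow> y > 0 \<Longrightarrow>
              \<exists>x. 0 \<le> x \<and> x \<le> real M \<and> nslash (a, b, c, d) (Complex x y) > 9 / 10 * \<Phi>"
    using big' by simp
  obtain p c where c: "c > 0" "coprime p c" "[p = a0] (mod int M)" "[c = c0] (mod int M)" "odd M \<Longrightarrow> odd c"
    and sqf: "\<And>r. prime r \<Longrightarrow> odd r \<Longrightarrow> \<not> r dvd M \<Longrightarrow> \<not> (int r)\<^sup>2 dvd c"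
    using cusp_denominator_exists[of M a0 c0] M \<Phi>(3) by auto
  obtain q s where \<gamma>: "(p, q, c, s) \<in> SL2Z" using SL2Z_complete[OF c(2)] by blast
  obtain C where C: "C > 0" "\<And>\<eta> K. 0 < \<eta> \<Longrightarrow> \<eta> \<le> 1 \<Longrightarrow> (\<Sum>n<K. (norm (a n))\<^sup>2 * exp (- 4 * pi * real n * \<eta> / real M)) \<le> C * \<eta> powr (1 - 2 * \<kappa>)"
    using second_moment by blast
  define L where "L = (2 :: real) ^ nat (2 * c)"
  define c3 where "c3 = \<Phi> / 12 * (2 * of_int c) powr (- \<kappa>)"
  define C' where "C' = C * 2 powr (2 * \<kappa> - 1)"
  define c4 where "c4 = c3\<^sup>2 / (L\<^sup>2 * C')"
  have pos: "L > 0" "c3 > 0" "C' > 0" "c4 > 0" using \<Phi> c(1) C(1) by (auto simp: L_def c3_def C'_def c4_def)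
  \<comment> \<open>Makes the contribution 1 / (D t) of the undetected squares at most half of the
    main gain \<open>c4 / \<eta>\<close>.\<close>
  define D where "D = max 2 (nat \<lceil>real M / (pi * c4)\<rceil>)"
  have D: "D \<ge> 2" "real M / (pi * c4) \<le> real D" by (auto simp: D_def) linarith
  \<comment> \<open>The term with \<open>T0\<close> is the height required by
    \<open>norm_sieved_ge\<close>; y >= M + |s| makes the real part of c z + s at most c y in size,
    so that c y <= |c z + s| <= 2 c y.\<close>
  define Y where "Y = max 1 (max (T0 * (\<Prod>p\<leftarrow>sieve_primes D. (real p)\<^sup>2)\<^sup>2) (real M + \<bar>real_of_int s\<bar>))"
  \<comment> \<open>The abscissa \<open>x\<close> where \<open>nslash\<close> is large cannot be
    prescribed, so \<open>\<eta>\<close> is known only within a factor 4; monotonicity of the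
    exponential sum in \<open>t\<close> makes up for this at the end.\<close>
  have claim: "\<exists>\<eta>. 1 / (4 * (of_int c)\<^sup>2 * y) \<le> \<eta> \<and> \<eta> \<le> 1 / ((of_int c)\<^sup>2 * y) \<and> c4 / (2 * \<eta>) \<le> ?\<Sigma> (2 * pi * \<eta> / real M)"
    if y: "y \<ge> Y" for y
  proof -
    have y1: "y \<ge> 1" "T0 * (\<Prod>p\<leftarrow>sieve_primes D. (real p)\<^sup>2)\<^sup>2 \<le> y" "real M + \<bar>real_of_int s\<bar> \<le> y"
      using y by (auto simp: Y_def)
    obtain x where x: "0 \<le> x" "x \<le> real M" "nslash (p, q, c, s) (Complex x y) > 9 / 10 * \<Phi>"
      using big[OF \<gamma> c(3,4), of y] y1 by auto
    let ?z = "Complex x y"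
    define R where "R = norm (cocycle (p, q, c, s) ?z)"
    define \<tau> where "\<tau> = moebius (p, q, c, s) ?z"
    define \<eta> where "\<eta> = Im \<tau>"
    define t where "t = 2 * pi * \<eta> / real M"
    have c1: "real_of_int c \<ge> 1" using c(1) by simp
    have zpos: "Im ?z > 0" using y1 by simp
    have Rpos: "R > 0" using cocycle_nonzero[OF \<gamma> zpos] by (simp add: R_def)
    have \<eta>R: "\<eta> = y / R\<^sup>2" unfolding \<eta>_def \<tau>_def R_def using Im_moebius[OF \<gamma> zpos] by simp
    have R1: "of_int c * y \<le> R"
    proof -
      have "\<bar>Im (cocycle (p, q, c, s) ?z)\<bar> \<le> R" unfolding R_def by (rule abs_Im_le_cmod)
      then show ?thesis using c1 y1 by (simp add: abs_mult)
    qed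
    have R2: "R \<le> 2 * (of_int c * y)"
    proof -
      have "R \<le> \<bar>Re (cocycle (p, q, c, s) ?z)\<bar> + \<bar>Im (cocycle (p, q, c, s) ?z)\<bar>" unfolding R_def by (rule cmod_le)
      also have "\<bar>Im (cocycle (p, q, c, s) ?z)\<bar> = of_int c * y" using c1 y1 by (simp add: abs_mult)
      also have "\<bar>Re (cocycle (p, q, c, s) ?z)\<bar> \<le> of_int c * x + \<bar>of_int s\<bar>"
      proof -
        have "0 \<le> of_int c * x" using c1 x by simp
        moreover have "Re (cocycle (p, q, c, s) ?z) = of_int c * x + of_int s" by simp
        ultimately show ?thesis by linarith
      qed
      also have "of_int c * x + \<bar>of_int s\<bar> \<le> of_int c * real M + of_int c * \<bar>of_int s\<bar>"
        using c1 x mult_right_mono[OF c1, of "\<bar>of_int s\<bar>"] by (intro add_mono mult_left_mono) auto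
      also have "\<dots> \<le> of_int c * y" using c1 y1(3) by (simp add: mult_left_mono flip: distrib_left)
      finally show ?thesis by (simp add: mult_ac)
    qed
    have \<eta>pos: "\<eta> > 0" unfolding \<eta>R using Rpos y1 by simp
    have \<eta>1: "\<eta> \<le> 1 / ((of_int c)\<^sup>2 * y)"
    proof -
      have "(of_int c * y)\<^sup>2 \<le> R\<^sup>2" using R1 c1 y1 by (intro power_mono) auto
      then have "\<eta> \<le> y / (of_int c * y)\<^sup>2" unfolding \<eta>R using c1 y1 Rpos by (intro divide_left_mono) auto
      also have "\<dots> = 1 / ((of_int c)\<^sup>2 * y)" using y1 c1 by (simp add: power2_eq_square)
      finally show ?thesis .
    qed
    have \<eta>2: "1 / (4 * (of_int c)\<^sup>2 * y) \<le> \<eta>"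
    proof -
      have "R\<^sup>2 \<le> (2 * (of_int c * y))\<^sup>2" using R2 Rpos by (intro power_mono) auto
      then have "y / (2 * (of_int c * y))\<^sup>2 \<le> \<eta>" unfolding \<eta>R using c1 y1 Rpos by (intro divide_left_mono) auto
      moreover have "y / (2 * (of_int c * y))\<^sup>2 = 1 / (4 * (of_int c)\<^sup>2 * y)" using y1 c1 by (simp add: power2_eq_square)
      ultimately show ?thesis by simp
    qed
    have "1 * 1 \<le> (of_int c)\<^sup>2 * y" using c1 y1 by (intro mult_mono) auto
    then have "1 / ((of_int c)\<^sup>2 * y) \<le> 1" by simp
    then have \<eta>le1: "\<eta> \<le> 1" using \<eta>1 by linarith
    \<comment> \<open>Chosen so that the second-moment term is exactly half of the lower bound c3
      eta^(-kappa).\<close>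
    define \<mu> where "\<mu> = c3 * \<eta> powr (\<kappa> - 1) / (L * C')"
    have \<mu>: "\<mu> > 0" using pos \<eta>pos by (simp add: \<mu>_def)
    have low: "c3 * \<eta> powr (- \<kappa>) \<le> norm (sieved (local_weight c) (sieve_primes D) \<tau>)"
    proof -
      have "1 / (2 * of_int c * \<eta>) \<le> R"
      proof -
        have "R * R \<le> 2 * (of_int c * y) * R" using R2 Rpos by (intro mult_right_mono) auto
        then have "R\<^sup>2 \<le> (2 * of_int c * y) * R" by (simp add: power2_eq_square mult.assoc)
        then have "1 \<le> (2 * of_int c * y) * R / R\<^sup>2" using Rpos by simp
        also have "\<dots> = (2 * of_int c * \<eta>) * R" by (simp add: \<eta>R)
        finally show ?thesis using c1 \<eta>pos by (simp add: pos_divide_le_eq mult.commute)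
      qed
      then have "(1 / (2 * of_int c * \<eta>)) powr \<kappa> \<le> R powr \<kappa>" using c1 \<eta>pos kappa by (intro powr_mono2) auto
      moreover have "(1 / (2 * of_int c * \<eta>)) powr \<kappa> = (2 * of_int c) powr (- \<kappa>) * \<eta> powr (- \<kappa>)"
        using c1 \<eta>pos by (simp add: powr_divide powr_mult powr_minus field_simps)
      ultimately have "c3 * \<eta> powr (- \<kappa>) \<le> \<Phi> / 12 * R powr \<kappa>"
        unfolding c3_def mult.assoc using \<Phi>(1) by (intro mult_left_mono) auto
      also have "\<dots> \<le> norm (sieved (local_weight c) (sieve_primes D) \<tau>)"
        unfolding R_def \<tau>_def using zpos y1(2) x(3) by (intro norm_sieved_ge[OF \<Phi>(1) T0 \<gamma> c(1,5) sqf]) auto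
      finally show ?thesis .
    qed
    have "norm (sieved (local_weight c) (sieve_primes D) \<tau>) \<le> L *
       (\<mu> / 2 * (C * (\<eta> / 2) powr (1 - 2 * \<kappa>)) + 1 / (2 * \<mu>) * (?\<Sigma> t + 1 / (real D * t)))"
      unfolding L_def t_def \<eta>_def
      by (rule norm_sieved_le[OF vanish D(1) c(1) C(2) _ _ \<mu>]) (use \<eta>pos \<eta>le1 in \<open>auto simp: \<eta>_def\<close>)
    also have "C * (\<eta> / 2) powr (1 - 2 * \<kappa>) = C' * \<eta> powr (1 - 2 * \<kappa>)"
      using \<eta>pos powr_minus[of 2 "2 * \<kappa> - 1"] by (simp add: C'_def powr_divide field_simps)
    also have "L * (\<mu> / 2 * (C' * \<eta> powr (1 - 2 * \<kappa>)) + 1 / (2 * \<mu>) * (?\<Sigma> t + 1 / (real D * t)))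
        = c3 * \<eta> powr (- \<kappa>) / 2 + L / (2 * \<mu>) * (?\<Sigma> t + 1 / (real D * t))"
    proof -
      have "\<eta> powr (\<kappa> - 1) * \<eta> powr (1 - 2 * \<kappa>) = \<eta> powr (- \<kappa>)" by (simp flip: powr_add)
      then have "L * (\<mu> / 2 * (C' * \<eta> powr (1 - 2 * \<kappa>))) = c3 * \<eta> powr (- \<kappa>) / 2"
        using pos by (simp add: \<mu>_def mult.assoc)
      then show ?thesis by (simp add: distrib_left)
    qed
    finally have "c3 * \<eta> powr (- \<kappa>) / 2 \<le> L / (2 * \<mu>) * (?\<Sigma> t + 1 / (real D * t))" using low by linarith
    moreover have "A * \<mu> / L \<le> X" if "A / 2 \<le> L / (2 * \<mu>) * X" for A X
      using that pos \<mu> by (simp add: field_simps)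
    ultimately have "c3 * \<eta> powr (- \<kappa>) * \<mu> / L \<le> ?\<Sigma> t + 1 / (real D * t)" by blast
    moreover have "c3 * \<eta> powr (- \<kappa>) * \<mu> / L = c4 / \<eta>"
    proof -
      have "\<eta> powr (- \<kappa>) * \<eta> powr (\<kappa> - 1) = \<eta> powr (- 1)" by (simp flip: powr_add)
      also have "\<dots> = 1 / \<eta>" using \<eta>pos by (simp add: powr_minus field_simps)
      finally have "\<eta> powr (- \<kappa>) * \<eta> powr (\<kappa> - 1) = 1 / \<eta>" .
      moreover have "c3 * \<eta> powr (- \<kappa>) * \<mu> / L = c3\<^sup>2 / (L\<^sup>2 * C') * (\<eta> powr (- \<kappa>) * \<eta> powr (\<kappa> - 1))"
        by (simp add: \<mu>_def power2_eq_square mult_ac)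
      ultimately show ?thesis by (simp add: c4_def)
    qed
    moreover have "1 / (real D * t) \<le> c4 / (2 * \<eta>)"
    proof -
      have "real M \<le> real D * (pi * c4)" using D(2) pos by (simp add: pos_divide_le_eq)
      then have "real M / (2 * pi * \<eta> * real D) \<le> real D * (pi * c4) / (2 * pi * \<eta> * real D)"
        using \<eta>pos by (intro divide_right_mono) auto
      also have "\<dots> = c4 / (2 * \<eta>)" using D(1) \<eta>pos by simp
      finally show ?thesis by (simp add: t_def mult_ac)
    qed
    moreover have "c4 / \<eta> = c4 / (2 * \<eta>) + c4 / (2 * \<eta>)" by (simp add: field_simps)
    ultimately have "c4 / (2 * \<eta>) \<le> ?\<Sigma> t" by linarith
    then show ?thesis using \<eta>1 \<eta>2 unfolding t_def by blast
  qed
  define d where "d = pi * c4 / (4 * real M)"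
  define t0 where "t0 = pi / (2 * real M * (of_int c)\<^sup>2 * Y)"
  have Mpos: "real M > 0" using M by simp
  have Ypos: "Y \<ge> 1" by (simp add: Y_def)
  have cpos: "real_of_int c > 0" using c(1) by simp
  have mono: "?\<Sigma> t2 \<le> ?\<Sigma> t1" if "0 < t1" "t1 \<le> t2" for t1 t2
    using that by (intro suminf_le summable_exp_indicator) (auto simp: mult_left_mono)
  have "d / t \<le> ?\<Sigma> t" if t: "0 < t" "t < t0" for t
  proof -
    \<comment> \<open>This makes \<open>t\<close> the left end of the range of 2 pi eta / M; hence t
      <= 2 pi eta / M, and the sum at \<open>t\<close> is the larger one.\<close>
    define y where "y = pi / (2 * real M * (of_int c)\<^sup>2 * t)"
    have "y \<ge> Y"
    proof -
      have "t * (2 * real M * (of_int c)\<^sup>2 * Y) \<le> pi"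
        using t(2) Mpos cpos Ypos by (simp add: t0_def pos_less_divide_eq)
      then show ?thesis using t(1) Mpos cpos by (simp add: y_def pos_le_divide_eq mult_ac)
    qed
    then obtain \<eta> where \<eta>: "1 / (4 * (of_int c)\<^sup>2 * y) \<le> \<eta>" "\<eta> \<le> 1 / ((of_int c)\<^sup>2 * y)" "c4 / (2 * \<eta>) \<le> ?\<Sigma> (2 * pi * \<eta> / real M)"
      using claim by blast
    have y1: "1 / ((of_int c)\<^sup>2 * y) = 2 * real M * t / pi" "1 / (4 * (of_int c)\<^sup>2 * y) = real M * t / (2 * pi)"
      using Mpos cpos t(1) by (simp_all add: y_def)
    have \<eta>pos: "\<eta> > 0" using \<eta>(1) t(1) Mpos unfolding y1 by (meson divide_pos_pos less_le_trans mult_pos_pos pi_gt_zero zero_less_numeral)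
    have le: "t \<le> 2 * pi * \<eta> / real M" using \<eta>(1) Mpos unfolding y1 by (simp add: field_simps)
    have "d / t = c4 / (2 * (2 * real M * t / pi))" by (simp add: d_def mult_ac)
    also have "\<dots> \<le> c4 / (2 * \<eta>)" using \<eta>(2) \<eta>pos pos t(1) Mpos unfolding y1 by (intro divide_left_mono) auto
    also have "\<dots> \<le> ?\<Sigma> (2 * pi * \<eta> / real M)" by (rule \<eta>(3))
    also have "\<dots> \<le> ?\<Sigma> t" by (rule mono[OF t(1) le])
    finally show ?thesis .
  qed
  moreover have "d > 0" "t0 > 0" using pos Mpos cpos Ypos by (auto simp: d_def t0_def)
  ultimately show ?thesis by blast
qed

end

section \<open>Modular forms of integral and half-integral weight\<close>

lemma floor_two_kappa_pos: "\<kappa> \<ge> 2 \<Longrightarrow> \<lfloor>2 * \<kappa>\<rfloor> > 0"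
  for \<kappa> :: real
  by linarith

text \<open>Where \<open>theta\<close> vanishes, the automorphy factor is \<open>0 / 0 = 0\<close>, so both sides are 0 there; no
  knowledge of the zeros of \<open>theta\<close> is needed.\<close>

lemma modular_forms_half_integral:
  assumes \<kappa>: "2 * \<kappa> \<in> \<int>" "\<kappa> \<ge> 2" "\<kappa> \<notin> \<int>" and M: "4 dvd M"
    and f: "f \<in> modular_forms \<kappa> M" and \<gamma>: "\<gamma> \<in> principal_congruence_subgroup M" and \<tau>: "Im \<tau> > 0"
  shows "norm (f (moebius \<gamma> \<tau>)) = norm (cocycle \<gamma> \<tau>) powr \<kappa> * norm (f \<tau>)"
    and "theta \<tau> = 0 \<Longrightarrow> f (moebius \<gamma> \<tau>) = 0"
proof -
  have tr: "f (moebius \<gamma> \<tau>) = (theta (moebius \<gamma> \<tau>) / theta \<tau>) powi \<lfloor>2 * \<kappa>\<rfloor> * f \<tau>"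
    if "\<gamma> \<in> principal_congruence_subgroup M" for \<gamma>
    using f that \<tau> \<kappa>(3) by (auto simp: modular_forms_def automorphy_factor_def)
  have k: "\<lfloor>2 * \<kappa>\<rfloor> > 0" using \<kappa>(2) by (rule floor_two_kappa_pos)
  have zero: "f (moebius \<gamma> \<tau>) = 0" if "theta \<tau> = 0" "\<gamma> \<in> principal_congruence_subgroup M" for \<gamma>
    using tr[OF that(2)] that(1) k by simp
  then show "theta \<tau> = 0 \<Longrightarrow> f (moebius \<gamma> \<tau>) = 0" using \<gamma> by blast
  obtain a b c d where g: "\<gamma> = (a, b, c, d)" by (cases \<gamma>) auto
  have S: "(a, b, c, d) \<in> SL2Z" and c: "[c = 0] (mod int M)"
    using \<gamma> unfolding g principal_congruence_subgroup_def by auto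
  have "int M dvd c" using c by (simp add: cong_0_iff)
  then have "4 dvd c" using M by (metis dvd_trans of_nat_dvd_iff of_nat_numeral)
  then have th: "norm (theta (moebius \<gamma> \<tau>)) = sqrt (norm (cocycle \<gamma> \<tau>)) * norm (theta \<tau>)"
    using theta_modular_Gamma0_4[OF S] \<tau> unfolding theta_modular_def g by blast
  show "norm (f (moebius \<gamma> \<tau>)) = norm (cocycle \<gamma> \<tau>) powr \<kappa> * norm (f \<tau>)"
  proof (cases "theta \<tau> = 0")
    case True
    have "(1, 0, 0, 1) \<in> principal_congruence_subgroup M"
      by (simp add: principal_congruence_subgroup_def SL2Z_iff)
    from zero[OF True this] have "f \<tau> = 0" by simp
    then show ?thesis using zero[OF True \<gamma>] by simp
  next
    case False
    have cpos: "norm (cocycle \<gamma> \<tau>) > 0" using cocycle_nonzero[OF S \<tau>] by (simp add: g)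
    have "norm (theta (moebius \<gamma> \<tau>) / theta \<tau>) = sqrt (norm (cocycle \<gamma> \<tau>))"
      using False by (simp add: norm_divide th)
    then have "norm ((theta (moebius \<gamma> \<tau>) / theta \<tau>) powi \<lfloor>2 * \<kappa>\<rfloor>) = sqrt (norm (cocycle \<gamma> \<tau>)) powi \<lfloor>2 * \<kappa>\<rfloor>"
      by (simp only: norm_power_int)
    also have "\<dots> = sqrt (norm (cocycle \<gamma> \<tau>)) powr (of_int \<lfloor>2 * \<kappa>\<rfloor>)"
      using cpos by (simp add: powr_real_of_int')
    also have "of_int \<lfloor>2 * \<kappa>\<rfloor> = 2 * \<kappa>" using \<kappa>(1) by (metis Ints_cases floor_of_int)
    also have "sqrt (norm (cocycle \<gamma> \<tau>)) powr (2 * \<kappa>) = norm (cocycle \<gamma> \<tau>) powr \<kappa>"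
      using cpos by (simp add: powr_half_sqrt[symmetric] powr_powr)
    finally show ?thesis unfolding tr[OF \<gamma>] norm_mult by simp
  qed
qed

lemma modular_forms_transform:
  assumes \<kappa>: "2 * \<kappa> \<in> \<int>" "\<kappa> \<ge> 2" and M: "\<kappa> \<notin> \<int> \<Longrightarrow> 4 dvd M"
    and f: "f \<in> modular_forms \<kappa> M" and \<gamma>: "\<gamma> \<in> principal_congruence_subgroup M" and \<tau>: "Im \<tau> > 0"
  shows "norm (f (moebius \<gamma> \<tau>)) = norm (cocycle \<gamma> \<tau>) powr \<kappa> * norm (f \<tau>)"
proof (cases "\<kappa> \<in> \<int>")
  case True
  have cpos: "norm (cocycle \<gamma> \<tau>) > 0"
    using cocycle_nonzero[OF principal_congruence_subgroup_SL2Z[OF \<gamma>] \<tau>] by simp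
  have "f (moebius \<gamma> \<tau>) = cocycle \<gamma> \<tau> powi \<lfloor>\<kappa>\<rfloor> * f \<tau>"
    using f \<gamma> \<tau> True by (auto simp: modular_forms_def automorphy_factor_def)
  then have "norm (f (moebius \<gamma> \<tau>)) = norm (cocycle \<gamma> \<tau>) powi \<lfloor>\<kappa>\<rfloor> * norm (f \<tau>)"
    by (simp only: norm_mult norm_power_int)
  also have "norm (cocycle \<gamma> \<tau>) powi \<lfloor>\<kappa>\<rfloor> = norm (cocycle \<gamma> \<tau>) powr (of_int \<lfloor>\<kappa>\<rfloor>)"
    using cpos by (simp add: powr_real_of_int')
  also have "of_int \<lfloor>\<kappa>\<rfloor> = \<kappa>" using True by (metis Ints_cases floor_of_int)
  finally show ?thesis .
next
  case False
  then show ?thesis using modular_forms_half_integral(1)[OF \<kappa> False M f \<gamma> \<tau>] by simp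
qed

text \<open>The Fourier expansion requires periodicity of \<open>f\<close> itself, not just of its
  modulus; for half-integral weight this rests on the periodicity of \<open>theta\<close>.\<close>

lemma modular_forms_periodic:
  assumes \<kappa>: "2 * \<kappa> \<in> \<int>" "\<kappa> \<ge> 2" and M: "\<kappa> \<notin> \<int> \<Longrightarrow> 4 dvd M"
    and f: "f \<in> modular_forms \<kappa> M" and \<tau>: "Im \<tau> > 0"
  shows "f (\<tau> + of_nat M) = f \<tau>"
proof -
  let ?T = "(1, int M, 0, 1)"
  have T: "?T \<in> principal_congruence_subgroup M"
    by (simp add: principal_congruence_subgroup_def SL2Z_iff cong_0_iff)
  have mT: "moebius ?T \<tau> = \<tau> + of_nat M" by simp
  have tr: "f (moebius ?T \<tau>) = automorphy_factor \<kappa> ?T \<tau> * f \<tau>"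
    using f T \<tau> unfolding modular_forms_def mem_Collect_eq upper_half_plane_iff[symmetric] by blast
  show ?thesis
  proof (cases "\<kappa> \<in> \<int>")
    case True
    then show ?thesis using tr by (simp add: automorphy_factor_def)
  next
    case False
    have th: "theta (\<tau> + of_nat M) = theta \<tau>" using theta_translate[of \<tau> "int M"] by simp
    show ?thesis
    proof (cases "theta \<tau> = 0")
      case True
      \<comment> \<open>At a zero of \<open>theta\<close> the factor of the identity matrix is 0 as
        well, which forces \<open>f \<tau> = 0\<close>.\<close>
      have I: "(1, 0, 0, 1) \<in> principal_congruence_subgroup M"
        by (simp add: principal_congruence_subgroup_def SL2Z_iff)
      show ?thesis
        using modular_forms_half_integral(2)[OF \<kappa> False M[OF False] f T \<tau> True]
          modular_forms_half_integral(2)[OF \<kappa> False M[OF False] f I \<tau> True] by simp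
    next
      case nz: False
      then show ?thesis using tr False th by (simp add: automorphy_factor_def)
    qed
  qed
qed

lemma modular_forms_fourier_expansion:
  assumes \<kappa>: "2 * \<kappa> \<in> \<int>" "\<kappa> \<ge> 2" and M: "M \<ge> 1" "\<kappa> \<notin> \<int> \<Longrightarrow> 4 dvd M"
    and f: "f \<in> modular_forms \<kappa> M" and \<tau>: "Im \<tau> > 0"
  shows "(\<lambda>n. fourier_coeff M f n * exp (2 * of_real pi * \<i> * of_nat n * \<tau> / of_nat M)) sums f \<tau>"
proof -
  have hol: "f holomorphic_on upper_half_plane" using f by (simp add: modular_forms_def)
  have "bounded_at_i_infinity (slash \<kappa> f (1, 0, 0, 1))"
    using f by (auto simp: modular_forms_def SL2Z_iff)
  moreover have "slash \<kappa> f (1, 0, 0, 1) = f" by (simp add: slash_def fun_eq_iff)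
  ultimately have bd: "bounded_at_i_infinity f" by simp
  obtain b where b: "\<forall>\<tau>. Im \<tau> > 0 \<longrightarrow> (\<lambda>n. b n * exp (2 * of_real pi * \<i> * of_nat n * \<tau> / of_nat M)) sums f \<tau>"
    using fourier_expansion_exists[OF _ hol modular_forms_periodic[OF \<kappa> M(2) f] bd] M(1) by auto
  then have "fourier_coeff M f = b" using M(1) by (intro fourier_coeff_eqI) auto
  then show ?thesis using b \<tau> by simp
qed

text \<open>Replacing tau by M tau makes the conditions inside the two \<open>THE\<close> terms
  equivalent, so the descriptions agree directly.\<close>

lemma fourier_coeff_rescale:
  assumes M: "M \<ge> 1"
  shows "fourier_coeff 1 (\<lambda>\<tau>. f (of_nat M * \<tau>)) = fourier_coeff M f"
proof -
  have "(\<forall>\<tau>\<in>upper_half_plane. (\<lambda>n. b n * exp (2 * of_real pi * \<i> * of_nat n * \<tau> / of_nat 1)) sums f (of_nat M * \<tau>))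
    \<longleftrightarrow> (\<forall>\<tau>\<in>upper_half_plane. (\<lambda>n. b n * exp (2 * of_real pi * \<i> * of_nat n * \<tau> / of_nat M)) sums f \<tau>)" (is "?L \<longleftrightarrow> ?R") for b
  proof
    assume L: ?L
    show ?R
    proof
      fix \<tau> assume "\<tau> \<in> upper_half_plane"
      then have "\<tau> / of_nat M \<in> upper_half_plane" using M by simp
      from bspec[OF L this] show "(\<lambda>n. b n * exp (2 * of_real pi * \<i> * of_nat n * \<tau> / of_nat M)) sums f \<tau>"
        using M by simp
    qed
  next
    assume R: ?R
    show ?L
    proof
      fix \<tau> assume "\<tau> \<in> upper_half_plane"
      then have "of_nat M * \<tau> \<in> upper_half_plane" using M by simp
      from bspec[OF R this] show "(\<lambda>n. b n * exp (2 * of_real pi * \<i> * of_nat n * \<tau> / of_nat 1)) sums f (of_nat M * \<tau>)"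
        using M by (simp add: mult_ac)
    qed
  qed
  then show ?thesis unfolding fourier_coeff_def by (simp only:)
qed

theorem theorem4p6:
  fixes \<kappa> :: real and N N' :: nat and f f' :: "complex \<Rightarrow> complex"
  assumes "2 * \<kappa> \<in> \<int>" and "\<kappa> \<ge> 2" and "N \<ge> 1"
    and "N' = (if \<kappa> \<in> \<int> then N else 4 * N)"
    and "f \<in> modular_forms \<kappa> N'" and "f \<notin> cusp_forms \<kappa> N'"
    and "\<And>n. gcd n N' > 1 \<Longrightarrow> fourier_coeff N' f n = 0"
    and "f' = (\<lambda>\<tau>. f (of_nat N' * \<tau>))"
  shows "infinite {n :: nat. odd n \<and> squarefree n \<and> fourier_coeff N' f n \<noteq> 0} \<and>
         (\<forall>n. fourier_coeff 1 f' n = fourier_coeff N' f n) \<and>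
         (\<lambda>X :: real. real (card {n :: nat. real n \<le> X \<and> squarefree n \<and> fourier_coeff 1 f' n \<noteq> 0}))
           \<in> \<Omega>(\<lambda>X. X)"
proof -
  have M: "N' \<ge> 1" "\<kappa> \<notin> \<int> \<Longrightarrow> 4 dvd N'" using assms(3,4) by auto
  interpret modular_expansion \<kappa> N' f "fourier_coeff N' f"
  proof
    show "norm (f (moebius \<gamma> \<tau>)) = norm (cocycle \<gamma> \<tau>) powr \<kappa> * norm (f \<tau>)"
      if "\<gamma> \<in> principal_congruence_subgroup N'" "Im \<tau> > 0" for \<gamma> \<tau>
      using modular_forms_transform[OF assms(1,2) M(2) assms(5) that] by blast
    show "(\<lambda>n. fourier_coeff N' f n * exp (2 * of_real pi * \<i> * of_nat n * \<tau> / of_nat N')) sums f \<tau>" if "Im \<tau> > 0" for \<tau>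
      using modular_forms_fourier_expansion[OF assms(1,2) M assms(5) that] by blast
  qed (use assms M in \<open>auto simp: modular_forms_def\<close>)
  let ?S = "{n :: nat. odd n \<and> squarefree n \<and> fourier_coeff N' f n \<noteq> 0}"
  obtain \<gamma>1 where \<gamma>1: "\<gamma>1 \<in> SL2Z" "\<not> zero_at_i_infinity (slash \<kappa> f \<gamma>1)"
    using assms(5,6) by (auto simp: cusp_forms_def)
  obtain d t0 where d: "d > 0" "t0 > 0" "\<And>t. 0 < t \<Longrightarrow> t < t0 \<Longrightarrow>
      d / t \<le> (\<Sum>n. if n \<in> ?S then exp (- real n * t) else 0)"
    using support_exp_sum_ge[OF assms(7) \<gamma>1] by blast
  obtain e X0 where e: "e > 0" "\<And>X. X \<ge> X0 \<Longrightarrow> e * X \<le> real (card {n. real n \<le> X \<and> n \<in> ?S})"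
    using counting_lower_bound[OF d] by blast
  have fin: "finite {n :: nat. real n \<le> X \<and> P n}" for X P
    by (rule finite_subset[of _ "{..nat \<lfloor>X\<rfloor>}"]) (auto simp: le_nat_floor)
  have "infinite ?S"
  proof
    assume "finite ?S"
    then have le: "real (card {n. real n \<le> X \<and> n \<in> ?S}) \<le> real (card ?S)" for X
      by (intro of_nat_mono card_mono) auto
    \<comment> \<open>Here the linear lower bound exceeds the fixed cardinality.\<close>
    define X where "X = max X0 ((real (card ?S) + 1) / e)"
    have "(real (card ?S) + 1) / e \<le> X" "X0 \<le> X" by (auto simp: X_def)
    then have "real (card ?S) + 1 \<le> e * X" using e(1) by (simp add: pos_divide_le_eq mult.commute)
    then show False using e(2)[OF \<open>X0 \<le> X\<close>] le[of X] by linarith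
  qed
  moreover have eq: "fourier_coeff 1 f' = fourier_coeff N' f"
    unfolding assms(8) by (rule fourier_coeff_rescale[OF M(1)])
  moreover have "(\<lambda>X :: real. real (card {n :: nat. real n \<le> X \<and> squarefree n \<and> fourier_coeff 1 f' n \<noteq> 0})) \<in> \<Omega>(\<lambda>X. X)"
  proof (rule landau_omega.bigI[OF e(1)])
    show "\<forall>\<^sub>F X in at_top. norm (real (card {n. real n \<le> X \<and> squarefree n \<and> fourier_coeff 1 f' n \<noteq> 0})) \<ge> e * norm X"
      \<comment> \<open>The maximum with 0 makes \<open>norm X\<close> equal to
        \<open>X\<close>.\<close>
      using eventually_ge_at_top[of "max 0 X0"]
    proof eventually_elim
      case (elim X)
      have "real (card {n. real n \<le> X \<and> n \<in> ?S}) \<le> real (card {n. real n \<le> X \<and> squarefree n \<and> fourier_coeff 1 f' n \<noteq> 0})"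
        unfolding eq by (intro of_nat_mono card_mono fin) auto
      then show ?case using e(2)[of X] elim by simp
    qed
  qed
  ultimately show ?thesis by simp
qed

end
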